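(* Assume $A=A_s$ (i.e. $A=A'$). For $\delta\in\Delta$ let $X^\delta:=X_t^\delta\otimes X_x^\delta$, where $X_t^\delta$ is the space of continuous piecewise linear functions on $I=(0,T)$ that vanish at $t=0$, with respect to the uniform partition of $I$ with mesh-size $h_\delta=\frac{T}{2N_\delta}$ for some $N_\delta\in\mathbb N$, and where $X_x^\delta\subset V$ are closed subspaces with $\bigcap_{\delta\in\Delta}X_x^\delta\neq\{0\}$. Then there is a constant $C>0$, independent of $\delta\in\Delta$, such that $$\inf_{0\neq z^\delta\in X^\delta}\ \sup_{0\neq v\in X^\delta}\frac{|(Bz^\delta)(v)|}{\|z^\delta\|_X\|v\|_Y}\le C\sqrt{h_\delta}\qquad(\delta\in\Delta).$$ Consequently, there is a constant $c>0$, independent of $\delta\in\Delta$, such that for every $\delta\in\Delta$ there exists a $u\in X$ with $u(0)=0$ and $u\notin X^\delta$, such that the Galerkin approximation $u^\delta\in X^\delta$ determined by $(Bu^\delta)(v)=(Bu)(v)$ for all $v\in X^\delta$ satisfies $$\|u-u^\delta\|_X\ge c\,h_\delta^{-1/2}\inf_{\bar u^\delta\in X^\delta}\|u-\bar u^\delta\|_X .$$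
   Context: All spaces are real. Let $V,H$ be separable Hilbert spaces (of functions on some spatial domain) with $V\hookrightarrow H$ densely and compactly; identify $H$ with its dual, giving the Gelfand triple $V\hookrightarrow H\simeq H'\hookrightarrow V'$. $\langle\cdot,\cdot\rangle$ denotes the scalar product on $H$ and also its continuous extension to the duality pairing on $V'\times V$; $\|\cdot\|$ is the norm on $H$. Let $T>0$ and $I:=(0,T)$. For a.e. $t\in I$, $a(t;\cdot,\cdot)$ is a bilinear form on $V\times V$ such that $t\mapsto a(t;\eta,\zeta)$ is measurable for all $\eta,\zeta\in V$, and, with constants independent of $t$, $|a(t;\eta,\zeta)|\lesssim\|\eta\|_V\|\zeta\|_V$ and $a(t;\eta,\eta)\gtrsim\|\eta\|_V^2$ for all $\eta,\zeta\in V$ and a.e. $t\in I$. Set $Y:=L_2(I;V)$ and $X:=L_2(I;V)\cap H^1(I;V')$; one has $X\hookrightarrow C(\bar I;H)$. Define $A\colon Y\to Y'$, $(Au)(v):=\int_I a(t;u(t),v(t))\,dt$; $B\colon X\to Y'$, $(Bw)(v):=\int_I\langle\frac{dw}{dt}(t),v(t)\rangle+a(t;w(t),v(t))\,dt$; $A_s:=\frac12(A+A')$, where $A'$ is the dual operator; and $\partial_t:=B-A\colon X\to Y'$. It is known that $u\mapsto(Bu,u(0))$ is bounded and boundedly invertible from $X$ to $Y'\times H$. $Y$ and $X$ are equipped with the energy norms $\|v\|_Y^2:=(A_sv)(v)$ and $\|u\|_X^2:=\|u\|_Y^2+\|\partial_tu\|_{Y'}^2+\|u(T)\|^2$ (equivalent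 to the standard norms), where $\|\cdot\|_{Y'}$ is dual to $\|\cdot\|_Y$. The tensor $f\otimes\eta$ of $f\in X_t^\delta$ and $\eta\in X_x^\delta$ is the function $t\mapsto f(t)\eta$. *)

theory Defs
  imports "HOL-Analysis.Analysis"
begin

text \<open>
  Elements of Lebesgue--Bochner spaces over \<open>I = (0,T)\<close> are represented by functions on
  \<open>real\<close>; only their values on \<open>I\<close> matter, and equality in such a space is equality almost
  everywhere on \<open>I\<close>. The dual of \<open>'v\<close> is \<open>'v \<Rightarrow>\<^sub>L real\<close>, and the duality pairing of \<open>g\<close>
  with \<open>\<eta>\<close> is the application of \<open>g\<close> to \<open>\<eta>\<close>. The embedding of \<open>V\<close> into \<open>H\<close> is an explicit map \<open>emb\<close>.
\<close>

definition eq_on_I :: "real \<Rightarrow> (real \<Rightarrow> 'b) \<Rightarrow> (real \<Rightarrow> 'b) \<Rightarrow> bool" where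
  "eq_on_I T u w \<longleftrightarrow> (AE t in lebesgue_on {0<..<T}. u t = w t)"

definition gelfand_embedding ::
    "('v::{real_inner,complete_space,second_countable_topology} \<Rightarrow>\<^sub>L
      'h::{real_inner,complete_space,second_countable_topology}) \<Rightarrow> bool" where
  "gelfand_embedding emb \<longleftrightarrow>
     inj (blinfun_apply emb) \<and>
     closure (range (blinfun_apply emb)) = UNIV \<and>
     compact (closure (blinfun_apply emb ` cball 0 1))"

definition H_to_dual :: "('v::real_normed_vector \<Rightarrow>\<^sub>L 'h::real_inner) \<Rightarrow> 'h \<Rightarrow> ('v \<Rightarrow>\<^sub>L real)" where
  "H_to_dual emb h = blinfun_inner_left h o\<^sub>L emb"

text \<open>
  The target spaces used below, \<open>V\<close> and its dual, are separable, so that Borel measurability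
  coincides with strong measurability.
\<close>

definition L2_space :: "real \<Rightarrow> (real \<Rightarrow> 'b::real_normed_vector) set" where
  "L2_space T = {u. u \<in> borel_measurable (lebesgue_on {0<..<T}) \<and>
                    integrable (lebesgue_on {0<..<T}) (\<lambda>t. (norm (u t))\<^sup>2)}"

definition test_functions :: "real \<Rightarrow> (real \<Rightarrow> real) set" where
  "test_functions T = {\<phi>. (\<forall>k x. ((deriv ^^ k) \<phi>) differentiable (at x)) \<and>
                          closure {t. \<phi> t \<noteq> 0} \<subseteq> {0<..<T}}"

text \<open>
  The defining identity for the distributional derivative is an equation between Bochner
  integrals with values in the dual of \<open>V\<close>; it is evaluated at each \<open>\<eta>\<close>, because the library's
  Bochner integral needs a second countable target type, which \<open>'v \<Rightarrow>\<^sub>L real\<close> is not declared to be.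
\<close>

definition weak_deriv ::
    "real \<Rightarrow> (real \<Rightarrow> ('v::real_normed_vector \<Rightarrow>\<^sub>L real)) \<Rightarrow> (real \<Rightarrow> ('v \<Rightarrow>\<^sub>L real)) \<Rightarrow> bool" where
  "weak_deriv T w g \<longleftrightarrow>
     (\<forall>\<phi>\<in>test_functions T. \<forall>\<eta>.
        (LINT t|lebesgue_on {0<..<T}. deriv \<phi> t * blinfun_apply (w t) \<eta>) =
        - (LINT t|lebesgue_on {0<..<T}. \<phi> t * blinfun_apply (g t) \<eta>))"

definition H1_dual :: "real \<Rightarrow> (real \<Rightarrow> ('v::real_normed_vector \<Rightarrow>\<^sub>L real)) set" where
  "H1_dual T = {w \<in> L2_space T. \<exists>g\<in>L2_space T. weak_deriv T w g}"

definition Y_space :: "real \<Rightarrow> (real \<Rightarrow> 'v::real_normed_vector) set" where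
  "Y_space T = L2_space T"

definition X_space ::
    "real \<Rightarrow> ('v::real_normed_vector \<Rightarrow>\<^sub>L 'h::real_inner) \<Rightarrow> (real \<Rightarrow> 'v) set" where
  "X_space T emb = {u \<in> L2_space T. (\<lambda>t. H_to_dual emb (blinfun_apply emb (u t))) \<in> H1_dual T}"

text \<open>The time derivative is unique up to equality almost everywhere on \<open>I\<close>.\<close>

definition time_deriv ::
    "real \<Rightarrow> ('v::real_normed_vector \<Rightarrow>\<^sub>L 'h::real_inner) \<Rightarrow> (real \<Rightarrow> 'v) \<Rightarrow> (real \<Rightarrow> ('v \<Rightarrow>\<^sub>L real))" where
  "time_deriv T emb u =
     (SOME g. g \<in> L2_space T \<and> weak_deriv T (\<lambda>t. H_to_dual emb (blinfun_apply emb (u t))) g)"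

text \<open>The value at \<open>s\<close> of the representative of \<open>u\<close> that is continuous on \<open>[0,T]\<close> with values in \<open>H\<close>.\<close>

definition trace_at ::
    "real \<Rightarrow> ('v::real_normed_vector \<Rightarrow>\<^sub>L 'h::real_normed_vector) \<Rightarrow> (real \<Rightarrow> 'v) \<Rightarrow> real \<Rightarrow> 'h" where
  "trace_at T emb u s =
     (THE h. \<exists>w. continuous_on {0..T} w \<and> eq_on_I T (\<lambda>t. blinfun_apply emb (u t)) w \<and> w s = h)"

definition parabolic_form :: "real \<Rightarrow> (real \<Rightarrow> 'v::real_normed_vector \<Rightarrow> 'v \<Rightarrow> real) \<Rightarrow> bool" where
  "parabolic_form T a \<longleftrightarrow>
     (AE t in lebesgue_on {0<..<T}. bilinear (a t)) \<and>
     (\<forall>\<eta> \<zeta>. (\<lambda>t. a t \<eta> \<zeta>) \<in> borel_measurable (lebesgue_on {0<..<T})) \<and>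
     (\<exists>M. AE t in lebesgue_on {0<..<T}. \<forall>\<eta> \<zeta>. \<bar>a t \<eta> \<zeta>\<bar> \<le> M * norm \<eta> * norm \<zeta>) \<and>
     (\<exists>\<alpha>>0. AE t in lebesgue_on {0<..<T}. \<forall>\<eta>. a t \<eta> \<eta> \<ge> \<alpha> * (norm \<eta>)\<^sup>2)"

definition op_A ::
    "real \<Rightarrow> (real \<Rightarrow> 'v \<Rightarrow> 'v \<Rightarrow> real) \<Rightarrow> (real \<Rightarrow> 'v) \<Rightarrow> (real \<Rightarrow> 'v) \<Rightarrow> real" where
  "op_A T a u v = (LINT t|lebesgue_on {0<..<T}. a t (u t) (v t))"

definition op_A_dual ::
    "real \<Rightarrow> (real \<Rightarrow> 'v \<Rightarrow> 'v \<Rightarrow> real) \<Rightarrow> (real \<Rightarrow> 'v) \<Rightarrow> (real \<Rightarrow> 'v) \<Rightarrow> real" where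
  "op_A_dual T a u v = op_A T a v u"

definition op_As ::
    "real \<Rightarrow> (real \<Rightarrow> 'v \<Rightarrow> 'v \<Rightarrow> real) \<Rightarrow> (real \<Rightarrow> 'v) \<Rightarrow> (real \<Rightarrow> 'v) \<Rightarrow> real" where
  "op_As T a u v = (1/2) * (op_A T a u v + op_A_dual T a u v)"

definition op_B ::
    "real \<Rightarrow> ('v::real_normed_vector \<Rightarrow>\<^sub>L 'h::real_inner) \<Rightarrow> (real \<Rightarrow> 'v \<Rightarrow> 'v \<Rightarrow> real) \<Rightarrow>
     (real \<Rightarrow> 'v) \<Rightarrow> (real \<Rightarrow> 'v) \<Rightarrow> real" where
  "op_B T emb a w v =
     (LINT t|lebesgue_on {0<..<T}. blinfun_apply (time_deriv T emb w t) (v t) + a t (w t) (v t))"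

definition op_dt ::
    "real \<Rightarrow> ('v::real_normed_vector \<Rightarrow>\<^sub>L 'h::real_inner) \<Rightarrow> (real \<Rightarrow> 'v \<Rightarrow> 'v \<Rightarrow> real) \<Rightarrow>
     (real \<Rightarrow> 'v) \<Rightarrow> (real \<Rightarrow> 'v) \<Rightarrow> real" where
  "op_dt T emb a w v = op_B T emb a w v - op_A T a w v"

definition norm_Y :: "real \<Rightarrow> (real \<Rightarrow> 'v \<Rightarrow> 'v \<Rightarrow> real) \<Rightarrow> (real \<Rightarrow> 'v) \<Rightarrow> real" where
  "norm_Y T a v = sqrt (op_As T a v v)"

definition norm_Y_dual ::
    "real \<Rightarrow> (real \<Rightarrow> 'v::real_normed_vector \<Rightarrow> 'v \<Rightarrow> real) \<Rightarrow> ((real \<Rightarrow> 'v) \<Rightarrow> real) \<Rightarrow> real" where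
  "norm_Y_dual T a F = (SUP v\<in>{v \<in> Y_space T. norm_Y T a v \<le> 1}. \<bar>F v\<bar>)"

definition norm_X ::
    "real \<Rightarrow> ('v::real_normed_vector \<Rightarrow>\<^sub>L 'h::real_inner) \<Rightarrow> (real \<Rightarrow> 'v \<Rightarrow> 'v \<Rightarrow> real) \<Rightarrow>
     (real \<Rightarrow> 'v) \<Rightarrow> real" where
  "norm_X T emb a u =
     sqrt ((norm_Y T a u)\<^sup>2 + (norm_Y_dual T a (op_dt T emb a u))\<^sup>2 + (norm (trace_at T emb u T))\<^sup>2)"

definition mesh :: "real \<Rightarrow> nat \<Rightarrow> real" where
  "mesh T N = T / (2 * real N)"

definition time_space :: "real \<Rightarrow> nat \<Rightarrow> (real \<Rightarrow> real) set" where
  "time_space T N = {f. continuous_on {0..T} f \<and> f 0 = 0 \<and>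
     (\<forall>k<2 * N. \<exists>\<alpha> \<beta>. \<forall>t\<in>{real k * mesh T N .. real (Suc k) * mesh T N}. f t = \<alpha> + \<beta> * t)}"

definition tensor_space :: "(real \<Rightarrow> real) set \<Rightarrow> 'v::real_vector set \<Rightarrow> (real \<Rightarrow> 'v) set" where
  "tensor_space F S =
     {w. \<exists>(n::nat) f \<eta>. (\<forall>i<n. f i \<in> F \<and> \<eta> i \<in> S) \<and> w = (\<lambda>t. \<Sum>i<n. f i t *\<^sub>R \<eta> i)}"

definition X_delta :: "real \<Rightarrow> nat \<Rightarrow> 'v::real_vector set \<Rightarrow> (real \<Rightarrow> 'v) set" where
  "X_delta T N S = tensor_space (time_space T N) S"

definition nonzero_in :: "real \<Rightarrow> (real \<Rightarrow> 'v::zero) set \<Rightarrow> (real \<Rightarrow> 'v) set" where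
  "nonzero_in T W = {w \<in> W. \<not> eq_on_I T w (\<lambda>t. 0)}"

definition is_galerkin ::
    "real \<Rightarrow> ('v::real_normed_vector \<Rightarrow>\<^sub>L 'h::real_inner) \<Rightarrow> (real \<Rightarrow> 'v \<Rightarrow> 'v \<Rightarrow> real) \<Rightarrow>
     (real \<Rightarrow> 'v) set \<Rightarrow> (real \<Rightarrow> 'v) \<Rightarrow> (real \<Rightarrow> 'v) \<Rightarrow> bool" where
  "is_galerkin T emb a W u w \<longleftrightarrow> w \<in> W \<and> (\<forall>v\<in>W. op_B T emb a w v = op_B T emb a u v)"

end

theory Submission
  imports Defs "HOL-Real_Asymp.Real_Asymp"
begin

text \<open>
  Let \<open>\<eta> \<noteq> 0\<close> lie in all the spaces \<open>X\<^sub>x\<^sup>\<delta>\<close>, and let \<open>z\<close> (\<open>saw\<close>) be the sawtooth function with teeth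
  of height \<open>h\<close>, times \<open>\<eta>\<close>. Its derivative \<open>\<plusminus> \<eta>\<close> has norm of order one, but against a continuous
  piecewise affine \<open>v\<close> it telescopes: \<open>(B z) v = \<integral> a(t; z, v) dt - h/2 \<langle>\<eta>, v(T)\<rangle>\<close>
  (\<open>op_B_saw_X_delta\<close>). As \<open>\<parallel>z\<parallel> \<lesssim> h\<close> and \<open>h\<^sup>1\<^sup>/\<^sup>2 \<parallel>v(T)\<parallel>\<^sub>V \<lesssim> \<parallel>v\<parallel>\<^sub>Y\<close> by an inverse inequality, the
  right-hand side is of order \<open>h\<^sup>1\<^sup>/\<^sup>2 \<parallel>v\<parallel>\<^sub>Y\<close>, which is the inf-sup bound (\<open>inf_sup_le\<close>).

  For the second claim a function \<open>w\<close> with \<open>w(0) = 0\<close>, \<open>\<parallel>w\<parallel>\<^sub>X \<lesssim> h\<^sup>1\<^sup>/\<^sup>2\<close> and \<open>(B w) v = (B z) v\<close> for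
  all \<open>v\<close> in the discrete space is needed. Then \<open>u = z - w\<close> (\<open>err\<close>) is orthogonal to the discrete
  space, so that its Galerkin approximation is zero, and its distance to the discrete space is
  at most \<open>\<parallel>w\<parallel>\<^sub>X \<lesssim> h\<^sup>1\<^sup>/\<^sup>2\<close>, whereas \<open>\<parallel>u\<parallel>\<^sub>X\<close> is bounded from below: \<open>(B u) v = (T - h/2) \<parallel>\<eta>\<parallel>\<^sup>2\<close> for
  the discontinuous test function \<open>v = \<plusminus> \<eta>\<close> (\<open>op_B_err_saw_slope\<close>).

  The function \<open>w\<close> (\<open>sol\<close>) is not obtained from the well-posedness of the parabolic problem but
  from a discontinuous Galerkin time stepping scheme with values in the full space \<open>V\<close>, driven
  by the right-hand side of the identity above and tested with all piecewise affine functions,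
  continuous or not. Each step is an application of the Lax--Milgram theorem on \<open>V \<times> V\<close>
  (\<open>step_exists\<close>). The jumps of the discontinuous solution are smoothed by a profile
  (\<open>radau_profile\<close>) whose derivative acts on affine functions like a point evaluation, so that
  the kinetic part of the scheme is reproduced exactly by a continuous function, and whose \<open>L\<^sub>2\<close>
  norm is so small that coercivity survives. Testing with the solution gives the energy
  estimate (\<open>energy\<close>); the equation on each cell then bounds the derivative in the dual norm
  (\<open>sol'_dual\<close>).

  Since all functions involved are continuous and piecewise smooth in time, weak derivatives
  and traces can be computed (\<open>op_B_eq\<close>, \<open>trace_at_eq\<close>); uniqueness of weak derivatives rests on
  the fundamental lemma of the calculus of variations.
\<close>

section \<open>Test functions and the fundamental lemma of the calculus of variations\<close>

text \<open>The functions \<open>p (1/x) exp (-1/x)\<close>, extended by zero to the left of the origin. They are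
  closed under differentiation, whence smooth.\<close>

definition flat_exp :: "real poly \<Rightarrow> real \<Rightarrow> real" where
  "flat_exp p x = (if x > 0 then poly p (1/x) * exp (-(1/x)) else 0)"

lemma poly_div_exp_tendsto_0: "((\<lambda>y. poly p y / exp (y::real)) \<longlongrightarrow> 0) at_top"
proof -
  have "((\<lambda>y. \<Sum>i\<le>degree p. coeff p i * (y ^ i / exp y)) \<longlongrightarrow> (\<Sum>i\<le>degree p. coeff p i * 0)) at_top"
    by (intro tendsto_sum tendsto_mult tendsto_const tendsto_power_div_exp_0)
  then show ?thesis
    by (simp add: poly_altdef sum_divide_distrib)
qed

lemma flat_exp_deriv:
  "(flat_exp p has_real_derivative flat_exp ([:0,0,1:] * (p - pderiv p)) x) (at x)"
proof -
  let ?q = "[:0,0,1:] * (p - pderiv p)"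
  consider "x > 0" | "x < 0" | "x = 0" by linarith
  then show ?thesis
  proof cases
    case 1
    have inv: "((\<lambda>x. 1 / x) has_real_derivative - (1 / x^2)) (at x)"
      using DERIV_inverse[of x] 1 by (simp add: inverse_eq_divide power2_eq_square)
    have "((\<lambda>x. poly p (1/x) * exp (-(1/x))) has_real_derivative
      poly (pderiv p) (1/x) * (- (1/x^2)) * exp (-(1/x)) + exp (-(1/x)) * (- (- (1/x^2))) * poly p (1/x)) (at x)"
      by (intro DERIV_mult DERIV_chain2[OF poly_DERIV inv] DERIV_chain2[OF DERIV_exp DERIV_minus[OF inv]])
    moreover have "poly (pderiv p) (1/x) * (- (1/x^2)) * exp (-(1/x)) + exp (-(1/x)) * (- (- (1/x^2))) * poly p (1/x)
        = flat_exp ?q x"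
      unfolding flat_exp_def using 1 by (simp add: power2_eq_square algebra_simps)
    ultimately have "((\<lambda>x. poly p (1/x) * exp (-(1/x))) has_real_derivative flat_exp ?q x) (at x)"
      by (simp only:)
    moreover have "\<forall>\<^sub>F y in nhds x. flat_exp p y = poly p (1/y) * exp (-(1/y))"
      using eventually_nhds_in_open[of "{0<..}" x] 1
      by (auto elim!: eventually_mono simp: flat_exp_def)
    ultimately show ?thesis
      by (simp only: DERIV_cong_ev[OF refl _ refl])
  next
    case 2
    have "((\<lambda>x. 0) has_real_derivative flat_exp ?q x) (at x)"
      unfolding flat_exp_def using 2 by auto
    moreover have "\<forall>\<^sub>F y in nhds x. flat_exp p y = 0"
      using eventually_nhds_in_open[of "{..<0}" x] 2
      by (auto elim!: eventually_mono simp: flat_exp_def)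
    ultimately show ?thesis
      by (simp only: DERIV_cong_ev[OF refl _ refl])
  next
    case 3
    have "((\<lambda>h. (flat_exp p (0 + h) - flat_exp p 0) / h) \<longlongrightarrow> 0) (at_right 0)"
    proof -
      have "((\<lambda>h. poly ([:0,1:] * p) (inverse h) / exp (inverse h)) \<longlongrightarrow> 0) (at_right (0::real))"
        by (rule filterlim_compose[OF poly_div_exp_tendsto_0 filterlim_inverse_at_top_right])
      moreover have "\<forall>\<^sub>F h in at_right 0.
          poly ([:0,1:] * p) (inverse h) / exp (inverse h) = (flat_exp p (0 + h) - flat_exp p 0) / h"
      proof -
        have "poly ([:0,1:] * p) (inverse h) / exp (inverse h) = (flat_exp p (0 + h) - flat_exp p 0) / h" if "h > 0" for h
        proof -
          have "exp (- (1/h)) = 1 / exp (1/h)" by (simp add: exp_minus inverse_eq_divide)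
          then show ?thesis using that unfolding flat_exp_def inverse_eq_divide by (simp add: mult.commute)
        qed
        then show ?thesis by (rule eventually_mono[OF eventually_at_right_less])
      qed
      ultimately show ?thesis by (rule Lim_transform_eventually)
    qed
    moreover have "((\<lambda>h. (flat_exp p (0 + h) - flat_exp p 0) / h) \<longlongrightarrow> 0) (at_left 0)"
    proof -
      have "\<forall>\<^sub>F h in at_left 0. 0 = (flat_exp p (0 + h) - flat_exp p 0) / h"
        unfolding eventually_at_left_field
        by (intro exI[of _ "-1"]) (auto simp: flat_exp_def)
      then show ?thesis by (rule Lim_transform_eventually[OF tendsto_const])
    qed
    ultimately show ?thesis
      using 3 by (simp add: DERIV_def filterlim_at_split flat_exp_def)
  qed
qed

text \<open>Sums of products of a flat function that starts at \<open>a\<close> and one that ends at \<open>b\<close>. This class is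
  closed under differentiation, so that its members are smooth; they are supported in
  \<open>[a,b]\<close>. The factor \<open>c\<close> is sent to infinity to approximate indicator functions.\<close>

definition bump_sum :: "real \<Rightarrow> real \<Rightarrow> real \<Rightarrow> (real poly \<times> real poly) list \<Rightarrow> real \<Rightarrow> real" where
  "bump_sum c a b ps x = (\<Sum>(p,q)\<leftarrow>ps. flat_exp p (c * (x - a)) * flat_exp q (c * (b - x)))"

lemma bump_sum_deriv: "\<exists>qs. \<forall>x. (bump_sum c a b ps has_real_derivative bump_sum c a b qs x) (at x)"
proof (induction ps)
  case Nil
  show ?case by (rule exI[of _ "[]"]) (simp add: bump_sum_def[abs_def])
next
  case (Cons pq ps)
  then obtain qs where qs: "\<And>x. (bump_sum c a b ps has_real_derivative bump_sum c a b qs x) (at x)"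
    by blast
  obtain p q where pq: "pq = (p, q)" by force
  let ?p = "smult c ([:0,0,1:] * (p - pderiv p))" and ?q = "smult (-c) ([:0,0,1:] * (q - pderiv q))"
  have smult: "flat_exp (smult d r) y = d * flat_exp r y" for d r y by (simp add: flat_exp_def)
  have eq: "bump_sum c a b (pq # ps) = (\<lambda>x. flat_exp p (c * (x - a)) * flat_exp q (c * (b - x)) + bump_sum c a b ps x)"
    by (auto simp: bump_sum_def pq)
  have "(bump_sum c a b (pq # ps) has_real_derivative bump_sum c a b ((?p, q) # (p, ?q) # qs) x) (at x)" for x
  proof -
    have 1: "((\<lambda>x. flat_exp p (c * (x - a))) has_real_derivative flat_exp ?p (c * (x - a))) (at x)"
      unfolding smult
      by (rule DERIV_cong[OF DERIV_chain2[OF flat_exp_deriv]]) (auto intro!: derivative_eq_intros)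
    have 2: "((\<lambda>x. flat_exp q (c * (b - x))) has_real_derivative flat_exp ?q (c * (b - x))) (at x)"
      unfolding smult
      by (rule DERIV_cong[OF DERIV_chain2[OF flat_exp_deriv]]) (auto intro!: derivative_eq_intros)
    show ?thesis unfolding eq
      by (rule DERIV_cong[OF DERIV_add[OF DERIV_mult[OF 1 2] qs]]) (simp add: bump_sum_def)
  qed
  then show ?case by blast
qed

lemma bump_sum_smooth: "((deriv ^^ k) (bump_sum c a b ps)) differentiable (at x)"
proof -
  have "\<exists>qs. (deriv ^^ k) (bump_sum c a b ps) = bump_sum c a b qs"
  proof (induction k)
    case 0 show ?case by auto
  next
    case (Suc k)
    then obtain qs where "(deriv ^^ k) (bump_sum c a b ps) = bump_sum c a b qs" by blast
    moreover obtain rs where "\<And>x. (bump_sum c a b qs has_real_derivative bump_sum c a b rs x) (at x)"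
      using bump_sum_deriv by blast
    then have "deriv (bump_sum c a b qs) = bump_sum c a b rs"
      using DERIV_imp_deriv by blast
    ultimately show ?case by auto
  qed
  then show ?thesis
    using bump_sum_deriv real_differentiable_def by metis
qed

lemma test_functions_bump:
  assumes "0 < a" "b < T" "c > 0"
  shows "bump_sum c a b [(1,1)] \<in> test_functions T"
proof -
  have "{t. bump_sum c a b [(1,1)] t \<noteq> 0} \<subseteq> {a..b}"
    using assms(3) by (auto simp: bump_sum_def flat_exp_def zero_less_mult_iff split: if_splits)
  then have "closure {t. bump_sum c a b [(1,1)] t \<noteq> 0} \<subseteq> {a..b}"
    by (simp add: closure_minimal)
  then show ?thesis
    using assms bump_sum_smooth unfolding test_functions_def by fastforce
qed

text \<open>By completeness of Lebesgue measure, neither measurability nor the value of an integral is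
  affected by a change on a null set, whether or not the new function is known to be measurable.\<close>

lemma borel_measurable_lebesgue_on_AE:
  fixes f g :: "'a::euclidean_space \<Rightarrow> 'b::topological_space"
  assumes S: "S \<in> sets lebesgue" and f: "f \<in> borel_measurable (lebesgue_on S)"
    and ae: "AE x in lebesgue_on S. f x = g x"
  shows "g \<in> borel_measurable (lebesgue_on S)"
proof (rule measurableI)
  fix X :: "'b set" assume X: "X \<in> sets borel"
  have "f -` X \<inter> S \<in> sets lebesgue"
    using measurable_sets[OF f X] S by (simp add: sets_restrict_space_iff)
  moreover have "AE x in lebesgue. x \<in> f -` X \<inter> S \<longleftrightarrow> x \<in> g -` X \<inter> S"
    using ae S by (auto simp: AE_restrict_space_iff elim!: eventually_mono)
  ultimately have "g -` X \<inter> S \<in> sets lebesgue"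
    using completion.in_sets_AE[where M=lborel and A="f -` X \<inter> S" and B="g -` X \<inter> S"] by simp
  then show "g -` X \<inter> space (lebesgue_on S) \<in> sets (lebesgue_on S)"
    using S by (simp add: sets_restrict_space_iff)
qed simp

lemma integral_lebesgue_on_cong_AE:
  fixes f g :: "'a::euclidean_space \<Rightarrow> real"
  assumes S: "S \<in> sets lebesgue" and ae: "AE x in lebesgue_on S. f x = g x"
  shows "(LINT x|lebesgue_on S. f x) = (LINT x|lebesgue_on S. g x)"
proof (cases "f \<in> borel_measurable (lebesgue_on S)")
  case True
  then show ?thesis
    using integral_cong_AE[OF True borel_measurable_lebesgue_on_AE[OF S True ae] ae] by blast
next
  case False
  have "AE x in lebesgue_on S. g x = f x" using ae by auto
  then have "g \<notin> borel_measurable (lebesgue_on S)"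
    using False borel_measurable_lebesgue_on_AE[OF S] by blast
  then show ?thesis
    using False borel_measurable_integrable not_integrable_integral_eq by metis
qed

lemma AE_zero_if_half_line_integrals_zero:
  fixes G :: "real \<Rightarrow> real"
  assumes G: "integrable lebesgue G"
    and z: "\<And>a. (LINT x|lebesgue. indicator {a<..} x * G x) = 0"
  shows "AE x in lebesgue. G x = 0"
proof -
  obtain g where g [measurable]: "g \<in> borel_measurable lborel" and ae: "AE x in lborel. G x = g x"
    using completion_ex_borel_measurable_real[OF borel_measurable_integrable[OF G]] by blast
  have ae': "AE x in lebesgue. G x = g x" by (rule AE_completion[OF ae])
  have gm: "g \<in> borel_measurable lebesgue" by (rule measurable_completion[OF g])
  have "integrable lebesgue g"
    using integrable_cong_AE[OF borel_measurable_integrable[OF G] gm ae'] G by blast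
  then have ig: "integrable lborel g" by (simp add: integrable_completion)
  have half: "(\<integral>\<^sup>+x. ennreal (indicator {a<..} x * g x) \<partial>lborel) = (\<integral>\<^sup>+x. ennreal (- (indicator {a<..} x * g x)) \<partial>lborel)"
    and fin: "(\<integral>\<^sup>+x. ennreal (indicator {a<..} x * g x) \<partial>lborel) < \<infinity>" for a
  proof -
    have i: "integrable lborel (\<lambda>x. indicator {a<..} x * g x)"
      using integrable_mult_indicator[OF _ ig, of "{a<..}"] by simp
    have "(LINT x|lborel. indicator {a<..} x * g x) = (LINT x|lebesgue. indicator {a<..} x * g x)"
      by (rule integral_completion[symmetric]) simp
    also have "\<dots> = (LINT x|lebesgue. indicator {a<..} x * G x)"
    proof (intro integral_cong_AE borel_measurable_times borel_measurable_integrable[OF G] gm)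
      show "(indicator {a<..} :: real \<Rightarrow> real) \<in> borel_measurable lebesgue"
        by (rule borel_measurable_indicator) simp
      then show "(indicator {a<..} :: real \<Rightarrow> real) \<in> borel_measurable lebesgue" .
      show "AE x in lebesgue. indicator {a<..} x * g x = indicator {a<..} x * G x"
        using ae' by eventually_elim simp
    qed
    finally have "(LINT x|lborel. indicator {a<..} x * g x) = 0" by (simp only: z)
    then have "enn2real (\<integral>\<^sup>+x. ennreal (indicator {a<..} x * g x) \<partial>lborel)
        = enn2real (\<integral>\<^sup>+x. ennreal (- (indicator {a<..} x * g x)) \<partial>lborel)"
      using real_lebesgue_integral_def[OF i] by linarith
    moreover have f: "(\<integral>\<^sup>+x. ennreal (indicator {a<..} x * g x) \<partial>lborel) < \<infinity>"
      "(\<integral>\<^sup>+x. ennreal (- (indicator {a<..} x * g x)) \<partial>lborel) < \<infinity>"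
      using i unfolding real_integrable_def by (auto simp: less_top)
    ultimately show "(\<integral>\<^sup>+x. ennreal (indicator {a<..} x * g x) \<partial>lborel) = (\<integral>\<^sup>+x. ennreal (- (indicator {a<..} x * g x)) \<partial>lborel)"
      by (metis ennreal_enn2real infinity_ennreal_def)
    show "(\<integral>\<^sup>+x. ennreal (indicator {a<..} x * g x) \<partial>lborel) < \<infinity>" by (rule f(1))
  qed
  have em: "emeasure (density lborel (\<lambda>x. ennreal (f x))) {a<..} = (\<integral>\<^sup>+x. ennreal (indicator {a<..} x * f x) \<partial>lborel)"
    if "f \<in> borel_measurable lborel" for f and a :: real
    using that by (subst emeasure_density) (auto intro!: nn_integral_cong simp: indicator_def)
  have "density lborel (\<lambda>x. ennreal (g x)) = density lborel (\<lambda>x. ennreal (- g x))"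
    by (rule measure_eqI_lessThan; (subst em)?; (subst em)?) (use half fin in simp_all)
  then have "AE x in lborel. ennreal (g x) = ennreal (- g x)"
    by (rule sigma_finite_measure.density_unique[OF lborel.sigma_finite_measure_axioms, rotated 2]) auto
  then have "AE x in lborel. g x = 0"
  proof eventually_elim
    case (elim x)
    then show ?case by (cases "g x \<ge> 0") (auto simp: ennreal_neg)
  qed
  with ae have "AE x in lborel. G x = 0" by eventually_elim simp
  then show ?thesis by (rule AE_completion)
qed

lemma fundamental_lemma_variations:
  fixes g :: "real \<Rightarrow> real"
  assumes g: "integrable (lebesgue_on {0<..<T}) g"
    and z: "\<And>\<phi>. \<phi> \<in> test_functions T \<Longrightarrow> (LINT t|lebesgue_on {0<..<T}. \<phi> t * g t) = 0"
  shows "AE t in lebesgue_on {0<..<T}. g t = 0"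
proof -
  define G where "G t = (if t \<in> {0<..<T} then g t else 0)" for t
  have G: "integrable lebesgue G"
    unfolding G_def using Lebesgue_Measure.integrable_restrict_UNIV[of "{0<..<T}" g] g by simp
  have "AE x in lebesgue. G x = 0"
  proof (rule AE_zero_if_half_line_integrals_zero[OF G])
    fix a :: real
    define a' b' where "a' = max a 0" and "b' = T"
    \<comment> \<open>test functions that are bounded by one and converge to the indicator of the interval\<close>
    define \<phi> where "\<phi> n = bump_sum (real (Suc n)) (a' + 1 / real (Suc n)) (b' - 1 / real (Suc n)) [(1,1)]" for n
    have phi: "\<phi> n \<in> test_functions T" for n
    proof -
      have "1 / real (Suc n) > 0" "a' \<ge> 0" "b' \<le> T" by (simp_all add: a'_def b'_def)
      then show ?thesis unfolding \<phi>_def by (intro test_functions_bump) linarith+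
    qed
    have phi_eq: "\<phi> n x = flat_exp 1 (real (Suc n) * (x - a') - 1) * flat_exp 1 (real (Suc n) * (b' - x) - 1)" for n x
    proof -
      have "real (Suc n) * (x - (a' + 1 / real (Suc n))) = real (Suc n) * (x - a') - 1"
        "real (Suc n) * (b' - 1 / real (Suc n) - x) = real (Suc n) * (b' - x) - 1"
        by (simp_all add: field_simps del: of_nat_Suc)
      then show ?thesis by (simp add: \<phi>_def bump_sum_def del: of_nat_Suc)
    qed
    have fl: "0 \<le> flat_exp 1 x" "flat_exp 1 x \<le> 1" for x
      by (auto simp: flat_exp_def)
    have lim1: "(\<lambda>n. flat_exp 1 (real (Suc n) * y - 1)) \<longlonglongrightarrow> 1" if "y > 0" for y
    proof -
      have *: "filterlim (\<lambda>n. real (Suc n) * y - 1) at_top sequentially"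
        using that by real_asymp
      have "((\<lambda>x. exp (-(1/x))) \<longlongrightarrow> 1) (at_top :: real filter)"
        by real_asymp
      from filterlim_compose[OF this *]
      have "(\<lambda>n. exp (- (1 / (real (Suc n) * y - 1)))) \<longlonglongrightarrow> 1" .
      moreover have "\<forall>\<^sub>F n in sequentially. exp (- (1 / (real (Suc n) * y - 1))) = flat_exp 1 (real (Suc n) * y - 1)"
        using filterlim_at_top_dense[THEN iffD1, OF *, rule_format, of 0]
        by eventually_elim (simp add: flat_exp_def)
      ultimately show ?thesis by (rule Lim_transform_eventually)
    qed
    have lim0: "flat_exp 1 (real (Suc n) * y - 1) = 0" if "y \<le> 0" for n y
    proof -
      have "real (Suc n) * y \<le> 0" using that by (simp add: mult_nonneg_nonpos)
      then show ?thesis by (simp add: flat_exp_def)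
    qed
    have lim: "(\<lambda>n. \<phi> n x) \<longlonglongrightarrow> indicator {a'<..<b'} x" for x
    proof -
      consider "x \<le> a'" | "x \<ge> b'" | "a' < x" "x < b'" by linarith
      then show ?thesis
      proof cases
        case 1
        then show ?thesis by (auto simp: phi_eq lim0 simp del: of_nat_Suc)
      next
        case 2
        then show ?thesis by (auto simp: phi_eq lim0 simp del: of_nat_Suc)
      next
        case 3
        then show ?thesis
          unfolding phi_eq using tendsto_mult[OF lim1[of "x-a'"] lim1[of "b'-x"]] by simp
      qed
    qed
    have meas: "\<phi> n \<in> borel_measurable lebesgue" for n
    proof -
      have "\<phi> n differentiable at x" for x
        using phi[of n] unfolding test_functions_def by (auto dest!: spec[of _ "0::nat"])
      then have "continuous_on UNIV (\<phi> n)"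
        by (simp add: continuous_on_eq_continuous_at differentiable_imp_continuous_within)
      then show ?thesis
        using measurable_completion[of "\<phi> n" lborel borel] borel_measurable_continuous_onI[of "\<phi> n"] by simp
    qed
    have "(\<lambda>n. LINT x|lebesgue. \<phi> n x * G x) \<longlonglongrightarrow> (LINT x|lebesgue. indicator {a'<..<b'} x * G x)"
    proof (rule integral_dominated_convergence[where w="\<lambda>x. \<bar>G x\<bar>"])
      show "AE x in lebesgue. (\<lambda>n. \<phi> n x * G x) \<longlonglongrightarrow> indicator {a'<..<b'} x * G x"
        using lim by (intro AE_I2 tendsto_mult tendsto_const)
      show "AE x in lebesgue. norm (\<phi> n x * G x) \<le> \<bar>G x\<bar>" for n
      proof (rule AE_I2)
        fix x
        have "\<bar>\<phi> n x\<bar> \<le> 1"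
          unfolding phi_eq abs_mult using fl by (intro mult_le_one) auto
        then show "norm (\<phi> n x * G x) \<le> \<bar>G x\<bar>"
          by (simp add: abs_mult mult_left_le_one_le)
      qed
    next
      show "(\<lambda>x. indicator {a'<..<b'} x * G x) \<in> borel_measurable lebesgue"
      proof -
        have "{a'<..<b'} \<in> sets lebesgue" by simp
        from borel_measurable_integrable[OF integrable_mult_indicator[OF this G]] show ?thesis by simp
      qed
    qed (use G meas in auto)
    moreover have "(LINT x|lebesgue. \<phi> n x * G x) = 0" for n
    proof -
      have "(LINT x|lebesgue. \<phi> n x * G x) = (LINT x|lebesgue. (if x \<in> {0<..<T} then \<phi> n x * g x else 0))"
        by (intro Bochner_Integration.integral_cong) (auto simp: G_def)
      also have "\<dots> = (LINT t|lebesgue_on {0<..<T}. \<phi> n t * g t)"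
        by (rule Lebesgue_Measure.integral_restrict_UNIV) simp
      finally show ?thesis using z[OF phi] by simp
    qed
    ultimately have "(LINT x|lebesgue. indicator {a'<..<b'} x * G x) = 0"
      by (simp add: LIMSEQ_const_iff)
    moreover have "indicator {a'<..<b'} x * G x = indicator {a<..} x * G x" for x
      by (auto simp: G_def indicator_def a'_def b'_def)
    ultimately show "(LINT x|lebesgue. indicator {a<..} x * G x) = 0" by simp
  qed
  then show ?thesis
    by (auto simp: AE_restrict_space_iff G_def elim!: eventually_mono)
qed

section \<open>Square integrable functions and form integrals\<close>

lemma continuous_on_imp_measurable_lebesgue_on:
  fixes f :: "real \<Rightarrow> 'b::topological_space"
  assumes "continuous_on S f"
  shows "f \<in> borel_measurable (lebesgue_on S)"
proof -
  have "f \<in> borel_measurable (restrict_space borel S)"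
    using assms by (rule borel_measurable_continuous_on_restrict)
  moreover have "(\<lambda>x. x) \<in> measurable (lebesgue_on S) (restrict_space borel S)"
    by (rule measurable_restrict_space3) (auto intro: measurable_completion)
  ultimately show ?thesis by (rule measurable_compose[rotated])
qed

lemma continuous_compose_measurable:
  assumes "f \<in> borel_measurable X" "continuous_on UNIV J"
  shows "(\<lambda>t. J (f t)) \<in> borel_measurable X"
  using borel_measurable_continuous_on[OF assms(2,1)] .

lemma le_sqrt_mult_if_scaled:
  fixes x A B :: real
  assumes "A \<ge> 0" "B \<ge> 0" and le: "\<And>l. l > 0 \<Longrightarrow> x \<le> (A / l + l * B) / 2"
  shows "x \<le> sqrt A * sqrt B"
proof (rule field_le_epsilon)
  fix e :: real assume e: "e > 0"
  have lim: "((\<lambda>d. sqrt (A + d) * sqrt (B + d)) \<longlongrightarrow> sqrt (A + 0) * sqrt (B + 0)) (at_right 0)"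
    by (intro tendsto_intros)
  then have "\<forall>\<^sub>F d in at_right 0. sqrt (A + d) * sqrt (B + d) < sqrt A * sqrt B + e"
    using e by (intro order_tendstoD) auto
  moreover have "\<forall>\<^sub>F d in at_right (0::real). d > 0" by (rule eventually_at_right_less)
  ultimately have "\<forall>\<^sub>F d in at_right 0. d > 0 \<and> sqrt (A + d) * sqrt (B + d) < sqrt A * sqrt B + e"
    by eventually_elim simp
  then obtain d where d: "d > 0" "sqrt (A + d) * sqrt (B + d) < sqrt A * sqrt B + e"
    using eventually_happens[of _ "at_right (0::real)"] by (auto simp: trivial_limit_at_right_real)
  define p q where "p = sqrt (A + d)" and "q = sqrt (B + d)"
  have pq: "p > 0" "q > 0" "A \<le> p * p" "B \<le> q * q" using assms(1,2) d by (auto simp: p_def q_def)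
  have "x \<le> (A / (p / q) + p / q * B) / 2" using pq by (intro le) simp
  also have "\<dots> \<le> ((p * p) / (p / q) + p / q * (q * q)) / 2"
    using pq by (intro divide_right_mono add_mono mult_left_mono) auto
  also have "\<dots> = p * q" using pq by (simp add: field_simps)
  finally show "x \<le> sqrt A * sqrt B + e" using d by (simp add: p_def q_def)
qed

text \<open>The norm of \<open>L\<^sub>2(I)\<close> with values in a normed space.\<close>

definition L2n :: "real \<Rightarrow> (real \<Rightarrow> 'b::real_normed_vector) \<Rightarrow> real" where
  "L2n T u = sqrt (LINT t|lebesgue_on {0<..<T}. (norm (u t))\<^sup>2)"

lemma L2n_nonneg [simp]: "L2n T u \<ge> 0"
  by (simp add: L2n_def)

lemma L2n_power2: "(L2n T u)\<^sup>2 = (LINT t|lebesgue_on {0<..<T}. (norm (u t))\<^sup>2)"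
  by (simp add: L2n_def)

lemma finite_measure_interval: "finite_measure (lebesgue_on {0<..<T::real})"
  by (rule finite_measure_lebesgue_on) simp

lemma integrable_bounded_interval:
  fixes f :: "real \<Rightarrow> real"
  assumes "f \<in> borel_measurable (lebesgue_on {0<..<T})" "\<And>t. t \<in> {0<..<T} \<Longrightarrow> \<bar>f t\<bar> \<le> K"
  shows "integrable (lebesgue_on {0<..<T}) f"
  by (rule finite_measure.integrable_const_bound[OF finite_measure_interval _ assms(1), of K])
     (use assms(2) in \<open>auto intro!: AE_I2\<close>)

text \<open>The Cauchy--Schwarz inequality, for integrands that are only dominated by a product.\<close>

lemma integral_product_le:
  fixes f :: "real \<Rightarrow> real"
  assumes u: "u \<in> L2_space T" and v: "v \<in> L2_space T" and C: "C \<ge> 0"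
    and f: "f \<in> borel_measurable (lebesgue_on {0<..<T})"
    and bd: "AE t in lebesgue_on {0<..<T}. \<bar>f t\<bar> \<le> C * norm (u t) * norm (v t)"
  shows "integrable (lebesgue_on {0<..<T}) f"
    and "\<bar>LINT t|lebesgue_on {0<..<T}. f t\<bar> \<le> C * L2n T u * L2n T v"
proof -
  let ?m = "lebesgue_on {0<..<T}"
  have iu: "integrable ?m (\<lambda>t. (norm (u t))\<^sup>2)" and iv: "integrable ?m (\<lambda>t. (norm (v t))\<^sup>2)"
    using u v by (auto simp: L2_space_def)
  have young: "AE t in ?m. \<bar>f t\<bar> \<le> (C / 2) * ((norm (u t))\<^sup>2 / l + l * (norm (v t))\<^sup>2)" if "l > 0" for l
    using bd
  proof eventually_elim
    case (elim t)
    have "0 \<le> (norm (u t) - l * norm (v t))\<^sup>2 / l" using that by simp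
    also have "\<dots> = (norm (u t))\<^sup>2 / l - 2 * norm (u t) * norm (v t) + l * (norm (v t))\<^sup>2"
      using that by (simp add: power2_eq_square field_simps)
    finally have "norm (u t) * norm (v t) \<le> (1/2) * ((norm (u t))\<^sup>2 / l + l * (norm (v t))\<^sup>2)" by simp
    from mult_left_mono[OF this C] elim show ?case by (simp add: mult.assoc)
  qed
  have iy: "integrable ?m (\<lambda>t. (C / 2) * ((norm (u t))\<^sup>2 / l + l * (norm (v t))\<^sup>2))" for l
    using iu iv by simp
  show if1: "integrable ?m f"
    by (rule Bochner_Integration.integrable_bound[OF iy[of 1] f]) (use young[of 1] in \<open>auto elim!: eventually_mono\<close>)
  have "\<bar>LINT t|?m. f t\<bar> \<le> ((C * (L2n T u)\<^sup>2) / l + l * (C * (L2n T v)\<^sup>2)) / 2" if "l > 0" for l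
  proof -
    have "\<bar>LINT t|?m. f t\<bar> \<le> (LINT t|?m. \<bar>f t\<bar>)"
      using if1 integral_norm_bound[of ?m f] by simp
    also have "\<dots> \<le> (LINT t|?m. (C / 2) * ((norm (u t))\<^sup>2 / l + l * (norm (v t))\<^sup>2))"
      using if1 iy young[OF that] by (intro integral_mono_AE) auto
    also have "\<dots> = (C / 2) * ((L2n T u)\<^sup>2 / l + l * (L2n T v)\<^sup>2)"
      unfolding L2n_power2 using iu iv by simp
    finally show ?thesis by (simp add: field_simps)
  qed
  then have "\<bar>LINT t|?m. f t\<bar> \<le> sqrt (C * (L2n T u)\<^sup>2) * sqrt (C * (L2n T v)\<^sup>2)"
    using C by (intro le_sqrt_mult_if_scaled) auto
  also have "\<dots> = C * L2n T u * L2n T v"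
    using C by (simp add: real_sqrt_mult)
  finally show "\<bar>LINT t|?m. f t\<bar> \<le> C * L2n T u * L2n T v" .
qed

lemma L2_space_bounded:
  assumes "u \<in> borel_measurable (lebesgue_on {0<..<T})" "\<And>t. t \<in> {0<..<T} \<Longrightarrow> norm (u t) \<le> K"
  shows "u \<in> L2_space T"
proof -
  have "\<bar>(norm (u t))\<^sup>2\<bar> \<le> K\<^sup>2" if "t \<in> {0<..<T}" for t
    using assms(2)[OF that] by (simp add: power_mono)
  then show ?thesis
    unfolding L2_space_def using assms(1) integrable_bounded_interval[of "\<lambda>t. (norm (u t))\<^sup>2" T "K\<^sup>2"]
    by (simp add: borel_measurable_power borel_measurable_norm)
qed

lemma L2_space_cmult:
  fixes u :: "real \<Rightarrow> 'b::{real_normed_vector,second_countable_topology}"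
  assumes "u \<in> L2_space T"
  shows "(\<lambda>t. c *\<^sub>R u t) \<in> L2_space T"
  using assms by (auto simp: L2_space_def power_mult_distrib intro!: borel_measurable_scaleR)

lemma L2n_cmult: "L2n T (\<lambda>t. c *\<^sub>R u t) = \<bar>c\<bar> * L2n T u"
  by (simp add: L2n_def power_mult_distrib real_sqrt_mult)

text \<open>A measurable form that is bounded and coercive for almost every time, with explicit
  constants.\<close>

locale coercive_form =
  fixes T :: real
    and a :: "real \<Rightarrow> 'v::{real_inner,complete_space,second_countable_topology} \<Rightarrow> 'v \<Rightarrow> real"
    and M \<alpha> :: real
  assumes T_pos: "T > 0" and M_pos: "M > 0" and alpha_pos: "\<alpha> > 0"
    and form_measurable: "\<And>\<eta> \<zeta>. (\<lambda>t. a t \<eta> \<zeta>) \<in> borel_measurable (lebesgue_on {0<..<T})"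
    and form_bilinear: "AE t in lebesgue_on {0<..<T}. bilinear (a t)"
    and form_bounded: "AE t in lebesgue_on {0<..<T}. \<forall>\<eta> \<zeta>. \<bar>a t \<eta> \<zeta>\<bar> \<le> M * norm \<eta> * norm \<zeta>"
    and form_coercive: "AE t in lebesgue_on {0<..<T}. \<forall>\<eta>. a t \<eta> \<eta> \<ge> \<alpha> * (norm \<eta>)\<^sup>2"
begin

abbreviation \<mu> :: "real measure" where "\<mu> \<equiv> lebesgue_on {0<..<T}"

lemma interval_sets [simp, intro]: "{0<..<T} \<in> sets lebesgue" by simp

sublocale fm: finite_measure \<mu> by (rule finite_measure_interval)

text \<open>Approximation of the arguments by simple functions and continuity of the form in its
  arguments give measurability of its composition with measurable functions.\<close>

lemma form_comp_measurable:
  assumes u: "u \<in> borel_measurable \<mu>" and v: "v \<in> borel_measurable \<mu>"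
  shows "(\<lambda>t. a t (u t) (v t)) \<in> borel_measurable \<mu>"
proof -
  obtain U where U: "\<And>i. simple_function \<mu> (U i)" "\<And>x. x \<in> space \<mu> \<Longrightarrow> (\<lambda>i. U i x) \<longlonglongrightarrow> u x"
    using borel_measurable_implies_sequence_metric[OF u, of 0] by metis
  obtain V where V: "\<And>i. simple_function \<mu> (V i)" "\<And>x. x \<in> space \<mu> \<Longrightarrow> (\<lambda>i. V i x) \<longlonglongrightarrow> v x"
    using borel_measurable_implies_sequence_metric[OF v, of 0] by metis
  have m: "(\<lambda>t. a t (U i t) (V i t)) \<in> borel_measurable \<mu>" for i
  proof -
    have s: "simple_function \<mu> (\<lambda>t. (U i t, V i t))" using U V by (intro simple_function_Pair)
    let ?I = "(\<lambda>t. (U i t, V i t)) ` space \<mu>"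
    have "(\<lambda>t. (\<lambda>p t. a t (fst p) (snd p)) (U i t, V i t) t) \<in> borel_measurable \<mu>"
    proof (rule measurable_compose_countable'[where I="?I"])
      show "(\<lambda>t. (U i t, V i t)) \<in> measurable \<mu> (count_space ?I)"
        using s by (subst measurable_count_space_eq2) (auto simp: simple_function_def)
      show "countable ?I" using s by (auto simp: simple_function_def intro: countable_finite)
    qed (rule form_measurable)
    then show ?thesis by simp
  qed
  have "AE t in \<mu>. bilinear (a t) \<and> (\<forall>\<eta> \<zeta>. \<bar>a t \<eta> \<zeta>\<bar> \<le> M * norm \<eta> * norm \<zeta>)"
    using form_bilinear form_bounded by auto
  then obtain N where N: "\<And>t. t \<in> space \<mu> - N \<Longrightarrow> bilinear (a t) \<and> (\<forall>\<eta> \<zeta>. \<bar>a t \<eta> \<zeta>\<bar> \<le> M * norm \<eta> * norm \<zeta>)"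
    and N0: "N \<in> null_sets \<mu>" by (rule AE_E3) blast
  have "(\<lambda>t. indicator (space \<mu> - N) t * a t (u t) (v t)) \<in> borel_measurable \<mu>"
  proof (rule borel_measurable_LIMSEQ_metric)
    show "(\<lambda>t. indicator (space \<mu> - N) t * a t (U i t) (V i t)) \<in> borel_measurable \<mu>" for i
      using m N0 by (intro borel_measurable_times borel_measurable_indicator) auto
    fix t assume t: "t \<in> space \<mu>"
    show "(\<lambda>i. indicator (space \<mu> - N) t * a t (U i t) (V i t)) \<longlonglongrightarrow> indicator (space \<mu> - N) t * a t (u t) (v t)"
    proof (cases "t \<in> N")
      case False
      then have b: "bilinear (a t)" "\<And>\<eta> \<zeta>. \<bar>a t \<eta> \<zeta>\<bar> \<le> M * norm \<eta> * norm \<zeta>" using N t by auto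
      interpret bb: bounded_bilinear "a t"
      proof
        show "\<exists>K. \<forall>x y. norm (a t x y) \<le> norm x * norm y * K"
          using b(2) by (intro exI[of _ M]) (simp add: mult_ac)
      qed (use b(1) in \<open>auto simp: bilinear_ladd bilinear_radd bilinear_lmul bilinear_rmul\<close>)
      show ?thesis
        by (intro tendsto_mult tendsto_const bb.tendsto U(2) V(2) t)
    qed simp
  qed
  then show ?thesis
  proof (rule borel_measurable_lebesgue_on_AE[OF interval_sets])
    have "AE t in \<mu>. t \<notin> N" using N0 by (rule AE_not_in)
    then show "AE t in \<mu>. indicator (space \<mu> - N) t * a t (u t) (v t) = a t (u t) (v t)"
      using AE_space by eventually_elim simp
  qed
qed

lemma form_L2:
  assumes "u \<in> L2_space T" "v \<in> L2_space T"
  shows form_integrable: "integrable \<mu> (\<lambda>t. a t (u t) (v t))"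
    and form_integral_le: "\<bar>LINT t|\<mu>. a t (u t) (v t)\<bar> \<le> M * L2n T u * L2n T v"
proof -
  have m: "(\<lambda>t. a t (u t) (v t)) \<in> borel_measurable \<mu>"
    using assms by (intro form_comp_measurable) (auto simp: L2_space_def)
  have b: "AE t in \<mu>. \<bar>a t (u t) (v t)\<bar> \<le> M * norm (u t) * norm (v t)"
    using form_bounded by auto
  show "integrable \<mu> (\<lambda>t. a t (u t) (v t))" "\<bar>LINT t|\<mu>. a t (u t) (v t)\<bar> \<le> M * L2n T u * L2n T v"
    using integral_product_le[OF assms _ m b] M_pos by auto
qed

lemma norm_Y_eq: "norm_Y T a v = sqrt (LINT t|\<mu>. a t (v t) (v t))"
  by (simp add: norm_Y_def op_As_def op_A_def op_A_dual_def)

lemma form_integral_ge: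
  assumes "v \<in> L2_space T"
  shows "\<alpha> * (L2n T v)\<^sup>2 \<le> (LINT t|\<mu>. a t (v t) (v t))"
proof -
  have "(LINT t|\<mu>. \<alpha> * (norm (v t))\<^sup>2) \<le> (LINT t|\<mu>. a t (v t) (v t))"
    using assms form_coercive
    by (intro integral_mono_AE form_integrable) (auto simp: L2_space_def)
  then show ?thesis by (simp add: L2n_power2)
qed

lemma norm_Y_ge: "v \<in> L2_space T \<Longrightarrow> sqrt \<alpha> * L2n T v \<le> norm_Y T a v"
  unfolding norm_Y_eq using form_integral_ge[of v] alpha_pos
  by (intro real_le_rsqrt) (simp add: power_mult_distrib)

lemma norm_Y_le: "v \<in> L2_space T \<Longrightarrow> norm_Y T a v \<le> sqrt M * L2n T v"
proof -
  assume v: "v \<in> L2_space T"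
  have "(LINT t|\<mu>. a t (v t) (v t)) \<le> M * (L2n T v)\<^sup>2"
    using form_integral_le[OF v v] by (simp add: power2_eq_square mult.assoc)
  also have "\<dots> = (sqrt M * L2n T v)\<^sup>2" using M_pos by (simp add: power_mult_distrib)
  finally show ?thesis
    unfolding norm_Y_eq using M_pos by (intro real_le_lsqrt) auto
qed

lemma norm_Y_nonneg: "v \<in> L2_space T \<Longrightarrow> norm_Y T a v \<ge> 0"
  using norm_Y_ge[of v] alpha_pos by (meson L2n_nonneg less_imp_le mult_nonneg_nonneg order_trans real_sqrt_ge_zero)

lemma form_cmult_integral:
  assumes "u \<in> L2_space T" "v \<in> L2_space T"
  shows "(LINT t|\<mu>. a t (b *\<^sub>R u t) (c *\<^sub>R v t)) = b * c * (LINT t|\<mu>. a t (u t) (v t))"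
proof -
  have "(LINT t|\<mu>. a t (b *\<^sub>R u t) (c *\<^sub>R v t)) = (LINT t|\<mu>. b * c * a t (u t) (v t))"
    using form_bilinear
    by (intro integral_lebesgue_on_cong_AE) (auto elim!: eventually_mono simp: bilinear_lmul bilinear_rmul)
  then show ?thesis by simp
qed

lemma norm_Y_cmult:
  assumes "v \<in> L2_space T" shows "norm_Y T a (\<lambda>t. c *\<^sub>R v t) = \<bar>c\<bar> * norm_Y T a v"
  using form_cmult_integral[OF assms assms, of c c]
  by (simp add: norm_Y_eq real_sqrt_mult flip: power2_eq_square)

lemma norm_Y_dual_le:
  assumes "c \<ge> 0" "\<And>v. v \<in> L2_space T \<Longrightarrow> \<bar>F v\<bar> \<le> c * L2n T v"
  shows "norm_Y_dual T a F \<le> c / sqrt \<alpha>"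
  unfolding norm_Y_dual_def
proof (rule cSUP_least)
  have "(\<lambda>t. 0) \<in> {v \<in> Y_space T. norm_Y T a v \<le> 1}"
    using form_cmult_integral[of "\<lambda>t. 0" "\<lambda>t. 0" 0 0]
    by (auto simp: Y_space_def norm_Y_eq L2_space_def)
  then show "{v \<in> Y_space T. norm_Y T a v \<le> 1} \<noteq> {}" by blast
  fix v :: "real \<Rightarrow> 'v" assume v: "v \<in> {v \<in> Y_space T. norm_Y T a v \<le> 1}"
  then have v2: "v \<in> L2_space T" by (simp add: Y_space_def)
  have "sqrt \<alpha> * L2n T v \<le> 1" using norm_Y_ge[OF v2] v by simp
  then have "L2n T v \<le> 1 / sqrt \<alpha>" using alpha_pos by (simp add: field_simps)
  then have "c * L2n T v \<le> c * (1 / sqrt \<alpha>)" using assms(1) by (intro mult_left_mono)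
  then show "\<bar>F v\<bar> \<le> c / sqrt \<alpha>" using assms(2)[OF v2] by simp
qed

lemma norm_Y_dual_ge:
  assumes c: "c \<ge> 0" "\<And>v. v \<in> L2_space T \<Longrightarrow> \<bar>F v\<bar> \<le> c * L2n T v"
    and hom: "\<And>b v. v \<in> L2_space T \<Longrightarrow> F (\<lambda>t. b *\<^sub>R v t) = b * F v"
    and v: "v \<in> L2_space T"
  shows "\<bar>F v\<bar> \<le> norm_Y_dual T a F * norm_Y T a v" and "0 \<le> norm_Y_dual T a F"
proof -
  have bdd: "bdd_above ((\<lambda>v. \<bar>F v\<bar>) ` {v \<in> Y_space T. norm_Y T a v \<le> 1})"
  proof (rule bdd_aboveI2)
    fix v :: "real \<Rightarrow> 'v" assume v: "v \<in> {v \<in> Y_space T. norm_Y T a v \<le> 1}"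
    then have v2: "v \<in> L2_space T" by (simp add: Y_space_def)
    have "sqrt \<alpha> * L2n T v \<le> 1" using norm_Y_ge[OF v2] v by simp
    then have "L2n T v \<le> 1 / sqrt \<alpha>" using alpha_pos by (simp add: field_simps)
    then have "c * L2n T v \<le> c * (1 / sqrt \<alpha>)" using c(1) by (intro mult_left_mono)
    then show "\<bar>F v\<bar> \<le> c * (1 / sqrt \<alpha>)" using c(2)[OF v2] by simp
  qed
  have up: "\<bar>F w\<bar> \<le> norm_Y_dual T a F" if "w \<in> L2_space T" "norm_Y T a w \<le> 1" for w
    unfolding norm_Y_dual_def using that by (intro cSUP_upper bdd) (auto simp: Y_space_def)
  show nn: "0 \<le> norm_Y_dual T a F"
  proof -
    have "(\<lambda>t. 0) \<in> L2_space T" "norm_Y T a (\<lambda>t. 0::'v) \<le> 1"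
      using form_cmult_integral[of "\<lambda>t. 0" "\<lambda>t. 0" 0 0] by (auto simp: norm_Y_eq L2_space_def)
    from up[OF this] show ?thesis by (meson abs_ge_zero order_trans)
  qed
  show "\<bar>F v\<bar> \<le> norm_Y_dual T a F * norm_Y T a v"
  proof (cases "norm_Y T a v > 0")
    case True
    have "\<bar>F (\<lambda>t. (1 / norm_Y T a v) *\<^sub>R v t)\<bar> \<le> norm_Y_dual T a F"
      using True by (intro up L2_space_cmult v) (simp add: norm_Y_cmult[OF v])
    then show ?thesis using True by (simp add: hom[OF v] abs_mult field_simps)
  next
    case False
    then have "norm_Y T a v = 0" using norm_Y_nonneg[OF v] by simp
    then have "L2n T v \<le> 0" using norm_Y_ge[OF v] alpha_pos by (simp add: mult_le_0_iff)
    then have "L2n T v = 0" using L2n_nonneg[of T v] by linarith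
    then show ?thesis using c(2)[OF v] nn norm_Y_nonneg[OF v] by simp
  qed
qed

end

section \<open>Piecewise smooth functions of time\<close>

text \<open>Continuous functions on \<open>[0,T]\<close> that have the bounded measurable derivative \<open>d\<close> outside a finite
  set. All functions that occur in the argument are of this kind, so that weak derivatives and traces
  are explicit.\<close>

definition pw_smooth :: "real \<Rightarrow> (real \<Rightarrow> 'b::real_normed_vector) \<Rightarrow> (real \<Rightarrow> 'b) \<Rightarrow> bool" where
  "pw_smooth T u d \<longleftrightarrow> continuous_on {0..T} u \<and>
     (\<exists>S. finite S \<and> (\<forall>t\<in>{0<..<T} - S. (u has_vector_derivative d t) (at t))) \<and>
     d \<in> borel_measurable (lebesgue_on {0<..<T}) \<and> (\<exists>K. \<forall>t\<in>{0<..<T}. norm (d t) \<le> K)"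

lemma pw_smooth_linear:
  assumes "pw_smooth T u d" and L: "bounded_linear L"
  shows "pw_smooth T (\<lambda>t. L (u t)) (\<lambda>t. L (d t))"
proof -
  interpret L: bounded_linear L by (rule L)
  obtain S K where S: "finite S" "\<And>t. t \<in> {0<..<T} - S \<Longrightarrow> (u has_vector_derivative d t) (at t)"
    and K: "\<And>t. t \<in> {0<..<T} \<Longrightarrow> norm (d t) \<le> K"
    using assms(1) unfolding pw_smooth_def by blast
  obtain B where B: "B > 0" "\<And>x. norm (L x) \<le> norm x * B" using L.pos_bounded by blast
  have "continuous_on {0..T} (\<lambda>t. L (u t))"
    using assms(1) by (intro L.continuous_on) (simp add: pw_smooth_def)
  moreover have "(\<lambda>t. L (d t)) \<in> borel_measurable (lebesgue_on {0<..<T})"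
    by (rule continuous_compose_measurable[OF _ L.continuous_on[OF continuous_on_id]])
       (use assms(1) in \<open>simp add: pw_smooth_def\<close>)
  moreover have "norm (L (d t)) \<le> K * B" if "t \<in> {0<..<T}" for t
  proof -
    have "norm (d t) * B \<le> K * B" using K[OF that] B(1) by (intro mult_right_mono) auto
    then show ?thesis using B(2)[of "d t"] by linarith
  qed
  moreover have "((\<lambda>t. L (u t)) has_vector_derivative L (d t)) (at t)" if "t \<in> {0<..<T} - S" for t
    using L.has_vector_derivative[OF S(2)[OF that]] .
  ultimately show ?thesis unfolding pw_smooth_def using S(1) by blast
qed

lemma pw_smooth_lincomb:
  fixes u w :: "real \<Rightarrow> 'b::{real_normed_vector,second_countable_topology}"
  assumes "pw_smooth T u d" "pw_smooth T w e"
  shows "pw_smooth T (\<lambda>t. b *\<^sub>R u t + c *\<^sub>R w t) (\<lambda>t. b *\<^sub>R d t + c *\<^sub>R e t)"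
proof -
  obtain S K where S: "finite S" "\<And>t. t \<in> {0<..<T} - S \<Longrightarrow> (u has_vector_derivative d t) (at t)"
    and K: "\<And>t. t \<in> {0<..<T} \<Longrightarrow> norm (d t) \<le> K"
    using assms(1) unfolding pw_smooth_def by blast
  obtain S' K' where S': "finite S'" "\<And>t. t \<in> {0<..<T} - S' \<Longrightarrow> (w has_vector_derivative e t) (at t)"
    and K': "\<And>t. t \<in> {0<..<T} \<Longrightarrow> norm (e t) \<le> K'"
    using assms(2) unfolding pw_smooth_def by blast
  have "continuous_on {0..T} (\<lambda>t. b *\<^sub>R u t + c *\<^sub>R w t)"
    using assms by (intro continuous_intros) (auto simp: pw_smooth_def)
  moreover have "(\<lambda>t. b *\<^sub>R d t + c *\<^sub>R e t) \<in> borel_measurable (lebesgue_on {0<..<T})"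
    using assms by (intro borel_measurable_add borel_measurable_scaleR) (auto simp: pw_smooth_def)
  moreover have "norm (b *\<^sub>R d t + c *\<^sub>R e t) \<le> \<bar>b\<bar> * K + \<bar>c\<bar> * K'" if "t \<in> {0<..<T}" for t
  proof -
    have "norm (b *\<^sub>R d t + c *\<^sub>R e t) \<le> \<bar>b\<bar> * norm (d t) + \<bar>c\<bar> * norm (e t)"
      by (rule order_trans[OF norm_triangle_ineq]) simp
    also have "\<dots> \<le> \<bar>b\<bar> * K + \<bar>c\<bar> * K'"
      using K[OF that] K'[OF that] by (intro add_mono mult_left_mono) auto
    finally show ?thesis .
  qed
  moreover have "((\<lambda>t. b *\<^sub>R u t + c *\<^sub>R w t) has_vector_derivative b *\<^sub>R d t + c *\<^sub>R e t) (at t)"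
    if "t \<in> {0<..<T} - (S \<union> S')" for t
    using S(2)[of t] S'(2)[of t] that by (auto intro!: derivative_eq_intros)
  ultimately show ?thesis unfolding pw_smooth_def using S(1) S'(1) by blast
qed

lemma pw_smooth_bounded:
  assumes "pw_smooth T u d"
  obtains K where "\<And>t. t \<in> {0<..<T} \<Longrightarrow> norm (u t) \<le> K"
proof -
  have "bounded (u ` {0..T})"
    using assms by (intro compact_imp_bounded compact_continuous_image) (auto simp: pw_smooth_def)
  then obtain K where "\<forall>x\<in>u ` {0..T}. norm x \<le> K" unfolding bounded_iff by blast
  then show ?thesis by (intro that[of K]) auto
qed

lemma pw_smooth_measurable:
  assumes "pw_smooth T u d" shows "u \<in> borel_measurable (lebesgue_on {0<..<T})"
proof (rule continuous_on_imp_measurable_lebesgue_on)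
  have "continuous_on {0..T} u" using assms by (simp add: pw_smooth_def)
  then show "continuous_on {0<..<T} u" by (rule continuous_on_subset) auto
qed

lemma pw_smooth_L2:
  assumes "pw_smooth T u d" shows "u \<in> L2_space T"
proof -
  obtain K where "\<And>t. t \<in> {0<..<T} \<Longrightarrow> norm (u t) \<le> K" using pw_smooth_bounded[OF assms] by blast
  then show ?thesis by (rule L2_space_bounded[OF pw_smooth_measurable[OF assms]])
qed

lemma pw_smooth_deriv_L2:
  assumes "pw_smooth T u d" shows "d \<in> L2_space T"
proof -
  have "d \<in> borel_measurable (lebesgue_on {0<..<T})" using assms by (simp add: pw_smooth_def)
  moreover obtain K where "\<forall>t\<in>{0<..<T}. norm (d t) \<le> K" using assms unfolding pw_smooth_def by blast
  ultimately show ?thesis by (intro L2_space_bounded[of d T K]) auto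
qed

lemma test_function_props:
  assumes "\<phi> \<in> test_functions T"
  shows "(\<phi> has_real_derivative deriv \<phi> t) (at t)" "continuous_on X \<phi>" "continuous_on X (deriv \<phi>)"
    "\<phi> 0 = 0" "\<phi> T = 0"
proof -
  have d: "((deriv ^^ k) \<phi>) differentiable (at x)" for k x
    using assms by (auto simp: test_functions_def)
  show "(\<phi> has_real_derivative deriv \<phi> t) (at t)"
    using d[of 0 t] by (simp add: DERIV_deriv_iff_real_differentiable)
  show "continuous_on X \<phi>" "continuous_on X (deriv \<phi>)"
    using d[of 0] d[of 1]
    by (auto intro!: continuous_at_imp_continuous_on differentiable_imp_continuous_within)
  have "closure {t. \<phi> t \<noteq> 0} \<subseteq> {0<..<T}" using assms by (auto simp: test_functions_def)
  then have "{t. \<phi> t \<noteq> 0} \<subseteq> {0<..<T}" by (rule order_trans[OF closure_subset])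
  then show "\<phi> 0 = 0" "\<phi> T = 0" by auto
qed

lemma integrable_interval_continuous_mult:
  fixes f \<phi> :: "real \<Rightarrow> real"
  assumes \<phi>: "continuous_on {0..T} \<phi>" and f: "integrable (lebesgue_on {0<..<T}) f"
  shows "integrable (lebesgue_on {0<..<T}) (\<lambda>t. \<phi> t * f t)"
proof -
  have "bounded (\<phi> ` {0..T})"
    using \<phi> by (intro compact_imp_bounded compact_continuous_image) auto
  then obtain K where K: "\<forall>x\<in>\<phi> ` {0..T}. norm x \<le> K" unfolding bounded_iff by blast
  have m: "\<phi> \<in> borel_measurable (lebesgue_on {0<..<T})"
    by (rule continuous_on_imp_measurable_lebesgue_on[OF continuous_on_subset[OF \<phi>]]) auto
  have i: "integrable (lebesgue_on {0<..<T}) (\<lambda>t. K * f t)" using f by simp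
  show ?thesis
  proof (rule Bochner_Integration.integrable_bound[OF i])
    show "(\<lambda>t. \<phi> t * f t) \<in> borel_measurable (lebesgue_on {0<..<T})"
      by (rule borel_measurable_times[OF m borel_measurable_integrable[OF f]])
    show "AE t in lebesgue_on {0<..<T}. norm (\<phi> t * f t) \<le> norm (K * f t)"
    proof (rule AE_I2)
      fix t assume "t \<in> space (lebesgue_on {0<..<T})"
      then have "\<bar>\<phi> t\<bar> \<le> K" using K by auto
      then have "\<bar>\<phi> t\<bar> \<le> \<bar>K\<bar>" by simp
      then show "norm (\<phi> t * f t) \<le> norm (K * f t)" by (simp add: abs_mult mult_right_mono)
    qed
  qed
qed

lemma pw_smooth_integral_deriv:
  fixes w d :: "real \<Rightarrow> real"
  assumes "T > 0" "pw_smooth T w d"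
  shows "(LINT t|lebesgue_on {0<..<T}. d t) = w T - w 0"
proof -
  obtain S K where S: "finite S" "\<And>t. t \<in> {0<..<T} - S \<Longrightarrow> (w has_vector_derivative d t) (at t)"
    and K: "\<And>t. t \<in> {0<..<T} \<Longrightarrow> norm (d t) \<le> K"
    using assms(2) unfolding pw_smooth_def by blast
  have i: "integrable (lebesgue_on {0<..<T}) d"
    using K assms(2) by (intro integrable_bounded_interval[of _ _ K]) (auto simp: pw_smooth_def)
  have "(d has_integral (w T - w 0)) {0..T}"
    using assms S by (intro fundamental_theorem_of_calculus_interior_strong) (auto simp: pw_smooth_def)
  then have "(d has_integral (w T - w 0)) {0<..<T}"
    by (simp add: has_integral_Icc_iff_Ioo)
  then show ?thesis
    using lebesgue_integral_eq_integral[OF i] by (simp add: integral_unique)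
qed

lemma pw_smooth_mult:
  fixes w d \<phi> \<psi> :: "real \<Rightarrow> real"
  assumes "pw_smooth T w d" "pw_smooth T \<phi> \<psi>"
  shows "pw_smooth T (\<lambda>t. \<phi> t * w t) (\<lambda>t. \<psi> t * w t + \<phi> t * d t)"
proof -
  obtain S K where S: "finite S" "\<And>t. t \<in> {0<..<T} - S \<Longrightarrow> (w has_vector_derivative d t) (at t)"
    and K: "\<And>t. t \<in> {0<..<T} \<Longrightarrow> \<bar>d t\<bar> \<le> K"
    using assms(1) unfolding pw_smooth_def real_norm_def by blast
  obtain S' K' where S': "finite S'" "\<And>t. t \<in> {0<..<T} - S' \<Longrightarrow> (\<phi> has_vector_derivative \<psi> t) (at t)"
    and K': "\<And>t. t \<in> {0<..<T} \<Longrightarrow> \<bar>\<psi> t\<bar> \<le> K'"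
    using assms(2) unfolding pw_smooth_def real_norm_def by blast
  obtain B where B: "\<And>t. t \<in> {0<..<T} \<Longrightarrow> \<bar>w t\<bar> \<le> B" using pw_smooth_bounded[OF assms(1)] by auto
  obtain B' where B': "\<And>t. t \<in> {0<..<T} \<Longrightarrow> \<bar>\<phi> t\<bar> \<le> B'" using pw_smooth_bounded[OF assms(2)] by auto
  have "continuous_on {0..T} (\<lambda>t. \<phi> t * w t)"
    using assms by (intro continuous_intros) (auto simp: pw_smooth_def)
  moreover have "(\<lambda>t. \<psi> t * w t + \<phi> t * d t) \<in> borel_measurable (lebesgue_on {0<..<T})"
    using assms pw_smooth_measurable[OF assms(1)] pw_smooth_measurable[OF assms(2)]
    by (intro borel_measurable_add borel_measurable_times) (auto simp: pw_smooth_def)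
  moreover have "norm (\<psi> t * w t + \<phi> t * d t) \<le> K' * B + B' * K" if "t \<in> {0<..<T}" for t
  proof -
    have "norm (\<psi> t * w t + \<phi> t * d t) \<le> \<bar>\<psi> t\<bar> * \<bar>w t\<bar> + \<bar>\<phi> t\<bar> * \<bar>d t\<bar>"
      by (rule order_trans[OF norm_triangle_ineq]) (simp add: abs_mult)
    also have "\<dots> \<le> K' * B + B' * K"
      using K[OF that] K'[OF that] B[OF that] B'[OF that]
      by (intro add_mono mult_mono') auto
    finally show ?thesis .
  qed
  moreover have "((\<lambda>t. \<phi> t * w t) has_vector_derivative \<psi> t * w t + \<phi> t * d t) (at t)"
    if "t \<in> {0<..<T} - (S \<union> S')" for t
  proof -
    have "(w has_real_derivative d t) (at t)" "(\<phi> has_real_derivative \<psi> t) (at t)"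
      using S(2)[of t] S'(2)[of t] that by (auto simp: has_real_derivative_iff_has_vector_derivative)
    from DERIV_mult[OF this(2,1)] show ?thesis
      by (simp add: has_real_derivative_iff_has_vector_derivative algebra_simps)
  qed
  ultimately show ?thesis unfolding pw_smooth_def using S(1) S'(1) by blast
qed

lemma pw_smooth_by_parts:
  fixes w d :: "real \<Rightarrow> real"
  assumes T: "T > 0" and w: "pw_smooth T w d" and \<phi>: "\<phi> \<in> test_functions T"
  shows "(LINT t|lebesgue_on {0<..<T}. deriv \<phi> t * w t) = - (LINT t|lebesgue_on {0<..<T}. \<phi> t * d t)"
proof -
  note t = test_function_props[OF \<phi>]
  have "bounded (deriv \<phi> ` {0..T})"
    using t(3) by (intro compact_imp_bounded compact_continuous_image) auto
  then obtain K where K: "\<forall>x\<in>deriv \<phi> ` {0..T}. norm x \<le> K" unfolding bounded_iff by blast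
  have p: "pw_smooth T \<phi> (deriv \<phi>)"
    unfolding pw_smooth_def
    using t(1,2) K
    by (intro conjI exI[of _ "{}"] exI[of _ K] continuous_on_imp_measurable_lebesgue_on[OF t(3)])
       (auto simp: has_real_derivative_iff_has_vector_derivative)
  have iw: "integrable (lebesgue_on {0<..<T}) w" "integrable (lebesgue_on {0<..<T}) d"
    using pw_smooth_L2[OF w] pw_smooth_deriv_L2[OF w]
    by (auto simp: L2_space_def intro!: finite_measure.square_integrable_imp_integrable[OF finite_measure_interval])
  have "(LINT t|lebesgue_on {0<..<T}. deriv \<phi> t * w t + \<phi> t * d t) = 0"
    using pw_smooth_integral_deriv[OF T pw_smooth_mult[OF w p]] t(4,5) by simp
  then show ?thesis
    using integrable_interval_continuous_mult[OF t(3) iw(1)] integrable_interval_continuous_mult[OF t(2) iw(2)]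
    by simp
qed

lemma continuous_on_AE_eq_imp_eq:
  fixes u w :: "real \<Rightarrow> 'b::metric_space"
  assumes T: "T > 0" and u: "continuous_on {0..T} u" and w: "continuous_on {0..T} w"
    and ae: "AE t in lebesgue_on {0<..<T}. u t = w t" and s: "s \<in> {0..T}"
  shows "u s = w s"
proof -
  have cl: "closed {r \<in> {0..T}. u r = w r}"
  proof -
    have "{r \<in> {0..T}. u r = w r} = {r \<in> {0..T}. dist (u r) (w r) = 0}" by auto
    moreover have "closed {r \<in> {0..T}. dist (u r) (w r) = 0}"
      using continuous_closed_preimage_constant[of "{0..T}" "\<lambda>r. dist (u r) (w r)" 0]
      by (simp add: continuous_on_dist u w)
    ultimately show ?thesis by simp
  qed
  have "x \<in> {r \<in> {0..T}. u r = w r}" if "x \<in> {0<..<T}" for x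
    by (rule mem_closed_if_AE_lebesgue_open[OF _ cl _ that])
       (use ae in \<open>auto simp: AE_restrict_space_iff elim!: eventually_mono\<close>)
  then have "closure {0<..<T} \<subseteq> {r \<in> {0..T}. u r = w r}"
    by (intro closure_minimal cl) blast
  then show ?thesis using s T by auto
qed

text \<open>A coercive form together with the embedding into the larger space.\<close>

locale parabolic_problem = coercive_form T a M \<alpha>
  for T and a :: "real \<Rightarrow> 'v::{real_inner,complete_space,second_countable_topology} \<Rightarrow> 'v \<Rightarrow> real"
    and M \<alpha> +
  fixes emb :: "'v \<Rightarrow>\<^sub>L 'h::{real_inner,complete_space,second_countable_topology}"
begin

text \<open>The scalar product of the larger space, pulled back to the smaller one.\<close>

definition ip :: "'v \<Rightarrow> 'v \<Rightarrow> real" where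
  "ip x y = inner (blinfun_apply emb x) (blinfun_apply emb y)"

sublocale ip: bounded_bilinear ip
  unfolding ip_def
  by (rule bounded_bilinear.comp[OF bounded_bilinear_inner blinfun.bounded_linear_right blinfun.bounded_linear_right])

lemma ip_sym: "ip x y = ip y x" by (simp add: ip_def inner_commute)
lemma ip_nonneg [simp]: "ip x x \<ge> 0" by (simp add: ip_def)
lemma ip_self: "ip x x = (norm (blinfun_apply emb x))\<^sup>2" by (simp add: ip_def power2_norm_eq_inner)

lemma ip_le: "\<bar>ip x y\<bar> \<le> (norm emb)\<^sup>2 * norm x * norm y"
proof -
  have "\<bar>ip x y\<bar> \<le> norm (blinfun_apply emb x) * norm (blinfun_apply emb y)"
    unfolding ip_def by (rule Cauchy_Schwarz_ineq2)
  also have "\<dots> \<le> (norm emb * norm x) * (norm emb * norm y)"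
    by (intro mult_mono norm_blinfun) auto
  finally show ?thesis by (simp add: power2_eq_square mult_ac)
qed

text \<open>The embedding of the smaller space into its dual.\<close>

definition dual_of :: "'v \<Rightarrow> 'v \<Rightarrow>\<^sub>L real" where
  "dual_of x = H_to_dual emb (blinfun_apply emb x)"

lemma dual_of_apply: "blinfun_apply (dual_of x) y = ip x y"
  by (simp add: dual_of_def H_to_dual_def ip_def inner_commute)

lemma dual_of_linear: "bounded_linear dual_of"
proof (rule bounded_linear_intro[where K="(norm emb)\<^sup>2"])
  show "dual_of (x + y) = dual_of x + dual_of y" for x y
    by (rule blinfun_eqI) (simp add: dual_of_apply ip.add_left blinfun.add_left)
  show "dual_of (r *\<^sub>R x) = r *\<^sub>R dual_of x" for r x
    by (rule blinfun_eqI) (simp add: dual_of_apply ip.scaleR_left blinfun.scaleR_left)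
  show "norm (dual_of x) \<le> norm x * (norm emb)\<^sup>2" for x
    using ip_le[of x] by (intro norm_blinfun_bound) (auto simp: dual_of_apply mult_ac)
qed

lemma pw_smooth_weak_deriv:
  assumes "pw_smooth T w d"
  shows "weak_deriv T (\<lambda>t. dual_of (w t)) (\<lambda>t. dual_of (d t))"
  unfolding weak_deriv_def dual_of_apply
  by (intro ballI allI pw_smooth_by_parts[OF T_pos] pw_smooth_linear[OF assms] ip.bounded_linear_left)

lemma time_deriv_spec:
  assumes "pw_smooth T w d"
  shows "time_deriv T emb w \<in> L2_space T \<and> weak_deriv T (\<lambda>t. dual_of (w t)) (time_deriv T emb w)"
  unfolding time_deriv_def dual_of_def[symmetric]
  by (rule someI[of _ "\<lambda>t. dual_of (d t)"])
     (intro conjI pw_smooth_weak_deriv[OF assms] pw_smooth_deriv_L2[OF pw_smooth_linear[OF assms dual_of_linear]])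

text \<open>Separability reduces equality of dual-valued functions to countably many scalar equalities.\<close>

lemma weak_deriv_unique:
  assumes w1: "weak_deriv T w g" and w2: "weak_deriv T w g'"
    and g: "g \<in> L2_space T" and g': "g' \<in> L2_space T"
  shows "AE t in \<mu>. g t = (g' t :: 'v \<Rightarrow>\<^sub>L real)"
proof -
  have int: "integrable \<mu> (\<lambda>t. blinfun_apply (k t) \<eta>)" if "k \<in> L2_space T" for k :: "real \<Rightarrow> 'v \<Rightarrow>\<^sub>L real" and \<eta>
  proof (rule fm.square_integrable_imp_integrable)
    have m: "k \<in> borel_measurable \<mu>" and i: "integrable \<mu> (\<lambda>t. (norm (k t))\<^sup>2 * (norm \<eta>)\<^sup>2)"
      using that by (auto simp: L2_space_def)
    have "continuous_on UNIV (\<lambda>b :: 'v \<Rightarrow>\<^sub>L real. blinfun_apply b \<eta>)"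
      by (intro continuous_intros)
    then show mm: "(\<lambda>t. blinfun_apply (k t) \<eta>) \<in> borel_measurable \<mu>"
      using continuous_compose_measurable[OF m] by blast
    show "integrable \<mu> (\<lambda>t. (blinfun_apply (k t) \<eta>)\<^sup>2)"
    proof (rule Bochner_Integration.integrable_bound[OF i])
      show "(\<lambda>t. (blinfun_apply (k t) \<eta>)\<^sup>2) \<in> borel_measurable \<mu>" using mm by (rule borel_measurable_power)
      show "AE t in \<mu>. norm ((blinfun_apply (k t) \<eta>)\<^sup>2) \<le> norm ((norm (k t))\<^sup>2 * (norm \<eta>)\<^sup>2)"
      proof (rule AE_I2)
        fix t
        have "\<bar>blinfun_apply (k t) \<eta>\<bar> \<le> norm (k t) * norm \<eta>" using norm_blinfun[of "k t" \<eta>] by simp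
        then have "\<bar>blinfun_apply (k t) \<eta>\<bar>\<^sup>2 \<le> (norm (k t) * norm \<eta>)\<^sup>2" by (intro power_mono) auto
        then show "norm ((blinfun_apply (k t) \<eta>)\<^sup>2) \<le> norm ((norm (k t))\<^sup>2 * (norm \<eta>)\<^sup>2)"
          by (simp add: power_mult_distrib)
      qed
    qed
  qed
  have ae: "AE t in \<mu>. blinfun_apply (g t) \<eta> = blinfun_apply (g' t) \<eta>" for \<eta>
  proof -
    have "AE t in \<mu>. blinfun_apply (g t) \<eta> - blinfun_apply (g' t) \<eta> = 0"
    proof (rule fundamental_lemma_variations)
      show "integrable \<mu> (\<lambda>t. blinfun_apply (g t) \<eta> - blinfun_apply (g' t) \<eta>)"
        using int g g' by simp
      fix \<phi> assume \<phi>: "\<phi> \<in> test_functions T"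
      have "(LINT t|\<mu>. \<phi> t * blinfun_apply (g t) \<eta>) = (LINT t|\<mu>. \<phi> t * blinfun_apply (g' t) \<eta>)"
      proof -
        have "- (LINT t|\<mu>. \<phi> t * blinfun_apply (g t) \<eta>) = - (LINT t|\<mu>. \<phi> t * blinfun_apply (g' t) \<eta>)"
          using w1[unfolded weak_deriv_def, rule_format, OF \<phi>, of \<eta>]
            w2[unfolded weak_deriv_def, rule_format, OF \<phi>, of \<eta>] by (rule trans[OF sym])
        then show ?thesis by simp
      qed
      then show "(LINT t|\<mu>. \<phi> t * (blinfun_apply (g t) \<eta> - blinfun_apply (g' t) \<eta>)) = 0"
        using Bochner_Integration.integral_diff[OF integrable_interval_continuous_mult[OF test_function_props(2)[OF \<phi>] int[OF g]]
          integrable_interval_continuous_mult[OF test_function_props(2)[OF \<phi>] int[OF g']], of \<eta> \<eta>]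
        by (simp only: right_diff_distrib)
    qed
    then show ?thesis by eventually_elim simp
  qed
  obtain D :: "'v set" where D: "countable D" "\<And>X. open X \<Longrightarrow> X \<noteq> {} \<Longrightarrow> \<exists>d\<in>D. d \<in> X"
    by (erule countable_dense_setE)
  have "closure D = UNIV"
  proof (rule ccontr)
    assume "closure D \<noteq> UNIV"
    then have "open (- closure D)" "- closure D \<noteq> {}" by auto
    from D(2)[OF this] show False using closure_subset[of D] by auto
  qed
  have "AE t in \<mu>. \<forall>\<eta>\<in>D. blinfun_apply (g t) \<eta> = blinfun_apply (g' t) \<eta>"
    using ae D(1) by (simp add: AE_ball_countable)
  then show ?thesis
  proof eventually_elim
    case (elim t)
    have "blinfun_apply (g t) \<eta> = blinfun_apply (g' t) \<eta>" for \<eta>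
      using \<open>closure D = UNIV\<close> elim
      by (intro continuous_constant_on_closure[of D "\<lambda>\<eta>. blinfun_apply (g t) \<eta> - blinfun_apply (g' t) \<eta>" 0 \<eta>, simplified])
         (auto intro!: continuous_intros)
    then show ?case by (intro blinfun_eqI)
  qed
qed

lemma ip_integral_L2:
  assumes "u \<in> L2_space T" "v \<in> L2_space T"
  shows ip_integrable: "integrable \<mu> (\<lambda>t. ip (u t) (v t))"
    and ip_integral_le: "\<bar>LINT t|\<mu>. ip (u t) (v t)\<bar> \<le> (norm emb)\<^sup>2 * L2n T u * L2n T v"
proof -
  have m: "(\<lambda>t. ip (u t) (v t)) \<in> borel_measurable \<mu>"
    unfolding ip_def using assms
    by (intro borel_measurable_inner continuous_compose_measurable[where J="blinfun_apply emb"] continuous_intros)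
       (auto simp: L2_space_def)
  show "integrable \<mu> (\<lambda>t. ip (u t) (v t))" "\<bar>LINT t|\<mu>. ip (u t) (v t)\<bar> \<le> (norm emb)\<^sup>2 * L2n T u * L2n T v"
    using integral_product_le[OF assms _ m AE_I2[OF ip_le]] by auto
qed

lemma op_B_eq:
  assumes w: "pw_smooth T w d" and v: "v \<in> L2_space T"
  shows "op_B T emb a w v = (LINT t|\<mu>. ip (d t) (v t)) + (LINT t|\<mu>. a t (w t) (v t))"
proof -
  have "AE t in \<mu>. time_deriv T emb w t = dual_of (d t)"
    using time_deriv_spec[OF w] pw_smooth_weak_deriv[OF w]
      pw_smooth_deriv_L2[OF pw_smooth_linear[OF w dual_of_linear]]
    by (intro weak_deriv_unique[where w="\<lambda>t. dual_of (w t)"]) auto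
  then have "op_B T emb a w v = (LINT t|\<mu>. ip (d t) (v t) + a t (w t) (v t))"
    unfolding op_B_def
    by (intro integral_lebesgue_on_cong_AE) (auto simp: dual_of_apply elim!: eventually_mono)
  then show ?thesis
    using ip_integrable[OF pw_smooth_deriv_L2[OF w] v] form_integrable[OF pw_smooth_L2[OF w] v] by simp
qed

lemma op_dt_eq:
  assumes w: "pw_smooth T w d" and v: "v \<in> L2_space T"
  shows "op_dt T emb a w v = (LINT t|\<mu>. ip (d t) (v t))"
  unfolding op_dt_def op_B_eq[OF assms] by (simp add: op_A_def)

lemma op_B_cong_AE:
  assumes "eq_on_I T u w"
  shows "op_B T emb a u v = op_B T emb a w v"
proof -
  have ae: "AE t in \<mu>. u t = w t" using assms by (simp add: eq_on_I_def)
  have "(LINT t|\<mu>. deriv \<phi> t * blinfun_apply (dual_of (u t)) \<eta>) =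
      (LINT t|\<mu>. deriv \<phi> t * blinfun_apply (dual_of (w t)) \<eta>)" for \<phi> \<eta>
    using ae by (intro integral_lebesgue_on_cong_AE) (auto elim!: eventually_mono)
  then have "time_deriv T emb u = time_deriv T emb w"
    unfolding time_deriv_def weak_deriv_def dual_of_def[symmetric] by simp
  then show ?thesis
    unfolding op_B_def using ae by (intro integral_lebesgue_on_cong_AE) (auto elim!: eventually_mono)
qed

lemma pw_smooth_X_space:
  assumes "pw_smooth T w d" shows "w \<in> X_space T emb"
proof -
  note l = pw_smooth_linear[OF assms dual_of_linear]
  have "(\<lambda>t. dual_of (w t)) \<in> H1_dual T"
    unfolding H1_dual_def using pw_smooth_L2[OF l] pw_smooth_deriv_L2[OF l] pw_smooth_weak_deriv[OF assms] by blast
  then show ?thesis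
    unfolding X_space_def using pw_smooth_L2[OF assms] by (simp add: dual_of_def)
qed

lemma trace_at_eq:
  assumes w: "pw_smooth T w d" and s: "s \<in> {0..T}"
  shows "trace_at T emb w s = blinfun_apply emb (w s)"
  unfolding trace_at_def
proof (rule the_equality)
  have c: "continuous_on {0..T} (\<lambda>t. blinfun_apply emb (w t))"
    using w by (intro continuous_intros) (simp add: pw_smooth_def)
  then show "\<exists>u. continuous_on {0..T} u \<and> eq_on_I T (\<lambda>t. blinfun_apply emb (w t)) u \<and> u s = blinfun_apply emb (w s)"
    by (intro exI[of _ "\<lambda>t. blinfun_apply emb (w t)"]) (simp add: eq_on_I_def)
  fix h assume "\<exists>u. continuous_on {0..T} u \<and> eq_on_I T (\<lambda>t. blinfun_apply emb (w t)) u \<and> u s = h"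
  then obtain u where u: "continuous_on {0..T} u" "AE t in \<mu>. blinfun_apply emb (w t) = u t" "u s = h"
    by (auto simp: eq_on_I_def)
  show "h = blinfun_apply emb (w s)"
    using continuous_on_AE_eq_imp_eq[OF T_pos c u(1,2) s] u(3) by simp
qed

lemma op_dt_bounds:
  assumes w: "pw_smooth T w d" and c: "c \<ge> 0" "\<And>v. v \<in> L2_space T \<Longrightarrow> \<bar>LINT t|\<mu>. ip (d t) (v t)\<bar> \<le> c * L2n T v"
  shows "norm_Y_dual T a (op_dt T emb a w) \<le> c / sqrt \<alpha>"
  using c by (intro norm_Y_dual_le) (auto simp: op_dt_eq[OF w])

lemma op_dt_le_norm_Y_dual:
  assumes w: "pw_smooth T w d" and v: "v \<in> L2_space T"
  shows "\<bar>LINT t|\<mu>. ip (d t) (v t)\<bar> \<le> norm_Y_dual T a (op_dt T emb a w) * norm_Y T a v"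
    and "0 \<le> norm_Y_dual T a (op_dt T emb a w)"
proof -
  have c: "\<bar>op_dt T emb a w v\<bar> \<le> ((norm emb)\<^sup>2 * L2n T d) * L2n T v" if "v \<in> L2_space T" for v
    using ip_integral_le[OF pw_smooth_deriv_L2[OF w] that] that by (simp add: op_dt_eq[OF w])
  have hom: "op_dt T emb a w (\<lambda>t. b *\<^sub>R v t) = b * op_dt T emb a w v" if "v \<in> L2_space T" for b v
    using that L2_space_cmult[OF that] by (simp add: op_dt_eq[OF w] ip.scaleR_right)
  show "\<bar>LINT t|\<mu>. ip (d t) (v t)\<bar> \<le> norm_Y_dual T a (op_dt T emb a w) * norm_Y T a v"
    "0 \<le> norm_Y_dual T a (op_dt T emb a w)"
    using norm_Y_dual_ge[OF _ c hom v] by (auto simp: op_dt_eq[OF w v])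
qed

lemma norm_X_nonneg: "norm_X T emb a w \<ge> 0"
  by (simp add: norm_X_def)

lemma norm_X_ge:
  assumes w: "pw_smooth T w d" and v: "v \<in> L2_space T"
  shows "norm_Y T a w \<le> norm_X T emb a w"
    and "\<bar>LINT t|\<mu>. ip (d t) (v t)\<bar> \<le> norm_X T emb a w * norm_Y T a v"
proof -
  show "norm_Y T a w \<le> norm_X T emb a w"
    unfolding norm_X_def by (rule real_le_rsqrt) simp
  have "norm_Y_dual T a (op_dt T emb a w) \<le> norm_X T emb a w"
    unfolding norm_X_def by (rule real_le_rsqrt) simp
  then show "\<bar>LINT t|\<mu>. ip (d t) (v t)\<bar> \<le> norm_X T emb a w * norm_Y T a v"
    using op_dt_le_norm_Y_dual[OF w v] norm_Y_nonneg[OF v] by (meson mult_right_mono order_trans)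
qed

text \<open>Boundedness of the parabolic operator. It is used to bound the norm of a function from below.\<close>

lemma op_B_le:
  assumes w: "pw_smooth T w d" and v: "v \<in> L2_space T"
  shows "\<bar>op_B T emb a w v\<bar> \<le> (sqrt M + M / sqrt \<alpha>) * norm_X T emb a w * L2n T v"
proof -
  have "\<bar>LINT t|\<mu>. ip (d t) (v t)\<bar> \<le> norm_X T emb a w * (sqrt M * L2n T v)"
    using norm_X_ge(2)[OF w v] norm_Y_le[OF v] norm_X_nonneg by (meson mult_left_mono order_trans)
  moreover have "\<bar>LINT t|\<mu>. a t (w t) (v t)\<bar> \<le> M * (norm_X T emb a w / sqrt \<alpha>) * L2n T v"
  proof -
    have "sqrt \<alpha> * L2n T w \<le> norm_X T emb a w"
      using norm_Y_ge[OF pw_smooth_L2[OF w]] norm_X_ge(1)[OF w v] by linarith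
    then have "L2n T w \<le> norm_X T emb a w / sqrt \<alpha>" using alpha_pos by (simp add: field_simps)
    then have "M * L2n T w * L2n T v \<le> M * (norm_X T emb a w / sqrt \<alpha>) * L2n T v"
      using M_pos by (intro mult_right_mono mult_left_mono) auto
    then show ?thesis using form_integral_le[OF pw_smooth_L2[OF w] v] by linarith
  qed
  ultimately show ?thesis
    unfolding op_B_eq[OF w v] by (simp add: algebra_simps)
qed

lemma norm_X_le:
  assumes w: "pw_smooth T w d" and c: "c \<ge> 0" "\<And>v. v \<in> L2_space T \<Longrightarrow> \<bar>LINT t|\<mu>. ip (d t) (v t)\<bar> \<le> c * L2n T v"
  shows "norm_X T emb a w \<le> sqrt M * L2n T w + c / sqrt \<alpha> + norm (blinfun_apply emb (w T))"
proof -
  have "norm_X T emb a w \<le> norm_Y T a w + norm_Y_dual T a (op_dt T emb a w) + norm (trace_at T emb w T)"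
    unfolding norm_X_def
    using norm_Y_nonneg[OF pw_smooth_L2[OF w]] op_dt_le_norm_Y_dual(2)[OF w pw_smooth_L2[OF w]]
    by (intro real_le_lsqrt) (auto simp: power2_eq_square algebra_simps)
  also have "\<dots> \<le> sqrt M * L2n T w + c / sqrt \<alpha> + norm (blinfun_apply emb (w T))"
    using norm_Y_le[OF pw_smooth_L2[OF w]] op_dt_bounds[OF w c] trace_at_eq[OF w, of T] T_pos
    by (intro add_mono) auto
  finally show ?thesis .
qed

text \<open>Coercivity on functions that vanish at time zero; it makes Galerkin solutions unique.\<close>

lemma op_B_self:
  assumes w: "pw_smooth T w d" and w0: "w 0 = 0"
  shows "\<alpha> * (L2n T w)\<^sup>2 \<le> op_B T emb a w w"
proof -
  obtain S K where S: "finite S" "\<And>t. t \<in> {0<..<T} - S \<Longrightarrow> (w has_vector_derivative d t) (at t)"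
    and K: "\<And>t. t \<in> {0<..<T} \<Longrightarrow> norm (d t) \<le> K"
    using w unfolding pw_smooth_def by blast
  obtain B where B: "\<And>t. t \<in> {0<..<T} \<Longrightarrow> norm (w t) \<le> B" using pw_smooth_bounded[OF w] by blast
  have "pw_smooth T (\<lambda>t. ip (w t) (w t)) (\<lambda>t. 2 * ip (d t) (w t))"
    unfolding pw_smooth_def
  proof (intro conjI exI[of _ S] exI[of _ "2 * ((norm emb)\<^sup>2 * K * B)"] ballI S(1))
    show "continuous_on {0..T} (\<lambda>t. ip (w t) (w t))"
      using w by (intro ip.continuous_on) (auto simp: pw_smooth_def)
    show "(\<lambda>t. 2 * ip (d t) (w t)) \<in> borel_measurable \<mu>"
      using ip_integrable[OF pw_smooth_deriv_L2[OF w] pw_smooth_L2[OF w]] by simp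
    show "((\<lambda>t. ip (w t) (w t)) has_vector_derivative 2 * ip (d t) (w t)) (at t)" if "t \<in> {0<..<T} - S" for t
      using ip.has_vector_derivative[OF S(2)[OF that] S(2)[OF that]]
      by (simp add: ip_sym[of "w t"])
    fix t assume t: "t \<in> {0<..<T}"
    have "\<bar>ip (d t) (w t)\<bar> \<le> (norm emb)\<^sup>2 * norm (d t) * norm (w t)" by (rule ip_le)
    also have "\<dots> \<le> (norm emb)\<^sup>2 * K * B"
      using K[OF t] B[OF t] order_trans[OF norm_ge_zero K[OF t]] by (intro mult_mono mult_left_mono) auto
    finally show "norm (2 * ip (d t) (w t)) \<le> 2 * ((norm emb)\<^sup>2 * K * B)" by simp
  qed
  from pw_smooth_integral_deriv[OF T_pos this]
  have "2 * (LINT t|\<mu>. ip (d t) (w t)) = ip (w T) (w T)" by (simp add: w0 ip.zero_left)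
  then have "0 \<le> (LINT t|\<mu>. ip (d t) (w t))" using ip_nonneg[of "w T"] by linarith
  then show ?thesis
    unfolding op_B_eq[OF w pw_smooth_L2[OF w]] using form_integral_ge[OF pw_smooth_L2[OF w]] by linarith
qed

lemma L2n_zero_imp_eq_on_I:
  assumes "w \<in> L2_space T" "L2n T w = 0"
  shows "eq_on_I T w (\<lambda>t. 0)"
proof -
  have "(LINT t|\<mu>. (norm (w t))\<^sup>2) = 0" using assms(2) L2n_power2[of T w] by simp
  then have "AE t in \<mu>. (norm (w t))\<^sup>2 = 0"
    using assms(1) by (subst (asm) integral_nonneg_eq_0_iff_AE) (auto simp: L2_space_def)
  then show ?thesis by (simp add: eq_on_I_def)
qed

end

lemma (in coercive_form) form_diff_integral:
  assumes "u \<in> L2_space T" "w \<in> L2_space T" "v \<in> L2_space T"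
  shows "(LINT t|\<mu>. a t (u t - w t) (v t)) = (LINT t|\<mu>. a t (u t) (v t)) - (LINT t|\<mu>. a t (w t) (v t))"
proof -
  have "(LINT t|\<mu>. a t (u t - w t) (v t)) = (LINT t|\<mu>. a t (u t) (v t) - a t (w t) (v t))"
    using form_bilinear
    by (intro integral_lebesgue_on_cong_AE) (auto elim!: eventually_mono simp: bilinear_lsub)
  then show ?thesis using form_integrable assms by simp
qed

lemma (in parabolic_problem) op_B_zero:
  assumes "v \<in> L2_space T" shows "op_B T emb a (\<lambda>t. 0) v = 0"
proof -
  have z: "pw_smooth T (\<lambda>t. 0 :: 'v) (\<lambda>t. 0)"
    unfolding pw_smooth_def by (auto intro!: exI[of _ "{}"] exI[of _ 0])
  have "(LINT t|\<mu>. a t 0 (v t)) = 0"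
    using form_diff_integral[OF pw_smooth_L2[OF z] pw_smooth_L2[OF z] assms] by simp
  then show ?thesis unfolding op_B_eq[OF z assms] by (simp add: ip.zero_left)
qed

lemma (in parabolic_problem) op_B_diff:
  assumes u: "pw_smooth T u d" and w: "pw_smooth T w e" and v: "v \<in> L2_space T"
  shows "pw_smooth T (\<lambda>t. u t - w t) (\<lambda>t. d t - e t)"
    and "op_B T emb a (\<lambda>t. u t - w t) v = op_B T emb a u v - op_B T emb a w v"
proof -
  show s: "pw_smooth T (\<lambda>t. u t - w t) (\<lambda>t. d t - e t)"
    using pw_smooth_lincomb[OF u w, of 1 "-1"] by simp
  have "(LINT t|\<mu>. ip (d t - e t) (v t)) = (LINT t|\<mu>. ip (d t) (v t)) - (LINT t|\<mu>. ip (e t) (v t))"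
    using ip_integrable[OF pw_smooth_deriv_L2[OF u] v] ip_integrable[OF pw_smooth_deriv_L2[OF w] v]
    by (simp add: ip.diff_left)
  then show "op_B T emb a (\<lambda>t. u t - w t) v = op_B T emb a u v - op_B T emb a w v"
    unfolding op_B_eq[OF s v] op_B_eq[OF u v] op_B_eq[OF w v]
      form_diff_integral[OF pw_smooth_L2[OF u] pw_smooth_L2[OF w] v] by simp
qed

section \<open>The theorem of Lax and Milgram\<close>

text \<open>The representing vector minimises the quadratic functional \<open>\<parallel>x\<parallel>\<^sup>2 / 2 - f x\<close>; the
  parallelogram identity makes minimising sequences Cauchy.\<close>

lemma riesz_representation:
  fixes f :: "'a::{real_inner,complete_space} \<Rightarrow> real"
  assumes f: "bounded_linear f"
  shows "\<exists>z. \<forall>x. f x = inner z x"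
proof -
  interpret f: bounded_linear f by (rule f)
  define J where "J x = (norm x)\<^sup>2 / 2 - f x" for x
  obtain B where B: "B > 0" "\<And>x. norm (f x) \<le> norm x * B" using f.pos_bounded by blast
  have low: "- (B\<^sup>2 / 2) \<le> J x" for x
  proof -
    have "0 \<le> (norm x - B)\<^sup>2" by simp
    then have "norm x * B \<le> (norm x)\<^sup>2 / 2 + B\<^sup>2 / 2" by (simp add: power2_diff)
    moreover have "f x \<le> norm x * B" using B(2)[of x] by simp
    ultimately show ?thesis unfolding J_def by linarith
  qed
  define m where "m = (INF x. J x)"
  have bdd: "bdd_below (range J)" using low by (intro bdd_belowI2)
  have m_le: "m \<le> J x" for x unfolding m_def by (rule cINF_lower[OF bdd]) simp
  have "\<exists>x. J x < m + 1 / real (Suc i)" for i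
    using cINF_less_iff[OF _ bdd, of "m + 1 / real (Suc i)"] by (auto simp: m_def)
  then obtain X where X: "\<And>i. J (X i) < m + 1 / real (Suc i)" by metis
  have par: "(norm (x - y))\<^sup>2 = 4 * (J x + J y - 2 * J ((1/2) *\<^sub>R (x + y)))" for x y
    unfolding J_def power2_norm_eq_inner
    by (simp add: f.add f.scaleR inner_add inner_diff inner_commute[of y x] field_simps)
  have cau: "(norm (X i - X j))\<^sup>2 \<le> 4 * (1 / real (Suc i) + 1 / real (Suc j))" for i j
  proof -
    have *: "p + q - 2 * m' \<le> d + e" if "p < m + d" "q < m + e" "m \<le> m'" for p q m' d e
      using that by linarith
    show ?thesis
      unfolding par[of "X i" "X j"] by (intro mult_left_mono *[OF X X m_le]) simp
  qed
  have "Cauchy X"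
  proof (rule CauchyI)
    fix e :: real assume e: "e > 0"
    obtain k where k: "8 / e\<^sup>2 < real k" using reals_Archimedean2 by blast
    have "norm (X i - X j) < e" if "k \<le> i" "k \<le> j" for i j
    proof -
      have kp: "real k > 0" using k e by (meson divide_pos_pos less_trans zero_less_numeral zero_less_power)
      have "1 / real (Suc i) \<le> 1 / real k" "1 / real (Suc j) \<le> 1 / real k"
        using that kp by (auto intro!: divide_left_mono mult_pos_pos)
      then have "(norm (X i - X j))\<^sup>2 \<le> 8 / real k" 
      proof -
        have "4 * (1 / real (Suc i) + 1 / real (Suc j)) \<le> 4 * (1 / real k + 1 / real k)"
          using \<open>1 / real (Suc i) \<le> 1 / real k\<close> \<open>1 / real (Suc j) \<le> 1 / real k\<close>
          by (intro mult_left_mono add_mono) auto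
        then show ?thesis using cau[of i j] by (simp del: of_nat_Suc)
      qed
      also have "\<dots> < e\<^sup>2" using k kp e by (simp add: field_simps)
      finally show ?thesis using e by (simp add: power2_less_imp_less)
    qed
    then show "\<exists>M. \<forall>i\<ge>M. \<forall>j\<ge>M. norm (X i - X j) < e" by blast
  qed
  then obtain z where z: "X \<longlonglongrightarrow> z" using convergent_eq_Cauchy by blast
  have "(\<lambda>i. J (X i)) \<longlonglongrightarrow> J z"
    unfolding J_def by (intro tendsto_intros z f.tendsto) simp
  moreover have "(\<lambda>i. m + 1 / real (Suc i)) \<longlonglongrightarrow> m + 0"
    by (intro tendsto_intros LIMSEQ_Suc[OF lim_1_over_n])
  ultimately have "J z \<le> m + 0"
    using X by (intro LIMSEQ_le[of "\<lambda>i. J (X i)" _ "\<lambda>i. m + 1 / real (Suc i)"]) (auto intro: less_imp_le)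
  then have min: "J z \<le> J x" for x using m_le[of x] by linarith
  have "f x = inner z x" for x
  proof -
    define c where "c = inner z x - f x"
    have pos: "0 \<le> t * c + t\<^sup>2 * (norm x)\<^sup>2 / 2" for t
    proof -
      have "J (z + t *\<^sub>R x) = J z + (t * c + t\<^sup>2 * (norm x)\<^sup>2 / 2)"
        unfolding J_def c_def power2_norm_eq_inner
        by (simp add: f.add f.scaleR inner_add inner_commute[of x z] power2_eq_square field_simps)
      then show ?thesis using min[of "z + t *\<^sub>R x"] by linarith
    qed
    define q where "q = (norm x)\<^sup>2 + 1"
    have q: "q > 0" "(norm x)\<^sup>2 \<le> q" by (auto simp: q_def add_nonneg_pos)
    have "0 \<le> (- c / q) * c + (- c / q)\<^sup>2 * (norm x)\<^sup>2 / 2" by (rule pos)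
    also have "\<dots> \<le> (- c / q) * c + (- c / q)\<^sup>2 * q / 2"
      using q by (intro add_left_mono divide_right_mono mult_left_mono) auto
    also have "\<dots> = - (c\<^sup>2 / (2 * q))" using q by (simp add: power2_eq_square field_simps)
    finally have "c\<^sup>2 / (2 * q) \<le> 0" by simp
    then have "c = 0" using q by (simp add: divide_le_0_iff)
    then show ?thesis by (simp add: c_def)
  qed
  then show ?thesis by blast
qed

text \<open>The equation is the fixed point equation of a contraction.\<close>

lemma lax_milgram:
  fixes b :: "'a::{real_inner,complete_space} \<Rightarrow> 'a \<Rightarrow> real"
  assumes b: "bounded_bilinear b" and f: "bounded_linear f"
    and c: "c > 0" "\<And>x. b x x \<ge> c * (norm x)\<^sup>2"
  shows "\<exists>w. \<forall>p. b w p = f p"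
proof -
  interpret b: bounded_bilinear b by (rule b)
  obtain K0 where K0: "K0 > 0" "\<And>x y. norm (b x y) \<le> norm x * norm y * K0" using b.pos_bounded by blast
  define K where "K = max K0 c"
  have K: "K > 0" "c \<le> K" "\<bar>b x y\<bar> \<le> K * norm x * norm y" for x y
  proof -
    have "norm x * norm y * K0 \<le> norm x * norm y * K" by (intro mult_left_mono) (auto simp: K_def)
    then show "\<bar>b x y\<bar> \<le> K * norm x * norm y" using K0(2)[of x y] by (simp add: mult_ac)
  qed (use c K0 in \<open>auto simp: K_def\<close>)
  have "\<forall>w. \<exists>z. \<forall>p. b w p = inner z p"
    using riesz_representation[OF b.bounded_linear_right] by blast
  then obtain B where B: "\<And>w p. b w p = inner (B w) p" by metis
  obtain z where z: "\<And>p. f p = inner z p" using riesz_representation[OF f] by blast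
  have Bdiff: "inner (B w - B w') p = b (w - w') p" for w w' p
    by (simp add: inner_diff_left B[symmetric] b.diff_left)
  have Bnorm: "norm (B w - B w') \<le> K * norm (w - w')" for w w'
  proof -
    have "norm (B w - B w') * norm (B w - B w') = b (w - w') (B w - B w')"
      by (simp add: Bdiff[symmetric] power2_norm_eq_inner[symmetric] power2_eq_square)
    also have "\<dots> \<le> K * norm (w - w') * norm (B w - B w')"
      using K(3)[of "w - w'" "B w - B w'"] by simp
    finally show ?thesis
      using K(1) by (cases "norm (B w - B w') = 0") auto
  qed
  define \<rho> where "\<rho> = c / K\<^sup>2"
  have rho: "\<rho> > 0" using c K by (simp add: \<rho>_def)
  define \<Phi> where "\<Phi> = (\<lambda>w::'a. w - \<rho> *\<^sub>R (B w - z))"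
  define l where "l = sqrt (1 - c\<^sup>2 / K\<^sup>2)"
  have cK: "0 < c\<^sup>2 / K\<^sup>2" "c\<^sup>2 / K\<^sup>2 \<le> 1" using c K by (auto simp: power_mono)
  have "\<exists>!w. \<Phi> w = w"
  proof (rule banach_fix_type)
    show "0 \<le> l" "l < 1" using cK by (auto simp: l_def)
    show "\<forall>w w'. dist (\<Phi> w) (\<Phi> w') \<le> l * dist w w'"
    proof (intro allI)
      fix w w' :: 'a
      define d where "d = w - w'"
      define D where "D = B w - B w'"
      have eq: "\<Phi> w - \<Phi> w' = d - \<rho> *\<^sub>R D" by (simp add: \<Phi>_def d_def D_def algebra_simps)
      have "inner D d = b d d" by (simp add: D_def d_def Bdiff)
      then have "(norm (d - \<rho> *\<^sub>R D))\<^sup>2 = (norm d)\<^sup>2 - 2 * \<rho> * b d d + \<rho>\<^sup>2 * (norm D)\<^sup>2"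
        unfolding power2_norm_eq_inner
        by (simp add: inner_diff inner_commute[of d D] power2_eq_square algebra_simps)
      also have "\<dots> \<le> (norm d)\<^sup>2 - 2 * \<rho> * (c * (norm d)\<^sup>2) + \<rho>\<^sup>2 * (K * norm d)\<^sup>2"
        using c(2)[of d] rho Bnorm[of w w']
        by (intro add_mono diff_left_mono mult_left_mono power_mono) (auto simp: D_def d_def)
      also have "\<dots> = (1 - c\<^sup>2 / K\<^sup>2) * (norm d)\<^sup>2"
        using K(1) by (simp add: \<rho>_def power2_eq_square field_simps)
      also have "\<dots> = (l * norm d)\<^sup>2" using cK by (simp add: l_def power_mult_distrib)
      finally have "norm (d - \<rho> *\<^sub>R D) \<le> l * norm d"
        by (rule power2_le_imp_le) (use cK in \<open>simp add: l_def\<close>)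
      then show "dist (\<Phi> w) (\<Phi> w') \<le> l * dist w w'"
        by (simp add: dist_norm eq d_def)
    qed
  qed
  then obtain w where "\<Phi> w = w" by blast
  then have "B w = z" using rho by (simp add: \<Phi>_def)
  then show ?thesis using B z by auto
qed

section \<open>A profile for smoothing jumps\<close>

text \<open>A function on the unit interval that drops from one to zero, has mean zero and is small in
  \<open>L\<^sub>2\<close>. Adding its multiples to a discontinuous piecewise affine function removes the jumps; since the
  mean \<open>P 1 - P 0\<close> vanishes, its derivative acts on affine functions exactly like minus the point
  evaluation at zero. The square is bounded through a majorant \<open>z\<close> with primitive \<open>Z\<close>. The witness is
  \<open>r s = (1 - s)\<^sup>n (1 - (n + 2) s)\<close>.\<close>

lemma radau_profile:
  fixes \<epsilon> :: real
  assumes "\<epsilon> > 0"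
  obtains r r' P :: "real \<Rightarrow> real" and Z z :: "real \<Rightarrow> real" and R :: real where
    "\<And>s. (r has_real_derivative r' s) (at s)" "continuous_on UNIV r'" "r 0 = 1" "r 1 = 0"
    "\<And>s. (P has_real_derivative r s) (at s)" "P 0 = 0" "P 1 = 0"
    "\<And>s. s \<in> {0..1} \<Longrightarrow> \<bar>r s\<bar> \<le> 4" "\<And>s. s \<in> {0..1} \<Longrightarrow> \<bar>r' s\<bar> \<le> R"
    "\<And>s. (Z has_real_derivative z s) (at s)" "continuous_on UNIV z"
    "\<And>s. s \<in> {0..1} \<Longrightarrow> (r s)\<^sup>2 \<le> z s" "Z 1 - Z 0 \<le> \<epsilon>"
proof -
  obtain m where m: "8 / \<epsilon> < real m" using reals_Archimedean2 by blast
  define n where "n = Suc m"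
  define r where "r s = (1 - s) ^ n * (1 - (real n + 2) * s)" for s :: real
  define r' where "r' s = - (real n * (1 - s) ^ m) * (1 - (real n + 2) * s) - (1 - s) ^ n * (real n + 2)" for s :: real
  define P where "P s = s * (1 - s) ^ (n + 1)" for s :: real
  define z where "z s = 4 * (2 * (1 - s) ^ n - r s)" for s :: real
  define Z where "Z s = 4 * (- 2 * (1 - s) ^ (n + 1) / (real n + 1) - P s)" for s :: real
  have r: "(r has_real_derivative r' s) (at s)" for s
    unfolding r_def[abs_def] r'_def n_def
    by (rule derivative_eq_intros refl | simp)+ (simp add: algebra_simps)
  have P: "(P has_real_derivative r s) (at s)" for s
    unfolding P_def[abs_def] r_def
    by (rule derivative_eq_intros refl | simp)+ (simp add: algebra_simps)
  have Z: "(Z has_real_derivative z s) (at s)" for s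
    unfolding Z_def[abs_def] z_def
    by (rule derivative_eq_intros P refl | simp)+ (simp add: field_simps add_nonneg_eq_0_iff)
  have c: "continuous_on UNIV r'" "continuous_on UNIV z"
    unfolding r'_def z_def r_def by (intro continuous_intros)+
  have bern: "(1 - s) ^ n * (1 + real n * s) \<le> 1" if "s \<in> {0..1}" for s
  proof -
    have "1 + real n * s \<le> (1 + s) ^ n" using that by (intro Bernoulli_inequality) auto
    then have "(1 - s) ^ n * (1 + real n * s) \<le> (1 - s) ^ n * (1 + s) ^ n"
      using that by (intro mult_left_mono) auto
    also have "\<dots> = (1 - s\<^sup>2) ^ n" by (simp add: power_mult_distrib[symmetric] power2_eq_square algebra_simps)
    also have "\<dots> \<le> 1" using that by (intro power_le_one) (auto simp: power_le_one)
    finally show ?thesis .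
  qed
  have parts: "0 \<le> (1 - s) ^ n" "(1 - s) ^ n \<le> 1" "0 \<le> (real n + 2) * s * (1 - s) ^ n"
    "(real n + 2) * s * (1 - s) ^ n \<le> 3" "r s = (1 - s) ^ n - (real n + 2) * s * (1 - s) ^ n"
    if "s \<in> {0..1}" for s
  proof -
    show p: "0 \<le> (1 - s) ^ n" "(1 - s) ^ n \<le> 1" using that by (auto intro: power_le_one)
    show "0 \<le> (real n + 2) * s * (1 - s) ^ n" using that by simp
    have "s * (1 - s) ^ n \<le> 1 * 1" using that p by (intro mult_mono) auto
    then show "(real n + 2) * s * (1 - s) ^ n \<le> 3"
      using bern[OF that] p by (simp add: algebra_simps)
    show "r s = (1 - s) ^ n - (real n + 2) * s * (1 - s) ^ n" by (simp add: r_def algebra_simps)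
  qed
  have r4: "\<bar>r s\<bar> \<le> 4" if "s \<in> {0..1}" for s using parts[OF that] by linarith
  have rz: "(r s)\<^sup>2 \<le> z s" if "s \<in> {0..1}" for s
  proof -
    have "(r s)\<^sup>2 = \<bar>r s\<bar> * \<bar>r s\<bar>" by (simp add: power2_eq_square)
    also have "\<dots> \<le> 4 * \<bar>r s\<bar>" using r4[OF that] by (intro mult_right_mono) auto
    also have "\<dots> \<le> z s"
    proof -
      have "\<bar>b - c\<bar> \<le> 2 * b - (b - c)" if "0 \<le> b" "0 \<le> c" for b c :: real using that by linarith
      from this[OF parts(1,3)[OF that]] show ?thesis
        unfolding z_def parts(5)[OF that] by (intro mult_left_mono) auto
    qed
    finally show ?thesis .
  qed
  have "bounded (r' ` {0..1})"
    by (intro compact_imp_bounded compact_continuous_image continuous_on_subset[OF c(1)]) auto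
  then obtain R where R: "\<forall>x\<in>r' ` {0..1}. norm x \<le> R" unfolding bounded_iff by blast
  have "Z 1 - Z 0 = 8 / (real n + 1)" by (simp add: Z_def P_def)
  also have "\<dots> \<le> \<epsilon>"
  proof -
    have "8 < \<epsilon> * real m" using m assms by (simp add: field_simps)
    also have "\<dots> \<le> \<epsilon> * (real n + 1)" using assms by (intro mult_left_mono) (auto simp: n_def)
    finally show ?thesis by (simp add: field_simps add_nonneg_pos)
  qed
  finally have "Z 1 - Z 0 \<le> \<epsilon>" .
  then show ?thesis
    using that[of r r' P R Z z] r c P Z r4 rz R by (auto simp: r_def P_def n_def)
qed

section \<open>Uniform partitions of the time interval\<close>

lemma pw_smooth_cong:
  assumes u: "pw_smooth T u d" and eq: "\<And>t. t \<in> {0..T} \<Longrightarrow> u t = w t"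
  shows "pw_smooth T w d"
proof -
  obtain S where S: "finite S" "\<And>t. t \<in> {0<..<T} - S \<Longrightarrow> (u has_vector_derivative d t) (at t)"
    using u unfolding pw_smooth_def by blast
  have "(w has_vector_derivative d t) (at t)" if "t \<in> {0<..<T} - S" for t
    by (rule has_vector_derivative_transform_within_open[OF S(2)[OF that], of "{0<..<T}"]) (use that eq in auto)
  moreover have "continuous_on {0..T} w"
    using u eq by (subst continuous_on_cong[of "{0..T}" "{0..T}" w u]) (auto simp: pw_smooth_def)
  ultimately show ?thesis using u S(1) unfolding pw_smooth_def by blast
qed

text \<open>The interval \<open>[0,T]\<close> is cut into \<open>n\<close> cells of length \<open>h\<close>.\<close>

locale uniform_grid =
  fixes T h :: real and n :: nat
  assumes grid_T_pos: "T > 0" and n_pos: "n \<ge> 1" and h_def: "h = T / real n"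
begin

text \<open>The number of the cell that contains \<open>t\<close>, the position of \<open>t\<close> in it, scaled to the unit
  interval, and the indicator functions of the cells. Cells are closed on the left, so that the end
  point \<open>T\<close> belongs to the cell with number \<open>n\<close>.\<close>

definition cell :: "real \<Rightarrow> nat" where "cell t = nat \<lfloor>t / h\<rfloor>"
definition loc :: "real \<Rightarrow> real" where "loc t = t / h - real (cell t)"
definition cind :: "nat \<Rightarrow> real \<Rightarrow> real" where "cind k t = (if cell t = k then 1 else 0)"

lemma h_pos: "h > 0" using grid_T_pos n_pos by (simp add: h_def)
lemma n_h: "real n * h = T" using n_pos by (simp add: h_def)
lemma h_le: "h \<le> T" using grid_T_pos n_pos by (simp add: h_def field_simps)

lemma cell_eqI: "real k * h \<le> t \<Longrightarrow> t < real (Suc k) * h \<Longrightarrow> cell t = k"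
proof -
  assume "real k * h \<le> t" "t < real (Suc k) * h"
  then have "real k \<le> t / h" "t / h < real k + 1" using h_pos by (auto simp: field_simps)
  then have "\<lfloor>t / h\<rfloor> = int k" by (intro floor_unique) auto
  then show ?thesis by (simp add: cell_def)
qed

lemma cell_bounds:
  assumes "0 \<le> t"
  shows "real (cell t) * h \<le> t" "t < real (Suc (cell t)) * h" "0 \<le> loc t" "loc t < 1"
proof -
  have "0 \<le> \<lfloor>t / h\<rfloor>" using assms h_pos by simp
  then have c: "real (cell t) = of_int \<lfloor>t / h\<rfloor>" by (simp add: cell_def)
  have "real (cell t) \<le> t / h" "t / h < real (cell t) + 1" unfolding c by linarith+
  then show "real (cell t) * h \<le> t" "t < real (Suc (cell t)) * h" "0 \<le> loc t" "loc t < 1"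
    using h_pos by (auto simp: field_simps loc_def)
qed

lemma cell_less: "0 \<le> t \<Longrightarrow> t < T \<Longrightarrow> cell t < n"
proof -
  assume "0 \<le> t" "t < T"
  then have "real (cell t) * h < real n * h" using cell_bounds(1)[of t] n_h by linarith
  then show ?thesis using h_pos by simp
qed

lemma loc_unit: "t \<in> {0<..<T} \<Longrightarrow> loc t \<in> {0..1}"
  using cell_bounds[of t] by auto

lemma cell_T: "cell T = n" and cell_0: "cell 0 = 0" and cell_node: "cell (real k * h) = k"
  using h_pos n_h by (auto intro!: cell_eqI simp: algebra_simps)

lemma loc_0: "loc 0 = 0" and loc_T: "loc T = 0"
  using n_h h_pos by (auto simp: loc_def cell_0 cell_T field_simps)

lemma cell_measurable: "cell \<in> measurable (lebesgue_on {0<..<T}) (count_space UNIV)"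
proof -
  have "(\<lambda>t. t / h) \<in> borel_measurable (lebesgue_on {0<..<T})"
    by (intro continuous_on_imp_measurable_lebesgue_on continuous_intros) (use h_pos in auto)
  from measurable_compose[OF this measurable_real_floor]
  have "(\<lambda>t. \<lfloor>t / h\<rfloor>) \<in> measurable (lebesgue_on {0<..<T}) (count_space UNIV)" .
  from measurable_compose[OF this, of nat "count_space UNIV"] show ?thesis
    unfolding cell_def[abs_def] by simp
qed

lemma cellwise_measurable:
  assumes "\<And>k. f k \<in> borel_measurable (lebesgue_on {0<..<T})"
  shows "(\<lambda>t. f (cell t) t) \<in> borel_measurable (lebesgue_on {0<..<T})"
  by (rule measurable_compose_countable[OF _ cell_measurable]) (rule assms)

lemma cind_measurable: "cind k \<in> borel_measurable (lebesgue_on {0<..<T})"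
  unfolding cind_def[abs_def] by (rule cellwise_measurable[of "\<lambda>j t. if j = k then 1 else 0"]) simp

lemma cind_nonneg [simp]: "0 \<le> cind k t" and cind_le_one [simp]: "cind k t \<le> 1" and cind_abs [simp]: "\<bar>cind k t\<bar> = cind k t"
  by (auto simp: cind_def)

lemma cind_cong: "(cell t = k \<Longrightarrow> f t = g t) \<Longrightarrow> cind k t * f t = cind k t * g t"
  by (auto simp: cind_def)

text \<open>Pieces \<open>p k\<close> that agree at the nodes are glued along the cells. The piece with number \<open>n\<close>
  supplies the value at \<open>T\<close>.\<close>

lemma glue_eq:
  assumes match: "\<And>k. k < n \<Longrightarrow> p k (real (Suc k) * h) = p (Suc k) (real (Suc k) * h)"
    and k: "k < n" and t: "t \<in> {real k * h..real (Suc k) * h}"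
  shows "p (cell t) t = p k t"
proof (cases "t < real (Suc k) * h")
  case True
  then have "cell t = k" using t by (intro cell_eqI) auto
  then show ?thesis by simp
next
  case False
  then have "t = real (Suc k) * h" using t by auto
  then show ?thesis using match[OF k] cell_node[of "Suc k"] by simp
qed

lemma cells_cover: "(\<Union>k\<in>{..<n}. {real k * h..real (Suc k) * h}) = {0..T}"
proof (intro equalityI subsetI)
  fix t assume "t \<in> (\<Union>k\<in>{..<n}. {real k * h..real (Suc k) * h})"
  then obtain k where k: "k < n" "real k * h \<le> t" "t \<le> real (Suc k) * h" by auto
  have "real (Suc k) * h \<le> real n * h" using k h_pos by (intro mult_right_mono) auto
  moreover have "0 \<le> real k * h" using h_pos by simp
  ultimately show "t \<in> {0..T}" using k n_h by auto
next
  fix t assume t: "t \<in> {0..T}"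
  show "t \<in> (\<Union>k\<in>{..<n}. {real k * h..real (Suc k) * h})"
  proof (cases "t = T")
    case True
    have "real (n - 1) * h \<le> real n * h" using h_pos by (intro mult_right_mono) auto
    then have "t \<in> {real (n - 1) * h..real (Suc (n - 1)) * h}" using n_pos n_h True by auto
    then show ?thesis using n_pos by (intro UN_I[of "n - 1"]) auto
  next
    case False
    then show ?thesis
      using t cell_less[of t] cell_bounds[of t] by (intro UN_I[of "cell t"]) auto
  qed
qed

lemma pw_smooth_glue:
  fixes p :: "nat \<Rightarrow> real \<Rightarrow> 'b::real_normed_vector"
  assumes match: "\<And>k. k < n \<Longrightarrow> p k (real (Suc k) * h) = p (Suc k) (real (Suc k) * h)"
    and deriv: "\<And>k t. (p k has_vector_derivative d k t) (at t)"
    and cont: "\<And>k. continuous_on UNIV (d k)"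
  shows "pw_smooth T (\<lambda>t. p (cell t) t) (\<lambda>t. d (cell t) t)"
  unfolding pw_smooth_def
proof (intro conjI)
  have pc: "continuous_on X (p k)" for X k
    using deriv[of k]
    by (intro continuous_at_imp_continuous_on ballI has_vector_derivative_continuous) blast
  have "continuous_on (\<Union>k\<in>{..<n}. {real k * h..real (Suc k) * h}) (\<lambda>t. p (cell t) t)"
  proof (rule continuous_on_closed_Union)
    fix k assume "k \<in> {..<n}"
    then show "continuous_on {real k * h..real (Suc k) * h} (\<lambda>t. p (cell t) t)"
      using pc[of "{real k * h..real (Suc k) * h}" k] glue_eq[of p, OF match]
      by (subst continuous_on_cong[of _ "{real k * h..real (Suc k) * h}" _ "p k"]) auto
  qed auto
  then show "continuous_on {0..T} (\<lambda>t. p (cell t) t)" by (simp only: cells_cover)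
  let ?S = "(\<lambda>k. real k * h) ` {..n}"
  have "((\<lambda>t. p (cell t) t) has_vector_derivative d (cell t) t) (at t)" if t: "t \<in> {0<..<T} - ?S" for t
  proof -
    let ?k = "cell t"
    have k: "?k < n" "real ?k * h \<le> t" "t < real (Suc ?k) * h"
      using t cell_less[of t] cell_bounds[of t] by auto
    have "real ?k * h \<in> ?S" by (rule imageI) (use k in auto)
    moreover have "t \<notin> ?S" using t by blast
    ultimately have "real ?k * h \<noteq> t" by metis
    then have kt: "t \<in> {real ?k * h<..<real (Suc ?k) * h}" using k by auto
    show ?thesis
    proof (rule has_vector_derivative_transform_within_open[OF deriv])
      show "t \<in> {real ?k * h<..<real (Suc ?k) * h}" by (rule kt)
      fix x assume "x \<in> {real ?k * h<..<real (Suc ?k) * h}"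
      then show "p ?k x = p (cell x) x" by (subst cell_eqI[of ?k x]) auto
    qed simp
  qed
  then show "\<exists>S. finite S \<and> (\<forall>t\<in>{0<..<T} - S. ((\<lambda>t. p (cell t) t) has_vector_derivative d (cell t) t) (at t))"
    by (intro exI[of _ ?S] conjI ballI) simp
  show "(\<lambda>t. d (cell t) t) \<in> borel_measurable (lebesgue_on {0<..<T})"
    by (rule cellwise_measurable[of d, OF continuous_on_imp_measurable_lebesgue_on[OF continuous_on_subset[OF cont]]]) simp
  have "\<forall>k. \<exists>K. \<forall>t\<in>{0..T}. norm (d k t) \<le> K"
  proof
    fix k
    have "bounded (d k ` {0..T})"
      by (intro compact_imp_bounded compact_continuous_image continuous_on_subset[OF cont]) auto
    then show "\<exists>K. \<forall>t\<in>{0..T}. norm (d k t) \<le> K" unfolding bounded_iff by auto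
  qed
  then obtain K where K: "\<And>k t. t \<in> {0..T} \<Longrightarrow> norm (d k t) \<le> K k" by metis
  have "norm (d (cell t) t) \<le> (\<Sum>k<n. \<bar>K k\<bar>)" if "t \<in> {0<..<T}" for t
  proof -
    have "norm (d (cell t) t) \<le> \<bar>K (cell t)\<bar>" using K[of t "cell t"] that by auto
    also have "\<dots> \<le> (\<Sum>k<n. \<bar>K k\<bar>)" using cell_less[of t] that by (intro member_le_sum) auto
    finally show ?thesis .
  qed
  then show "\<exists>K. \<forall>t\<in>{0<..<T}. norm (d (cell t) t) \<le> K" by blast
qed

text \<open>The primitive is glued from its restriction to one cell and constants.\<close>

lemma cell_integral:
  fixes \<Gamma> G :: "real \<Rightarrow> real"
  assumes k: "k < n" and \<Gamma>: "\<And>s. (\<Gamma> has_real_derivative G s) (at s)" and G: "continuous_on UNIV G"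
  shows "integrable (lebesgue_on {0<..<T}) (\<lambda>t. cind k t * G (loc t))"
    and "(LINT t|lebesgue_on {0<..<T}. cind k t * G (loc t)) = h * (\<Gamma> 1 - \<Gamma> 0)"
proof -
  define p where "p j t = (if j < k then 0 else if j = k then h * (\<Gamma> (t / h - real k) - \<Gamma> 0) else h * (\<Gamma> 1 - \<Gamma> 0))" for j t
  define d where "d j t = (if j = k then G (t / h - real k) else 0)" for j t
  have pw: "pw_smooth T (\<lambda>t. p (cell t) t) (\<lambda>t. d (cell t) t)"
  proof (rule pw_smooth_glue)
    show "p j (real (Suc j) * h) = p (Suc j) (real (Suc j) * h)" for j
      using h_pos by (auto simp: p_def field_simps)
    have *: "((\<lambda>t. h * (\<Gamma> (t / h - real k) - \<Gamma> 0)) has_real_derivative G (t / h - real k)) (at t)" for t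
      by (rule DERIV_cong[OF DERIV_cmult[OF DERIV_diff[OF DERIV_chain2[OF \<Gamma>] DERIV_const]]])
         (use h_pos in \<open>auto intro!: derivative_eq_intros\<close>)
    show "(p j has_vector_derivative d j t) (at t)" for j t
      using *[of t] unfolding p_def[abs_def] d_def
      by (cases "j < k"; cases "j = k") (simp_all add: has_real_derivative_iff_has_vector_derivative)
    show "continuous_on UNIV (d j)" for j
      unfolding d_def[abs_def] using h_pos
      by (cases "j = k") (auto intro!: continuous_intros continuous_on_compose2[OF G])
  qed
  have eq: "d (cell t) t = cind k t * G (loc t)" for t by (simp add: d_def cind_def loc_def)
  have "d (cell t) t = cind k t * G (loc t)" for t by (rule eq)
  then show "(LINT t|lebesgue_on {0<..<T}. cind k t * G (loc t)) = h * (\<Gamma> 1 - \<Gamma> 0)"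
    using pw_smooth_integral_deriv[OF grid_T_pos pw] k n_pos n_h h_pos
    by (simp add: p_def cell_T cell_0)
  show "integrable (lebesgue_on {0<..<T}) (\<lambda>t. cind k t * G (loc t))"
    using pw_smooth_deriv_L2[OF pw] unfolding eq
    by (auto simp: L2_space_def intro!: finite_measure.square_integrable_imp_integrable[OF finite_measure_interval])
qed

lemma cind_integral: "k < n \<Longrightarrow> (LINT t|lebesgue_on {0<..<T}. cind k t) = h"
  using cell_integral(2)[of k "\<lambda>s. s" "\<lambda>s. 1"] by simp

lemma cind_integrable: 
  fixes f :: "real \<Rightarrow> real"
  assumes f: "integrable (lebesgue_on {0<..<T}) f"
  shows "integrable (lebesgue_on {0<..<T}) (\<lambda>t. cind k t * f t)"
  by (rule Bochner_Integration.integrable_bound[OF f])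
     (auto intro!: borel_measurable_times cind_measurable borel_measurable_integrable[OF f] AE_I2
       simp: abs_mult mult_left_le_one_le)

lemma integral_cells:
  fixes f :: "real \<Rightarrow> real"
  assumes f: "integrable (lebesgue_on {0<..<T}) f"
  shows "(LINT t|lebesgue_on {0<..<T}. f t) = (\<Sum>k<n. LINT t|lebesgue_on {0<..<T}. cind k t * f t)"
proof -
  have "(LINT t|lebesgue_on {0<..<T}. f t) = (LINT t|lebesgue_on {0<..<T}. (\<Sum>k<n. cind k t * f t))"
  proof (rule Bochner_Integration.integral_cong)
    fix t assume "t \<in> space (lebesgue_on {0<..<T})"
    then have "cell t < n" using cell_less[of t] by simp
    then have "(\<Sum>k<n. cind k t) = 1" by (simp add: cind_def)
    then show "f t = (\<Sum>k<n. cind k t * f t)" by (simp add: sum_distrib_right[symmetric])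
  qed simp
  also have "\<dots> = (\<Sum>k<n. LINT t|lebesgue_on {0<..<T}. cind k t * f t)"
    by (rule Bochner_Integration.integral_sum) (rule cind_integrable[OF f])
  finally show ?thesis .
qed

end

section \<open>The discrete spaces\<close>

context uniform_grid
begin

lemma time_space_interp:
  assumes N: "n = 2 * N" and f: "f \<in> time_space T N" and k: "k < n"
    and t: "t \<in> {real k * h..real (Suc k) * h}"
  shows "f t = f (real k * h) + (t / h - real k) * (f (real (Suc k) * h) - f (real k * h))"
proof -
  have m: "mesh T N = h" by (simp add: mesh_def h_def N)
  obtain \<alpha> \<beta> where ab: "\<And>t. t \<in> {real k * h..real (Suc k) * h} \<Longrightarrow> f t = \<alpha> + \<beta> * t"
    using f k unfolding time_space_def m N by blast
  have le: "real k * h \<le> real (Suc k) * h" using h_pos by (intro mult_right_mono) auto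
  have "f t = \<alpha> + \<beta> * t" "f (real k * h) = \<alpha> + \<beta> * (real k * h)"
    "f (real (Suc k) * h) = \<alpha> + \<beta> * (real (Suc k) * h)"
    using t le by (auto intro!: ab)
  then show ?thesis using h_pos by (simp add: field_simps)
qed

text \<open>Elements of the discrete spaces are determined by their values at the nodes.\<close>

lemma X_delta_interp:
  fixes S :: "'v::real_normed_vector set"
  assumes N: "n = 2 * N" and S: "subspace S" and w: "w \<in> X_delta T N S"
  shows "w 0 = 0"
    and "\<And>k t. k < n \<Longrightarrow> t \<in> {real k * h..real (Suc k) * h} \<Longrightarrow>
      w t = w (real k * h) + (t / h - real k) *\<^sub>R (w (real (Suc k) * h) - w (real k * h))"
proof -
  obtain m :: nat and f :: "nat \<Rightarrow> real \<Rightarrow> real" and \<eta> where f: "\<And>i. i < m \<Longrightarrow> f i \<in> time_space T N"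
    and w_eq: "w = (\<lambda>t. \<Sum>i<m. f i t *\<^sub>R \<eta> i)"
    using w unfolding X_delta_def tensor_space_def by blast
  show "w 0 = 0" unfolding w_eq using f by (intro sum.neutral) (auto simp: time_space_def)
  fix k t assume k: "k < n" and t: "t \<in> {real k * h..real (Suc k) * h}"
  have "w t = (\<Sum>i<m. (f i (real k * h) + (t / h - real k) * (f i (real (Suc k) * h) - f i (real k * h))) *\<^sub>R \<eta> i)"
    unfolding w_eq using time_space_interp[OF N f k t] by (intro sum.cong) auto
  also have "\<dots> = w (real k * h) + (t / h - real k) *\<^sub>R (w (real (Suc k) * h) - w (real k * h))"
    unfolding w_eq
    by (simp add: sum.distrib scaleR_left.add scaleR_right.sum sum_subtractf[symmetric] scaleR_left.diff[symmetric])
  finally show "w t = w (real k * h) + (t / h - real k) *\<^sub>R (w (real (Suc k) * h) - w (real k * h))" .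
qed

lemma X_delta_smooth:
  fixes S :: "'v::real_normed_vector set"
  assumes N: "n = 2 * N" and S: "subspace S" and w: "w \<in> X_delta T N S"
  shows "pw_smooth T w (\<lambda>t. (1 / h) *\<^sub>R (w (real (Suc (cell t)) * h) - w (real (cell t) * h)))"
proof -
  define \<Delta> where "\<Delta> k = w (real (Suc k) * h) - w (real k * h)" for k
  define p where "p k t = w (real k * h) + (t / h - real k) *\<^sub>R \<Delta> k" for k t
  have match: "p k (real (Suc k) * h) = p (Suc k) (real (Suc k) * h)" for k
  proof -
    have 1: "real (Suc k) * h / h - real k = 1" "real (Suc k) * h / h - real (Suc k) = 0"
      using h_pos by (auto simp: field_simps)
    show ?thesis unfolding p_def 1 by (simp add: \<Delta>_def)
  qed
  have "pw_smooth T (\<lambda>t. p (cell t) t) (\<lambda>t. (\<lambda>k t. (1 / h) *\<^sub>R \<Delta> k) (cell t) t)"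
  proof (rule pw_smooth_glue[OF match])
    fix k t
    have 1: "((\<lambda>t. t / h - real k) has_real_derivative 1 / h) (at t)"
      using h_pos by (auto intro!: derivative_eq_intros)
    have "(p k has_vector_derivative (0 + (1 / h) *\<^sub>R \<Delta> k)) (at t)"
      unfolding p_def[abs_def]
      by (intro has_vector_derivative_add has_vector_derivative_const
          bounded_linear.has_vector_derivative[OF bounded_linear_scaleR_left]
          1[unfolded has_real_derivative_iff_has_vector_derivative])
    then show "(p k has_vector_derivative (1 / h) *\<^sub>R \<Delta> k) (at t)" by simp
  qed (auto intro: continuous_intros)
  then have "pw_smooth T w (\<lambda>t. (\<lambda>k t. (1 / h) *\<^sub>R \<Delta> k) (cell t) t)"
  proof (rule pw_smooth_cong)
    fix t assume "t \<in> {0..T}"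
    then obtain k where k: "k < n" and t: "t \<in> {real k * h..real (Suc k) * h}"
      using cells_cover by blast
    have "p (cell t) t = p k t" by (rule glue_eq[OF match k t])
    also have "\<dots> = w t" using X_delta_interp(2)[OF assms k t] by (simp add: p_def \<Delta>_def)
    finally show "p (cell t) t = w t" .
  qed
  then show ?thesis by (simp add: \<Delta>_def)
qed

lemma X_delta_zero: "(\<lambda>t. 0) \<in> X_delta T N S"
  unfolding X_delta_def tensor_space_def by (auto intro!: exI[of _ "0::nat"])

end

lemma young_ineq: "c > 0 \<Longrightarrow> x * y \<le> c * y\<^sup>2 + x\<^sup>2 / (4 * c)" for x y c :: real
proof -
  assume c: "c > 0"
  have "0 \<le> (2 * c * y - x)\<^sup>2 / (4 * c)" using c by simp
  also have "\<dots> = c * y\<^sup>2 + x\<^sup>2 / (4 * c) - x * y" using c by (simp add: power2_eq_square field_simps)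
  finally show ?thesis by simp
qed

section \<open>The time-stepping scheme\<close>

text \<open>The squared \<open>L\<^sub>2\<close> norm of \<open>x + s y\<close> over the unit interval.\<close>

definition affine_mass :: "'v::real_inner \<Rightarrow> 'v \<Rightarrow> real" where
  "affine_mass x y = (norm x)\<^sup>2 + inner x y + (norm y)\<^sup>2 / 3"

lemma affine_mass_bounds:
  fixes x y :: "'v::real_inner"
  shows "(norm x)\<^sup>2 \<le> 4 * affine_mass x y" "(norm (x + y))\<^sup>2 \<le> 4 * affine_mass x y"
    "(norm x)\<^sup>2 + (norm y)\<^sup>2 \<le> 16 * affine_mass x y" "0 \<le> affine_mass x y"
proof -
  have n: "inner x x = (norm x)\<^sup>2" "inner y y = (norm y)\<^sup>2" by (simp_all add: power2_norm_eq_inner)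
  have "4 * affine_mass x y - (norm x)\<^sup>2 = 3 * (norm (x + (2/3) *\<^sub>R y))\<^sup>2"
    unfolding affine_mass_def power2_norm_eq_inner
    by (simp add: inner_add inner_commute[of y x] field_simps)
  moreover have "4 * affine_mass x y - (norm (x + y))\<^sup>2 = 3 * (norm (x + (1/3) *\<^sub>R y))\<^sup>2"
    unfolding affine_mass_def power2_norm_eq_inner
    by (simp add: inner_add inner_commute[of y x] field_simps)
  moreover have "16 * affine_mass x y - ((norm x)\<^sup>2 + (norm y)\<^sup>2)
      = 15 * (norm (x + (8/15) *\<^sub>R y))\<^sup>2 + (1/15) * (norm y)\<^sup>2"
    unfolding affine_mass_def power2_norm_eq_inner
    by (simp add: inner_add inner_commute[of y x] field_simps)
  moreover have "0 \<le> (norm (x + (2/3) *\<^sub>R y))\<^sup>2" "0 \<le> (norm (x + (1/3) *\<^sub>R y))\<^sup>2"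
    "0 \<le> 15 * (norm (x + (8/15) *\<^sub>R y))\<^sup>2 + (1/15) * (norm y)\<^sup>2" by simp_all
  ultimately show "(norm x)\<^sup>2 \<le> 4 * affine_mass x y" "(norm (x + y))\<^sup>2 \<le> 4 * affine_mass x y"
    "(norm x)\<^sup>2 + (norm y)\<^sup>2 \<le> 16 * affine_mass x y" by linarith+
  then show "0 \<le> affine_mass x y" by (meson dual_order.trans linorder_not_le mult_pos_neg zero_le_power2 zero_less_numeral)
qed

text \<open>A parabolic problem on a grid, with a profile \<open>r\<close> for smoothing jumps whose square has a
  majorant \<open>m\<^sub>2\<close> with primitive \<open>I\<^sub>2\<close>, and a vector \<open>\<eta>\<close>, the spatial direction of the sawtooth.
  The squared jumps sum up to at most 16 times the mass of the discontinuous solution; the bound on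
  \<open>I\<^sub>2\<close> allows the coercivity of the form to absorb their contribution.\<close>

locale dg_scheme = parabolic_problem T a M \<alpha> emb + uniform_grid T h n
  for T and a :: "real \<Rightarrow> 'v::{real_inner,complete_space,second_countable_topology} \<Rightarrow> 'v \<Rightarrow> real"
    and M \<alpha> and emb :: "'v \<Rightarrow>\<^sub>L 'h::{real_inner,complete_space,second_countable_topology}"
    and h n +
  fixes r r' P m\<^sub>2 I\<^sub>2 :: "real \<Rightarrow> real" and R :: real and \<eta> :: 'v
  assumes r_deriv: "\<And>s. (r has_real_derivative r' s) (at s)" and r'_cont: "continuous_on UNIV r'"
    and r_0: "r 0 = 1" and r_1: "r 1 = 0"
    and P_deriv: "\<And>s. (P has_real_derivative r s) (at s)" and P_0: "P 0 = 0" and P_1: "P 1 = 0"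
    and r_le: "\<And>s. s \<in> {0..1} \<Longrightarrow> \<bar>r s\<bar> \<le> 4" and r'_le: "\<And>s. s \<in> {0..1} \<Longrightarrow> \<bar>r' s\<bar> \<le> R"
    and I2_deriv: "\<And>s. (I\<^sub>2 has_real_derivative m\<^sub>2 s) (at s)" and m2_cont: "continuous_on UNIV m\<^sub>2"
    and r_sq_le: "\<And>s. s \<in> {0..1} \<Longrightarrow> (r s)\<^sup>2 \<le> m\<^sub>2 s"
    and I2_le: "I\<^sub>2 1 - I\<^sub>2 0 \<le> \<alpha>\<^sup>2 / (64 * M\<^sup>2)"
begin

lemma r_cont: "continuous_on X r"
  using r_deriv by (intro continuous_at_imp_continuous_on ballI) (rule DERIV_isCont)

lemma R_nonneg: "0 \<le> R" using r'_le[of 0] by (meson abs_ge_zero atLeastAtMost_iff order_refl order_trans zero_le_one)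

text \<open>Affine functions of the local coordinate, and the integral of the form over one cell.\<close>

definition aff :: "'v \<Rightarrow> 'v \<Rightarrow> real \<Rightarrow> 'v" where "aff x y t = x + loc t *\<^sub>R y"

definition cform :: "nat \<Rightarrow> (real \<Rightarrow> 'v) \<Rightarrow> (real \<Rightarrow> 'v) \<Rightarrow> real" where
  "cform k w p = (LINT t|\<mu>. cind k t * a t (w t) (p t))"

text \<open>The sawtooth in direction \<open>\<eta>\<close>: it rises on the cells with even number and falls on the
  others, with slope \<open>alt k\<close> on cell \<open>k\<close>.\<close>

definition alt :: "nat \<Rightarrow> real" where "alt k = (if even k then 1 else -1)"

definition saw_fun :: "real \<Rightarrow> real" where
  "saw_fun t = (if even (cell t) then loc t else 1 - loc t) * h"

definition saw :: "real \<Rightarrow> 'v" where "saw t = saw_fun t *\<^sub>R \<eta>"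

text \<open>The contribution of cell \<open>k\<close> to a functional that agrees on the discrete space with the
  parabolic operator applied to the sawtooth. It is small on discontinuous functions as well, because
  the time derivative of the sawtooth is replaced by an end point term on the last cell.\<close>

definition source :: "nat \<Rightarrow> 'v \<Rightarrow> 'v \<Rightarrow> real" where
  "source k \<xi> \<zeta> = cform k saw (aff \<xi> \<zeta>) - (if Suc k = n then h / 2 * ip \<eta> (\<xi> + \<zeta>) else 0)"

text \<open>An affine function whose jump \<open>j\<close> at the left end of the cell is smoothed.\<close>

definition trial :: "'v \<Rightarrow> 'v \<Rightarrow> 'v \<Rightarrow> real \<Rightarrow> 'v" where
  "trial x y j t = aff x y t - r (loc t) *\<^sub>R j"

lemma cellwise_L2:
  fixes f :: "nat \<Rightarrow> real \<Rightarrow> 'b::real_normed_vector"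
  assumes f: "\<And>k. continuous_on UNIV (f k)"
  shows "(\<lambda>t. f (cell t) (loc t)) \<in> L2_space T"
proof -
  have "\<forall>k. \<exists>K. \<forall>s\<in>{0..1}. norm (f k s) \<le> K"
  proof
    fix k
    have "bounded (f k ` {0..1})"
      by (intro compact_imp_bounded compact_continuous_image continuous_on_subset[OF f]) auto
    then show "\<exists>K. \<forall>s\<in>{0..1}. norm (f k s) \<le> K" unfolding bounded_iff by auto
  qed
  then obtain K where K: "\<And>k s. s \<in> {0..1} \<Longrightarrow> norm (f k s) \<le> K k" by metis
  have "norm (f (cell t) (loc t)) \<le> (\<Sum>k<n. \<bar>K k\<bar>)" if "t \<in> {0<..<T}" for t
  proof -
    have "norm (f (cell t) (loc t)) \<le> \<bar>K (cell t)\<bar>" using K[OF loc_unit[OF that], of "cell t"] by linarith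
    also have "\<dots> \<le> (\<Sum>k<n. \<bar>K k\<bar>)" using cell_less[of t] that by (intro member_le_sum) auto
    finally show ?thesis .
  qed
  moreover have "(\<lambda>t. f (cell t) (loc t)) \<in> borel_measurable \<mu>"
    unfolding loc_def
  proof (rule cellwise_measurable[of "\<lambda>k t. f k (t / h - real k)"])
    fix k
    have "continuous_on {0<..<T} (\<lambda>t. f k (t / h - real k))"
      using h_pos by (intro continuous_on_compose2[OF f] continuous_intros) auto
    then show "(\<lambda>t. f k (t / h - real k)) \<in> borel_measurable \<mu>"
      by (rule continuous_on_imp_measurable_lebesgue_on)
  qed
  ultimately show ?thesis by (intro L2_space_bounded)
qed

lemma disc_L2: "(\<lambda>t. aff (\<xi> (cell t)) (\<zeta> (cell t)) t) \<in> L2_space T"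
  unfolding aff_def by (rule cellwise_L2[of "\<lambda>k s. \<xi> k + s *\<^sub>R \<zeta> k"]) (intro continuous_intros)

lemma aff_L2: "aff x y \<in> L2_space T"
  unfolding aff_def[abs_def] by (rule cellwise_L2[of "\<lambda>k s. x + s *\<^sub>R y"]) (intro continuous_intros)

lemma trial_L2: "trial x y j \<in> L2_space T"
  unfolding trial_def[abs_def] aff_def
  by (rule cellwise_L2[of "\<lambda>k s. x + s *\<^sub>R y - r s *\<^sub>R j"]) (intro continuous_intros r_cont)

lemma profile_L2: "(\<lambda>t. r (loc t) *\<^sub>R x) \<in> L2_space T"
  by (rule cellwise_L2[of "\<lambda>k s. r s *\<^sub>R x"]) (intro continuous_intros r_cont)

lemma saw_L2: "saw \<in> L2_space T"
proof -
  have "(\<lambda>t. (\<lambda>k s. ((if even k then s else 1 - s) * h) *\<^sub>R \<eta>) (cell t) (loc t)) \<in> L2_space T"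
  proof (rule cellwise_L2)
    fix k :: nat
    show "continuous_on UNIV (\<lambda>s. ((if even k then s else 1 - s) * h) *\<^sub>R \<eta>)"
      by (cases "even k") (auto intro!: continuous_intros)
  qed
  then show ?thesis by (simp add: saw_def[abs_def] saw_fun_def)
qed

lemma aff_norm: "t \<in> {0<..<T} \<Longrightarrow> norm (aff x y t) \<le> norm x + norm y"
proof -
  assume t: "t \<in> {0<..<T}"
  have "norm (aff x y t) \<le> norm x + \<bar>loc t\<bar> * norm y"
    unfolding aff_def by (rule order_trans[OF norm_triangle_ineq]) simp
  also have "\<bar>loc t\<bar> * norm y \<le> 1 * norm y" using loc_unit[OF t] by (intro mult_right_mono) auto
  finally show ?thesis by simp
qed

lemma profile_norm: "t \<in> {0<..<T} \<Longrightarrow> norm (r (loc t) *\<^sub>R j) \<le> 4 * norm j"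
  using r_le[OF loc_unit[of t]] by (simp add: mult_right_mono)

lemma trial_norm: "t \<in> {0<..<T} \<Longrightarrow> norm (trial x y j t) \<le> norm x + norm y + 4 * norm j"
  unfolding trial_def using aff_norm[of t x y] profile_norm[of t j]
  by (meson add_mono norm_triangle_ineq4 order_trans)

lemma saw_norm: "t \<in> {0<..<T} \<Longrightarrow> norm (saw t) \<le> h * norm \<eta>"
proof -
  assume t: "t \<in> {0<..<T}"
  have "\<bar>saw_fun t\<bar> \<le> 1 * h"
    unfolding saw_fun_def abs_mult using loc_unit[OF t] h_pos by (intro mult_mono) auto
  then show ?thesis by (simp add: saw_def mult_right_mono)
qed

lemma cform_integrable:
  assumes "w \<in> L2_space T" "p \<in> L2_space T"
  shows "integrable \<mu> (\<lambda>t. cind k t * a t (w t) (p t))"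
  by (rule cind_integrable[OF form_integrable[OF assms]])

lemma cform_add_left:
  assumes "w \<in> L2_space T" "w' \<in> L2_space T" "p \<in> L2_space T"
  shows "cform k (\<lambda>t. w t + w' t) p = cform k w p + cform k w' p"
proof -
  have "cform k (\<lambda>t. w t + w' t) p = (LINT t|\<mu>. cind k t * a t (w t) (p t) + cind k t * a t (w' t) (p t))"
    unfolding cform_def using form_bilinear
    by (intro integral_lebesgue_on_cong_AE) (auto elim!: eventually_mono simp: bilinear_ladd algebra_simps)
  then show ?thesis using cform_integrable assms by (simp add: cform_def)
qed

lemma cform_add_right:
  assumes "w \<in> L2_space T" "p \<in> L2_space T" "p' \<in> L2_space T"
  shows "cform k w (\<lambda>t. p t + p' t) = cform k w p + cform k w p'"
proof -
  have "cform k w (\<lambda>t. p t + p' t) = (LINT t|\<mu>. cind k t * a t (w t) (p t) + cind k t * a t (w t) (p' t))"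
    unfolding cform_def using form_bilinear
    by (intro integral_lebesgue_on_cong_AE) (auto elim!: eventually_mono simp: bilinear_radd algebra_simps)
  then show ?thesis using cform_integrable assms by (simp add: cform_def)
qed

lemma cform_scale_left: "cform k (\<lambda>t. c *\<^sub>R w t) p = c * cform k w p"
proof -
  have "cform k (\<lambda>t. c *\<^sub>R w t) p = (LINT t|\<mu>. c * (cind k t * a t (w t) (p t)))"
    unfolding cform_def using form_bilinear
    by (intro integral_lebesgue_on_cong_AE) (auto elim!: eventually_mono simp: bilinear_lmul)
  then show ?thesis by (simp add: cform_def)
qed

lemma cform_scale_right: "cform k w (\<lambda>t. c *\<^sub>R p t) = c * cform k w p"
proof -
  have "cform k w (\<lambda>t. c *\<^sub>R p t) = (LINT t|\<mu>. c * (cind k t * a t (w t) (p t)))"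
    unfolding cform_def using form_bilinear
    by (intro integral_lebesgue_on_cong_AE) (auto elim!: eventually_mono simp: bilinear_rmul)
  then show ?thesis by (simp add: cform_def)
qed

lemma cform_bound:
  assumes k: "k < n" and w: "w \<in> L2_space T" "\<And>t. t \<in> {0<..<T} \<Longrightarrow> norm (w t) \<le> W"
    and p: "p \<in> L2_space T" "\<And>t. t \<in> {0<..<T} \<Longrightarrow> norm (p t) \<le> B"
  shows "\<bar>cform k w p\<bar> \<le> M * W * B * h"
proof -
  have "\<bar>cform k w p\<bar> \<le> (LINT t|\<mu>. \<bar>cind k t * a t (w t) (p t)\<bar>)"
    unfolding cform_def using integral_norm_bound[of \<mu> "\<lambda>t. cind k t * a t (w t) (p t)"] by simp
  also have "\<dots> \<le> (LINT t|\<mu>. cind k t * (M * W * B))"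
  proof (rule integral_mono_AE)
    show "integrable \<mu> (\<lambda>t. \<bar>cind k t * a t (w t) (p t)\<bar>)" using cform_integrable[OF w(1) p(1)] by simp
    show "integrable \<mu> (\<lambda>t. cind k t * (M * W * B))" by (rule cind_integrable) simp
    show "AE t in \<mu>. \<bar>cind k t * a t (w t) (p t)\<bar> \<le> cind k t * (M * W * B)"
      using form_bounded AE_space
    proof eventually_elim
      case (elim t)
      then have t: "t \<in> {0<..<T}" by simp
      have "\<bar>a t (w t) (p t)\<bar> \<le> M * norm (w t) * norm (p t)" using elim by blast
      also have "\<dots> \<le> M * W * B"
        using w(2)[OF t] p(2)[OF t] M_pos order_trans[OF norm_ge_zero w(2)[OF t]]
        by (intro mult_mono mult_left_mono) auto
      finally show ?case by (simp add: abs_mult mult_left_mono)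
    qed
  qed
  also have "\<dots> = M * W * B * h" using cind_integral[OF k] by simp
  finally show ?thesis .
qed

lemma aff_mass_integral:
  assumes "k < n"
  shows "integrable \<mu> (\<lambda>t. cind k t * (norm (aff x y t))\<^sup>2)"
    "(LINT t|\<mu>. cind k t * (norm (aff x y t))\<^sup>2) = h * affine_mass x y"
proof -
  define \<Gamma> where "\<Gamma> s = (norm x)\<^sup>2 * s + inner x y * s\<^sup>2 + (norm y)\<^sup>2 * s ^ 3 / 3" for s
  define G where "G s = (norm x)\<^sup>2 + 2 * inner x y * s + (norm y)\<^sup>2 * s\<^sup>2" for s
  have d: "(\<Gamma> has_real_derivative G s) (at s)" for s
    unfolding \<Gamma>_def[abs_def] G_def by (auto intro!: derivative_eq_intros)
  have c: "continuous_on UNIV G" unfolding G_def[abs_def] by (intro continuous_intros)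
  have eq: "(norm (aff x y t))\<^sup>2 = G (loc t)" for t
    unfolding aff_def G_def power2_norm_eq_inner
    by (simp add: inner_add inner_commute[of y x] power2_eq_square algebra_simps)
  show "integrable \<mu> (\<lambda>t. cind k t * (norm (aff x y t))\<^sup>2)"
    "(LINT t|\<mu>. cind k t * (norm (aff x y t))\<^sup>2) = h * affine_mass x y"
    unfolding eq using cell_integral[OF assms d c]
    by (simp_all add: \<Gamma>_def affine_mass_def)
qed

text \<open>The smoothing perturbs the form only slightly, because the profile is small in \<open>L\<^sub>2\<close>.\<close>

lemma local_energy:
  assumes k: "k < n"
  shows "3 * \<alpha> / 4 * (h * affine_mass x y) - \<alpha> / 64 * (h * (norm j)\<^sup>2) \<le> cform k (trial x y j) (aff x y)"
proof -
  let ?c = "M\<^sup>2 / \<alpha> * (norm j)\<^sup>2"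
  note ci = cell_integral[OF k I2_deriv m2_cont]
  have "(LINT t|\<mu>. 3 * \<alpha> / 4 * (cind k t * (norm (aff x y t))\<^sup>2) - ?c * (cind k t * m\<^sub>2 (loc t)))
      \<le> cform k (trial x y j) (aff x y)"
    unfolding cform_def
  proof (rule integral_mono_AE)
    show "integrable \<mu> (\<lambda>t. 3 * \<alpha> / 4 * (cind k t * (norm (aff x y t))\<^sup>2) - ?c * (cind k t * m\<^sub>2 (loc t)))"
      using aff_mass_integral(1)[OF k] ci(1) by simp
    show "integrable \<mu> (\<lambda>t. cind k t * a t (trial x y j t) (aff x y t))"
      by (intro cform_integrable trial_L2 aff_L2)
    show "AE t in \<mu>. 3 * \<alpha> / 4 * (cind k t * (norm (aff x y t))\<^sup>2) - ?c * (cind k t * m\<^sub>2 (loc t))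
        \<le> cind k t * a t (trial x y j t) (aff x y t)"
      using form_bounded form_coercive form_bilinear AE_space
    proof eventually_elim
      case (elim t)
      then have t: "loc t \<in> {0..1}" by (intro loc_unit) simp
      let ?q = "aff x y t" and ?\<rho> = "r (loc t)"
      have "a t (trial x y j t) ?q = a t ?q ?q - ?\<rho> * a t j ?q"
        unfolding trial_def using elim by (simp add: bilinear_lsub bilinear_lmul)
      moreover have "\<alpha> * (norm ?q)\<^sup>2 \<le> a t ?q ?q" using elim by blast
      moreover have "?\<rho> * a t j ?q \<le> \<alpha> / 4 * (norm ?q)\<^sup>2 + ?c * m\<^sub>2 (loc t)"
      proof -
        have "?\<rho> * a t j ?q \<le> \<bar>?\<rho>\<bar> * (M * norm j * norm ?q)"
        proof -
          have "\<bar>a t j ?q\<bar> \<le> M * norm j * norm ?q" using elim by blast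
          from mult_left_mono[OF this abs_ge_zero[of ?\<rho>]] show ?thesis
            using abs_ge_self[of "?\<rho> * a t j ?q"] unfolding abs_mult by linarith
        qed
        also have "\<dots> = (\<bar>?\<rho>\<bar> * M * norm j) * norm ?q" by simp
        also have "\<dots> \<le> \<alpha> / 4 * (norm ?q)\<^sup>2 + (\<bar>?\<rho>\<bar> * M * norm j)\<^sup>2 / (4 * (\<alpha> / 4))"
          using alpha_pos by (intro young_ineq) simp
        also have "(\<bar>?\<rho>\<bar> * M * norm j)\<^sup>2 / (4 * (\<alpha> / 4)) = ?c * ?\<rho>\<^sup>2"
          by (simp add: power_mult_distrib)
        also have "?c * ?\<rho>\<^sup>2 \<le> ?c * m\<^sub>2 (loc t)"
          using r_sq_le[OF t] alpha_pos by (intro mult_left_mono) auto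
        finally show ?thesis by simp
      qed
      ultimately have "3 * \<alpha> / 4 * (norm ?q)\<^sup>2 - ?c * m\<^sub>2 (loc t) \<le> a t (trial x y j t) ?q" by simp
      then have "cind k t * (3 * \<alpha> / 4 * (norm ?q)\<^sup>2 - ?c * m\<^sub>2 (loc t)) \<le> cind k t * a t (trial x y j t) ?q"
        by (rule mult_left_mono) simp
      then show ?case by (simp add: algebra_simps)
    qed
  qed
  moreover have "(LINT t|\<mu>. 3 * \<alpha> / 4 * (cind k t * (norm (aff x y t))\<^sup>2) - ?c * (cind k t * m\<^sub>2 (loc t)))
      = 3 * \<alpha> / 4 * (h * affine_mass x y) - ?c * (h * (I\<^sub>2 1 - I\<^sub>2 0))"
    using aff_mass_integral[OF k, of x y] ci by simp
  moreover have "?c * (h * (I\<^sub>2 1 - I\<^sub>2 0)) \<le> ?c * (h * (\<alpha>\<^sup>2 / (64 * M\<^sup>2)))"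
    using I2_le alpha_pos h_pos by (intro mult_left_mono) auto
  moreover have "?c * (h * (\<alpha>\<^sup>2 / (64 * M\<^sup>2))) = \<alpha> / 64 * (h * (norm j)\<^sup>2)"
    using alpha_pos M_pos by (simp add: field_simps power2_eq_square)
  ultimately show ?thesis by linarith
qed

lemma saw_energy:
  assumes k: "k < n"
  shows "cform k saw (aff x y) \<le> \<alpha> / 8 * (h * affine_mass x y) + 2 * M\<^sup>2 / \<alpha> * (h * norm \<eta>)\<^sup>2 * h"
proof -
  let ?c = "2 * M\<^sup>2 / \<alpha> * (h * norm \<eta>)\<^sup>2"
  have i1: "integrable \<mu> (\<lambda>t. cind k t * 1)" by (rule cind_integrable) simp
  have "cform k saw (aff x y) \<le> (LINT t|\<mu>. \<alpha> / 8 * (cind k t * (norm (aff x y t))\<^sup>2) + ?c * (cind k t * 1))"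
    unfolding cform_def
  proof (rule integral_mono_AE)
    show "integrable \<mu> (\<lambda>t. \<alpha> / 8 * (cind k t * (norm (aff x y t))\<^sup>2) + ?c * (cind k t * 1))"
      by (intro Bochner_Integration.integrable_add integrable_mult_right aff_mass_integral(1)[OF k] i1)
    show "integrable \<mu> (\<lambda>t. cind k t * a t (saw t) (aff x y t))"
      by (intro cform_integrable saw_L2 aff_L2)
    show "AE t in \<mu>. cind k t * a t (saw t) (aff x y t) \<le> \<alpha> / 8 * (cind k t * (norm (aff x y t))\<^sup>2) + ?c * (cind k t * 1)"
      using form_bounded AE_space
    proof eventually_elim
      case (elim t)
      then have t: "t \<in> {0<..<T}" by simp
      let ?q = "aff x y t"
      have "a t (saw t) ?q \<le> M * norm (saw t) * norm ?q" using elim by (meson abs_le_D1)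
      also have "\<dots> \<le> (M * (h * norm \<eta>)) * norm ?q"
        using saw_norm[OF t] M_pos by (intro mult_right_mono mult_left_mono) auto
      also have "\<dots> \<le> \<alpha> / 8 * (norm ?q)\<^sup>2 + (M * (h * norm \<eta>))\<^sup>2 / (4 * (\<alpha> / 8))"
        using alpha_pos by (intro young_ineq) simp
      also have "(M * (h * norm \<eta>))\<^sup>2 / (4 * (\<alpha> / 8)) = ?c" by (simp add: power_mult_distrib)
      finally have "cind k t * a t (saw t) ?q \<le> cind k t * (\<alpha> / 8 * (norm ?q)\<^sup>2 + ?c)"
        by (rule mult_left_mono) simp
      then show ?case by (simp add: algebra_simps)
    qed
  qed
  also have "\<dots> = \<alpha> / 8 * (h * affine_mass x y) + ?c * h"
    using aff_mass_integral[OF k, of x y] i1 cind_integral[OF k] by simp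
  finally show ?thesis .
qed

lemma aff_add: "aff (x + x') (y + y') t = aff x y t + aff x' y' t"
  and aff_scale: "aff (c *\<^sub>R x) (c *\<^sub>R y) t = c *\<^sub>R aff x y t"
  by (auto simp: aff_def algebra_simps)

lemma trial_add: "trial (x + x') (y + y') (j + j') t = trial x y j t + trial x' y' j' t"
  and trial_scale: "trial (c *\<^sub>R x) (c *\<^sub>R y) (c *\<^sub>R j) t = c *\<^sub>R trial x y j t"
  by (auto simp: trial_def aff_def algebra_simps)

text \<open>One step of the discontinuous Galerkin method with smoothed jumps: \<open>e\<close> is the incoming value,
  and \<open>x\<close> and \<open>y\<close> are the initial value and the increment on the cell. The factor 1/2 is the mean of
  the local coordinate.\<close>

definition step_eq :: "nat \<Rightarrow> 'v \<Rightarrow> 'v \<Rightarrow> 'v \<Rightarrow> bool" where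
  "step_eq k e x y \<longleftrightarrow> (\<forall>\<xi> \<zeta>. ip y \<xi> + ip y \<zeta> / 2 + ip (x - e) \<xi> + cform k (trial x y (x - e)) (aff \<xi> \<zeta>) = source k \<xi> \<zeta>)"

lemma step_exists:
  assumes k: "k < n"
  shows "\<exists>x y. step_eq k e x y"
proof -
  define c\<^sub>1 where "c\<^sub>1 = (norm emb)\<^sup>2"
  define L where "L q = aff (fst q) (snd q)" for q :: "'v \<times> 'v"
  define U where "U p = trial (fst p) (snd p) (fst p)" for p :: "'v \<times> 'v"
  define b where "b p q = ip (snd p) (fst q) + ip (snd p) (snd q) / 2 + ip (fst p) (fst q) + cform k (U p) (L q)"
    for p q :: "'v \<times> 'v"
  define f where "f q = source k (fst q) (snd q) + ip e (fst q) - cform k (\<lambda>t. r (loc t) *\<^sub>R e) (L q)" for q :: "'v \<times> 'v"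
  have LU: "L q \<in> L2_space T" "U q \<in> L2_space T" for q by (auto simp: L_def U_def aff_L2 trial_L2)
  have Ladd: "L (q + q') = (\<lambda>t. L q t + L q' t)" and Lsc: "L (c *\<^sub>R q) = (\<lambda>t. c *\<^sub>R L q t)" for q q' c
    by (auto simp: L_def aff_add aff_scale)
  have Uadd: "U (q + q') = (\<lambda>t. U q t + U q' t)" and Usc: "U (c *\<^sub>R q) = (\<lambda>t. c *\<^sub>R U q t)" for q q' c
    by (auto simp: U_def trial_add trial_scale)
  have nf: "norm (fst q) \<le> norm q" "norm (snd q) \<le> norm q" for q :: "'v \<times> 'v"
    using norm_fst_le[of "fst q" "snd q"] norm_snd_le[of "snd q" "fst q"] by simp_all
  have Ln: "norm (L q t) \<le> 2 * norm q" if "t \<in> {0<..<T}" for q t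
    using aff_norm[OF that, of "fst q" "snd q"] nf[of q] unfolding L_def by linarith
  have Un: "norm (U q t) \<le> 6 * norm q" if "t \<in> {0<..<T}" for q t
    using trial_norm[OF that, of "fst q" "snd q" "fst q"] nf[of q] unfolding U_def by linarith
  have ipn: "\<bar>ip x y\<bar> \<le> c\<^sub>1 * A * B" if "norm x \<le> A" "norm y \<le> B" for x y A B
  proof -
    have "c\<^sub>1 * norm x * norm y \<le> c\<^sub>1 * A * B"
      using that order_trans[OF norm_ge_zero that(1)] by (intro mult_mono mult_left_mono) (auto simp: c\<^sub>1_def)
    then show ?thesis using ip_le[of x y] by (simp add: c\<^sub>1_def)
  qed
  have "bounded_bilinear b"
  proof
    show "b (p + p') q = b p q + b p' q" for p p' q
      unfolding b_def Uadd cform_add_left[OF LU(2) LU(2) LU(1)]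
      by (simp add: ip.add_left add_divide_distrib)
    show "b p (q + q') = b p q + b p q'" for p q q'
      unfolding b_def Ladd cform_add_right[OF LU(2) LU(1) LU(1)]
      by (simp add: ip.add_right add_divide_distrib)
    show "b (c *\<^sub>R p) q = c *\<^sub>R b p q" for c p q
      unfolding b_def Usc cform_scale_left by (simp add: ip.scaleR_left algebra_simps)
    show "b p (c *\<^sub>R q) = c *\<^sub>R b p q" for c p q
      unfolding b_def Lsc cform_scale_right by (simp add: ip.scaleR_right algebra_simps)
    show "\<exists>K. \<forall>p q. norm (b p q) \<le> norm p * norm q * K"
    proof (intro exI allI)
      fix p q :: "'v \<times> 'v"
      have 1: "\<bar>ip (snd p) (fst q)\<bar> \<le> c\<^sub>1 * norm p * norm q" "\<bar>ip (snd p) (snd q)\<bar> \<le> c\<^sub>1 * norm p * norm q"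
        "\<bar>ip (fst p) (fst q)\<bar> \<le> c\<^sub>1 * norm p * norm q"
        by (intro ipn nf)+
      have 2: "\<bar>cform k (U p) (L q)\<bar> \<le> M * (6 * norm p) * (2 * norm q) * h"
        by (intro cform_bound[OF k] LU Un Ln)
      have "\<bar>b p q\<bar> \<le> 3 * (c\<^sub>1 * norm p * norm q) + M * (6 * norm p) * (2 * norm q) * h"
        unfolding b_def using 1 2 by linarith
      then show "norm (b p q) \<le> norm p * norm q * (3 * c\<^sub>1 + 12 * M * h)"
        by (simp add: algebra_simps)
    qed
  qed
  moreover have "bounded_linear f"
  proof (rule bounded_linear_intro)
    show "f (q + q') = f q + f q'" for q q'
      unfolding f_def source_def L_def[symmetric] Ladd
        cform_add_right[OF saw_L2 LU(1) LU(1)] cform_add_right[OF profile_L2 LU(1) LU(1)]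
      by (simp add: ip.add_right distrib_left)
    show "f (c *\<^sub>R q) = c *\<^sub>R f q" for c q
      unfolding f_def source_def L_def[symmetric] Lsc cform_scale_right
      by (simp add: ip.scaleR_right ip.add_right algebra_simps)
    fix q :: "'v \<times> 'v"
    have 1: "\<bar>cform k saw (L q)\<bar> \<le> M * (h * norm \<eta>) * (2 * norm q) * h"
      by (intro cform_bound[OF k] LU saw_L2 saw_norm Ln)
    have 2: "\<bar>cform k (\<lambda>t. r (loc t) *\<^sub>R e) (L q)\<bar> \<le> M * (4 * norm e) * (2 * norm q) * h"
      by (intro cform_bound[OF k] LU profile_L2 profile_norm Ln)
    have 3: "\<bar>ip \<eta> (fst q)\<bar> \<le> c\<^sub>1 * norm \<eta> * norm q" "\<bar>ip \<eta> (snd q)\<bar> \<le> c\<^sub>1 * norm \<eta> * norm q"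
      "\<bar>ip e (fst q)\<bar> \<le> c\<^sub>1 * norm e * norm q"
      by (intro ipn nf order_refl)+
    have "\<bar>h / 2 * ip \<eta> (fst q + snd q)\<bar> \<le> h / 2 * (2 * (c\<^sub>1 * norm \<eta> * norm q))"
      using 3(1,2) h_pos unfolding abs_mult ip.add_right by (intro mult_mono) auto
    moreover have "0 \<le> h / 2 * (2 * (c\<^sub>1 * norm \<eta> * norm q))" using h_pos by (simp add: c\<^sub>1_def)
    ultimately have 4: "\<bar>if Suc k = n then h / 2 * ip \<eta> (fst q + snd q) else 0\<bar> \<le> h / 2 * (2 * (c\<^sub>1 * norm \<eta> * norm q))"
      by simp
    have "\<bar>f q\<bar> \<le> M * (h * norm \<eta>) * (2 * norm q) * h + h / 2 * (2 * (c\<^sub>1 * norm \<eta> * norm q))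
        + c\<^sub>1 * norm e * norm q + M * (4 * norm e) * (2 * norm q) * h"
      unfolding f_def source_def L_def[symmetric] using 1 2 3(3) 4 by linarith
    then show "norm (f q) \<le> norm q * (2 * M * h * norm \<eta> * h + h * c\<^sub>1 * norm \<eta> + c\<^sub>1 * norm e + 8 * M * norm e * h)"
      by (simp add: algebra_simps)
  qed
  moreover have "0 < \<alpha> * h / 32" using alpha_pos h_pos by simp
  moreover have "\<alpha> * h / 32 * (norm p)\<^sup>2 \<le> b p p" for p
  proof -
    obtain x y where p: "p = (x, y)" by force
    \<comment> \<open>for zero incoming value the jump is \<open>x\<close> itself\<close>
    have "3 * \<alpha> / 4 * (h * affine_mass x y) - \<alpha> / 64 * (h * (norm x)\<^sup>2) \<le> cform k (U p) (L p)"
      using local_energy[OF k, of x y x] by (simp add: U_def L_def p)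
    moreover have "ip y x + ip y y / 2 + ip x x = ip (x + y) (x + y) / 2 + ip x x / 2"
      by (simp add: ip.add_left ip.add_right ip_sym[of y x] add_divide_distrib)
    then have "0 \<le> ip y x + ip y y / 2 + ip x x" using ip_nonneg[of "x + y"] ip_nonneg[of x] by linarith
    moreover have "\<alpha> / 64 * (h * (norm x)\<^sup>2) \<le> \<alpha> / 64 * (h * (4 * affine_mass x y))"
      using affine_mass_bounds(1)[of x y] alpha_pos h_pos by (intro mult_left_mono) auto
    moreover have "\<alpha> * h / 32 * ((norm x)\<^sup>2 + (norm y)\<^sup>2) \<le> \<alpha> * h / 32 * (16 * affine_mass x y)"
      using affine_mass_bounds(3)[of x y] alpha_pos h_pos by (intro mult_left_mono) auto
    moreover have "0 \<le> \<alpha> * h * affine_mass x y" using affine_mass_bounds(4)[of x y] alpha_pos h_pos by simp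
    moreover have "(norm p)\<^sup>2 = (norm x)\<^sup>2 + (norm y)\<^sup>2" by (simp add: p norm_Pair)
    ultimately show ?thesis unfolding b_def by (simp add: p)
  qed
  ultimately obtain p where p: "\<And>q. b p q = f q" using lax_milgram[of b f "\<alpha> * h / 32"] by blast
  have "step_eq k e (fst p) (snd p)"
    unfolding step_eq_def
  proof (intro allI)
    fix \<xi> \<zeta>
    have "trial (fst p) (snd p) (fst p - e) = (\<lambda>t. U p t + r (loc t) *\<^sub>R e)"
      by (auto simp: U_def trial_def algebra_simps)
    then have "cform k (trial (fst p) (snd p) (fst p - e)) (aff \<xi> \<zeta>)
        = cform k (U p) (L (\<xi>, \<zeta>)) + cform k (\<lambda>t. r (loc t) *\<^sub>R e) (L (\<xi>, \<zeta>))"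
      using cform_add_left[OF LU(2)[of p] profile_L2[of e] LU(1)[of "(\<xi>, \<zeta>)"], of k] by (simp add: L_def)
    then show "ip (snd p) \<xi> + ip (snd p) \<zeta> / 2 + ip (fst p - e) \<xi> + cform k (trial (fst p) (snd p) (fst p - e)) (aff \<xi> \<zeta>) = source k \<xi> \<zeta>"
      using p[of "(\<xi>, \<zeta>)"] by (simp add: b_def f_def ip.diff_left)
  qed
  then show ?thesis by blast
qed

lemma scheme_exists:
  "\<exists>x y E. E 0 = 0 \<and> (\<forall>k<n. E (Suc k) = x k + y k \<and> step_eq k (E k) (x k) (y k))"
proof -
  have "\<forall>k e. \<exists>p. k < n \<longrightarrow> step_eq k e (fst p) (snd p)" using step_exists by fastforce
  then obtain p where p: "\<And>k e. k < n \<Longrightarrow> step_eq k e (fst (p k e)) (snd (p k e))" by metis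
  define E where "E = rec_nat (0::'v) (\<lambda>k e. fst (p k e) + snd (p k e))"
  show ?thesis
    by (rule exI[of _ "\<lambda>k. fst (p k (E k))"], rule exI[of _ "\<lambda>k. snd (p k (E k))"], rule exI[of _ E])
       (simp add: E_def p)
qed

section \<open>The sawtooth\<close>

text \<open>The affine pieces of the sawtooth.\<close>

definition tooth :: "nat \<Rightarrow> real \<Rightarrow> real" where
  "tooth k t = (if even k then t / h - real k else 1 - (t / h - real k)) * h"

lemma saw_fun_tooth: "saw_fun t = tooth (cell t) t"
  unfolding tooth_def saw_fun_def loc_def ..

lemma tooth_match: "tooth k (real (Suc k) * h) = tooth (Suc k) (real (Suc k) * h)"
  using h_pos by (simp add: tooth_def field_simps)

lemma saw_fun_smooth: "pw_smooth T saw_fun (\<lambda>t. alt (cell t))"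
  unfolding saw_fun_tooth[abs_def]
proof (rule pw_smooth_glue[OF tooth_match])
  show "(tooth k has_vector_derivative alt k) (at t)" for k t
    unfolding has_real_derivative_iff_has_vector_derivative[symmetric] tooth_def[abs_def] alt_def
    using h_pos by (cases "even k") (auto intro!: derivative_eq_intros)
qed simp

lemma saw_smooth: "pw_smooth T saw (\<lambda>t. alt (cell t) *\<^sub>R \<eta>)"
  unfolding saw_def[abs_def]
  by (rule pw_smooth_linear[OF saw_fun_smooth bounded_linear_scaleR_left])

lemma saw_0: "saw 0 = 0" by (simp add: saw_def saw_fun_def cell_0 loc_0)

lemma saw_in_X_delta:
  assumes N: "n = 2 * N" and \<eta>: "\<eta> \<in> S"
  shows "saw \<in> X_delta T N S"
proof -
  have m: "mesh T N = h" by (simp add: mesh_def h_def N)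
  have "\<exists>\<alpha> \<beta>. \<forall>t\<in>{real k * h..real (Suc k) * h}. saw_fun t = \<alpha> + \<beta> * t" if k: "k < n" for k
  proof (intro exI ballI)
    fix t assume t: "t \<in> {real k * h..real (Suc k) * h}"
    have "saw_fun t = tooth k t" unfolding saw_fun_tooth by (rule glue_eq[OF tooth_match k t])
    also have "\<dots> = (if even k then - real k * h else (1 + real k) * h) + alt k * t"
      using h_pos by (simp add: tooth_def alt_def field_simps)
    finally show "saw_fun t = (if even k then - real k * h else (1 + real k) * h) + alt k * t" .
  qed
  moreover have "continuous_on {0..T} saw_fun" using saw_fun_smooth by (simp add: pw_smooth_def)
  moreover have "saw_fun 0 = 0" by (simp add: saw_fun_def cell_0 loc_0)
  ultimately have "saw_fun \<in> time_space T N" unfolding time_space_def m using N by auto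
  then show ?thesis
    unfolding X_delta_def tensor_space_def saw_def[abs_def] using \<eta>
    by (intro CollectI exI[of _ "1::nat"] exI[of _ "\<lambda>_. saw_fun"] exI[of _ "\<lambda>_. \<eta>"]) simp
qed

lemma op_B_saw:
  "op_B T emb a saw (\<lambda>t. aff (\<xi> (cell t)) (\<zeta> (cell t)) t) =
    (\<Sum>k<n. alt k * h * (ip \<eta> (\<xi> k) + ip \<eta> (\<zeta> k) / 2) + cform k saw (aff (\<xi> k) (\<zeta> k)))"
proof -
  let ?v = "\<lambda>t. aff (\<xi> (cell t)) (\<zeta> (cell t)) t"
  have "(LINT t|\<mu>. ip (alt (cell t) *\<^sub>R \<eta>) (?v t)) = (\<Sum>k<n. LINT t|\<mu>. cind k t * ip (alt (cell t) *\<^sub>R \<eta>) (?v t))"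
    by (intro integral_cells ip_integrable pw_smooth_deriv_L2[OF saw_smooth] disc_L2)
  also have "\<dots> = (\<Sum>k<n. alt k * h * (ip \<eta> (\<xi> k) + ip \<eta> (\<zeta> k) / 2))"
  proof (rule sum.cong)
    fix k assume "k \<in> {..<n}"
    then have k: "k < n" by simp
    define \<Gamma> where "\<Gamma> s = alt k * (s * ip \<eta> (\<xi> k) + s\<^sup>2 / 2 * ip \<eta> (\<zeta> k))" for s
    define G where "G s = alt k * (ip \<eta> (\<xi> k) + s * ip \<eta> (\<zeta> k))" for s
    have d: "(\<Gamma> has_real_derivative G s) (at s)" for s
      unfolding \<Gamma>_def[abs_def] G_def by (auto intro!: derivative_eq_intros)
    have c: "continuous_on UNIV G" unfolding G_def[abs_def] by (intro continuous_intros)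
    have "(LINT t|\<mu>. cind k t * ip (alt (cell t) *\<^sub>R \<eta>) (?v t)) = (LINT t|\<mu>. cind k t * G (loc t))"
      by (intro Bochner_Integration.integral_cong refl)
         (auto simp: cind_def aff_def G_def ip.add_right ip.scaleR_left ip.scaleR_right algebra_simps)
    also have "\<dots> = h * (\<Gamma> 1 - \<Gamma> 0)" by (rule cell_integral(2)[OF k d c])
    finally show "(LINT t|\<mu>. cind k t * ip (alt (cell t) *\<^sub>R \<eta>) (?v t)) = alt k * h * (ip \<eta> (\<xi> k) + ip \<eta> (\<zeta> k) / 2)"
      by (simp add: \<Gamma>_def)
  qed simp
  finally have 1: "(LINT t|\<mu>. ip (alt (cell t) *\<^sub>R \<eta>) (?v t)) = \<dots>" .
  have "(LINT t|\<mu>. a t (saw t) (?v t)) = (\<Sum>k<n. LINT t|\<mu>. cind k t * a t (saw t) (?v t))"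
    by (intro integral_cells form_integrable saw_L2 disc_L2)
  also have "\<dots> = (\<Sum>k<n. cform k saw (aff (\<xi> k) (\<zeta> k)))"
    unfolding cform_def
    by (intro sum.cong Bochner_Integration.integral_cong refl) (auto simp: cind_def)
  finally show ?thesis
    unfolding op_B_eq[OF saw_smooth disc_L2] 1 by (simp add: sum.distrib)
qed

lemma sum_if_last: "(\<Sum>k<n. if Suc k = n then f k else 0) = f (n - 1)" for f :: "nat \<Rightarrow> real"
proof -
  have "(\<Sum>k<n. if Suc k = n then f k else 0) = (\<Sum>k<n. if k = n - 1 then f k else 0)"
    using n_pos by (intro sum.cong) auto
  then show ?thesis using n_pos by simp
qed

lemma sum_source: "(\<Sum>k<n. source k (\<xi> k) (\<zeta> k)) =
    (\<Sum>k<n. cform k saw (aff (\<xi> k) (\<zeta> k))) - h / 2 * ip \<eta> (\<xi> (n - 1) + \<zeta> (n - 1))"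
  unfolding source_def by (simp only: sum_subtractf sum_if_last)

lemma X_delta_disc:
  assumes N: "n = 2 * N" and S: "subspace S" and w: "w \<in> X_delta T N S" and t: "t \<in> {0<..<T}"
  shows "w t = aff (w (real (cell t) * h)) (w (real (Suc (cell t)) * h) - w (real (cell t) * h)) t"
proof -
  have c: "cell t < n" "real (cell t) * h \<le> t" "t < real (Suc (cell t)) * h"
    using t cell_less[of t] cell_bounds[of t] by auto
  show ?thesis
    using X_delta_interp(2)[OF N S w c(1), of t] c(2,3) by (simp add: aff_def loc_def)
qed

lemma op_B_test_cong:
  assumes "\<And>t. t \<in> {0<..<T} \<Longrightarrow> v t = v' t"
  shows "op_B T emb a u v = op_B T emb a u v'"
  unfolding op_B_def by (intro Bochner_Integration.integral_cong) (auto simp: assms)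

text \<open>Against continuous piecewise affine functions that vanish at zero, the oscillating derivative of
  the sawtooth telescopes to an end point contribution, as the number of cells is even.\<close>

lemma op_B_saw_X_delta:
  assumes N: "n = 2 * N" and S: "subspace S" and w: "w \<in> X_delta T N S"
  defines "\<xi> \<equiv> \<lambda>k. w (real k * h)" and "\<zeta> \<equiv> \<lambda>k. w (real (Suc k) * h) - w (real k * h)"
  shows "op_B T emb a saw w = (\<Sum>k<n. source k (\<xi> k) (\<zeta> k))"
    and "op_B T emb a saw w = (LINT t|\<mu>. a t (saw t) (w t)) - h / 2 * ip \<eta> (w T)"
proof -
  define g where "g k = ip \<eta> (w (real k * h))" for k
  have wd: "w t = aff (\<xi> (cell t)) (\<zeta> (cell t)) t" if "t \<in> {0<..<T}" for t
    unfolding \<xi>_def \<zeta>_def by (rule X_delta_disc[OF N S w that])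
  have "(\<Sum>k<n. alt k * h * (ip \<eta> (\<xi> k) + ip \<eta> (\<zeta> k) / 2)) = h / 2 * (\<Sum>k<n. alt k * g k - alt (Suc k) * g (Suc k))"
    unfolding sum_distrib_left
    by (intro sum.cong refl) (auto simp: \<xi>_def \<zeta>_def g_def ip.diff_right alt_def algebra_simps diff_divide_distrib)
  also have "\<dots> = h / 2 * (alt 0 * g 0 - alt n * g n)"
    by (subst sum_lessThan_telescope') simp
  also have "\<dots> = - (h / 2 * ip \<eta> (w T))"
    using N n_h X_delta_interp(1)[OF N S w] by (simp add: alt_def g_def ip.zero_right)
  finally have tel: "(\<Sum>k<n. alt k * h * (ip \<eta> (\<xi> k) + ip \<eta> (\<zeta> k) / 2)) = - (h / 2 * ip \<eta> (w T))" .
  have B: "op_B T emb a saw w = - (h / 2 * ip \<eta> (w T)) + (\<Sum>k<n. cform k saw (aff (\<xi> k) (\<zeta> k)))"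
  proof -
    have "op_B T emb a saw w = op_B T emb a saw (\<lambda>t. aff (\<xi> (cell t)) (\<zeta> (cell t)) t)"
      by (rule op_B_test_cong[OF wd])
    then show ?thesis unfolding op_B_saw by (simp only: sum.distrib tel)
  qed
  have "Suc (n - 1) = n" using n_pos by simp
  then have "\<xi> (n - 1) + \<zeta> (n - 1) = w T"
    unfolding \<xi>_def \<zeta>_def using n_h by simp
  then show "op_B T emb a saw w = (\<Sum>k<n. source k (\<xi> k) (\<zeta> k))"
    unfolding sum_source B by simp
  have wL2: "w \<in> L2_space T" by (rule pw_smooth_L2[OF X_delta_smooth[OF N S w]])
  have "(LINT t|\<mu>. a t (saw t) (w t)) = (\<Sum>k<n. LINT t|\<mu>. cind k t * a t (saw t) (w t))"
    by (intro integral_cells form_integrable saw_L2 wL2)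
  also have "\<dots> = (\<Sum>k<n. cform k saw (aff (\<xi> k) (\<zeta> k)))"
    unfolding cform_def
    by (intro sum.cong Bochner_Integration.integral_cong refl) (auto simp: cind_def wd)
  finally show "op_B T emb a saw w = (LINT t|\<mu>. a t (saw t) (w t)) - h / 2 * ip \<eta> (w T)"
    unfolding B by simp
qed

lemma saw_L2n: "L2n T saw \<le> T * norm \<eta> * sqrt h"
proof -
  have "(LINT t|\<mu>. (norm (saw t))\<^sup>2) \<le> (LINT t|\<mu>. (h * norm \<eta>)\<^sup>2)"
  proof (rule integral_mono_AE)
    show "integrable \<mu> (\<lambda>t. (norm (saw t))\<^sup>2)" using saw_L2 by (simp add: L2_space_def)
    show "AE t in \<mu>. (norm (saw t))\<^sup>2 \<le> (h * norm \<eta>)\<^sup>2"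
      using saw_norm by (intro AE_I2 power_mono) auto
  qed simp
  also have "\<dots> = (h * norm \<eta>)\<^sup>2 * T" using T_pos by (simp add: measure_restrict_space)
  also have "\<dots> = (h * T) * (norm \<eta>)\<^sup>2 * h" by (simp add: power2_eq_square)
  also have "\<dots> \<le> (T * T) * (norm \<eta>)\<^sup>2 * h"
    using h_le h_pos T_pos by (intro mult_right_mono) auto
  also have "\<dots> = (T * norm \<eta> * sqrt h)\<^sup>2" using h_pos by (simp add: power_mult_distrib power2_eq_square)
  finally show ?thesis unfolding L2n_def using T_pos h_pos by (intro real_le_lsqrt) auto
qed

text \<open>An inverse inequality; it is the source of the factor \<open>sqrt h\<close>.\<close>

lemma X_delta_end_le:
  fixes w :: "real \<Rightarrow> 'v"
  assumes N: "n = 2 * N" and S: "subspace S" and w: "w \<in> X_delta T N S"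
  shows "sqrt h * norm (w T) \<le> 2 * L2n T w"
proof -
  define k where "k = n - 1"
  have k: "k < n" "Suc k = n" using n_pos by (auto simp: k_def)
  define \<xi> \<zeta> where "\<xi> = w (real k * h)" and "\<zeta> = w (real (Suc k) * h) - w (real k * h)"
  have i: "integrable \<mu> (\<lambda>t. (norm (w t))\<^sup>2)"
    using pw_smooth_L2[OF X_delta_smooth[OF N S w]] by (simp add: L2_space_def)
  have "h * (norm (\<xi> + \<zeta>))\<^sup>2 \<le> h * (4 * affine_mass \<xi> \<zeta>)"
    using h_pos by (intro mult_left_mono affine_mass_bounds) auto
  also have "\<dots> = 4 * (LINT t|\<mu>. cind k t * (norm (aff \<xi> \<zeta> t))\<^sup>2)"
    by (simp add: aff_mass_integral(2)[OF k(1)])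
  also have "(LINT t|\<mu>. cind k t * (norm (aff \<xi> \<zeta> t))\<^sup>2) = (LINT t|\<mu>. cind k t * (norm (w t))\<^sup>2)"
    by (intro Bochner_Integration.integral_cong refl)
       (auto simp: cind_def X_delta_disc[OF N S w] \<xi>_def \<zeta>_def)
  also have "\<dots> \<le> (LINT t|\<mu>. (norm (w t))\<^sup>2)"
    by (rule integral_mono_AE[OF cind_integrable[OF i] i]) (auto intro!: AE_I2 mult_left_le_one_le)
  also have "\<dots> = (L2n T w)\<^sup>2" by (simp add: L2n_power2)
  also have "\<xi> + \<zeta> = w T" using n_h k(2) by (simp add: \<xi>_def \<zeta>_def)
  finally have "(sqrt h * norm (w T))\<^sup>2 \<le> (2 * L2n T w)\<^sup>2"
    using h_pos by (simp add: power_mult_distrib)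
  then show ?thesis by (rule power2_le_imp_le) simp
qed

lemma saw_inf_sup:
  assumes N: "n = 2 * N" and S: "subspace S" and w: "w \<in> X_delta T N S"
  shows "\<bar>op_B T emb a saw w\<bar> \<le> ((norm emb)\<^sup>2 + M * T) * norm \<eta> / sqrt \<alpha> * sqrt h * norm_Y T a w"
proof -
  have wL2: "w \<in> L2_space T" by (rule pw_smooth_L2[OF X_delta_smooth[OF N S w]])
  have "\<bar>LINT t|\<mu>. a t (saw t) (w t)\<bar> \<le> M * (T * norm \<eta> * sqrt h) * L2n T w"
    using form_integral_le[OF saw_L2 wL2] saw_L2n M_pos
    by (meson L2n_nonneg mult_left_mono mult_right_mono less_imp_le order_trans)
  moreover have "\<bar>h / 2 * ip \<eta> (w T)\<bar> \<le> (norm emb)\<^sup>2 * norm \<eta> * sqrt h * L2n T w"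
  proof -
    have "\<bar>h / 2 * ip \<eta> (w T)\<bar> = h / 2 * \<bar>ip \<eta> (w T)\<bar>" using h_pos by (simp add: abs_mult)
    also have "\<dots> \<le> h / 2 * ((norm emb)\<^sup>2 * norm \<eta> * norm (w T))"
      using h_pos by (intro mult_left_mono ip_le) auto
    also have "\<dots> = (norm emb)\<^sup>2 * norm \<eta> * (sqrt h / 2) * (sqrt h * norm (w T))"
      using h_pos by simp
    also have "\<dots> \<le> (norm emb)\<^sup>2 * norm \<eta> * (sqrt h / 2) * (2 * L2n T w)"
      using h_pos by (intro mult_left_mono X_delta_end_le[OF N S w]) auto
    finally show ?thesis by simp
  qed
  ultimately have "\<bar>op_B T emb a saw w\<bar> \<le> ((norm emb)\<^sup>2 + M * T) * norm \<eta> * sqrt h * L2n T w"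
    unfolding op_B_saw_X_delta(2)[OF N S w] by (simp add: algebra_simps)
  also have "\<dots> \<le> ((norm emb)\<^sup>2 + M * T) * norm \<eta> * sqrt h * (norm_Y T a w / sqrt \<alpha>)"
    using norm_Y_ge[OF wL2] alpha_pos M_pos T_pos h_pos
    by (intro mult_left_mono) (auto simp: field_simps)
  finally show ?thesis by (simp add: algebra_simps add_divide_distrib)
qed

text \<open>The time derivative of the sawtooth. Paired with the sawtooth's derivative it does not cancel, in
  contrast to continuous test functions.\<close>

definition saw_slope :: "real \<Rightarrow> 'v" where "saw_slope t = alt (cell t) *\<^sub>R \<eta>"

lemma saw_slope_L2: "saw_slope \<in> L2_space T"
  unfolding saw_slope_def[abs_def] by (rule cellwise_L2[of "\<lambda>k s. alt k *\<^sub>R \<eta>"]) (rule continuous_on_const)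

lemma saw_slope_L2n: "L2n T saw_slope = sqrt T * norm \<eta>"
proof -
  have "(norm (saw_slope t))\<^sup>2 = (norm \<eta>)\<^sup>2" for t by (simp add: saw_slope_def alt_def)
  then show ?thesis using T_pos by (simp add: L2n_def measure_restrict_space real_sqrt_mult)
qed

lemma saw_dt_saw_slope: "(LINT t|\<mu>. ip (alt (cell t) *\<^sub>R \<eta>) (saw_slope t)) = T * ip \<eta> \<eta>"
proof -
  have "ip (alt (cell t) *\<^sub>R \<eta>) (saw_slope t) = ip \<eta> \<eta>" for t
    by (simp add: saw_slope_def alt_def ip.minus_left ip.minus_right)
  then show ?thesis using T_pos by (simp add: measure_restrict_space)
qed

lemma saw_norm_X: "T * ip \<eta> \<eta> \<le> norm_X T emb a saw * (sqrt M * sqrt T * norm \<eta>)"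
proof -
  have "T * ip \<eta> \<eta> \<le> norm_X T emb a saw * norm_Y T a saw_slope"
    using norm_X_ge(2)[OF saw_smooth saw_slope_L2] unfolding saw_dt_saw_slope by linarith
  also have "\<dots> \<le> norm_X T emb a saw * (sqrt M * sqrt T * norm \<eta>)"
    using norm_Y_le[OF saw_slope_L2] norm_X_nonneg unfolding saw_slope_L2n by (intro mult_left_mono) auto
  finally show ?thesis .
qed

lemma saw_nonzero:
  assumes "\<eta> \<noteq> 0" "n \<ge> 2" shows "\<not> eq_on_I T saw (\<lambda>t. 0)"
proof
  assume "eq_on_I T saw (\<lambda>t. 0)"
  then have "saw h = 0"
    using continuous_on_AE_eq_imp_eq[of T saw "\<lambda>t. 0" h] saw_smooth T_pos h_pos h_le
    by (simp add: eq_on_I_def pw_smooth_def)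
  moreover have "cell h = 1" using cell_node[of 1] by simp
  then have "saw h = h *\<^sub>R \<eta>" using h_pos by (simp add: saw_def saw_fun_def loc_def)
  ultimately show False using assms h_pos by simp
qed

lemma inf_sup_le:
  assumes N: "n = 2 * N" and N1: "N \<ge> 1" and S: "subspace S" "\<eta> \<in> S" and \<eta>: "\<eta> \<noteq> 0" "blinfun_apply emb \<eta> \<noteq> 0"
  shows "(INF z\<in>nonzero_in T (X_delta T N S). SUP v\<in>nonzero_in T (X_delta T N S).
           ereal (\<bar>op_B T emb a z v\<bar> / (norm_X T emb a z * norm_Y T a v)))
    \<le> ereal (((norm emb)\<^sup>2 + M * T) * norm \<eta> / sqrt \<alpha> / (T * ip \<eta> \<eta> / (sqrt M * sqrt T * norm \<eta>)) * sqrt h)"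
proof (rule INF_lower2)
  let ?D = "((norm emb)\<^sup>2 + M * T) * norm \<eta> / sqrt \<alpha>"
  let ?c = "T * ip \<eta> \<eta> / (sqrt M * sqrt T * norm \<eta>)"
  show "saw \<in> nonzero_in T (X_delta T N S)"
    unfolding nonzero_in_def using saw_in_X_delta[OF N S(2)] saw_nonzero[OF \<eta>(1)] N N1 by auto
  have c: "?c > 0" using T_pos M_pos \<eta> by (simp add: ip_self)
  have cX: "?c \<le> norm_X T emb a saw"
    using saw_norm_X T_pos M_pos \<eta>(1) by (simp add: field_simps)
  show "(SUP v\<in>nonzero_in T (X_delta T N S). ereal (\<bar>op_B T emb a saw v\<bar> / (norm_X T emb a saw * norm_Y T a v)))
      \<le> ereal (?D / ?c * sqrt h)"
  proof (rule SUP_least)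
    fix v assume "v \<in> nonzero_in T (X_delta T N S)"
    then have v: "v \<in> X_delta T N S" by (simp add: nonzero_in_def)
    have v0: "0 \<le> norm_Y T a v" by (rule norm_Y_nonneg[OF pw_smooth_L2[OF X_delta_smooth[OF N S(1) v]]])
    have D: "0 \<le> ?D" using M_pos T_pos alpha_pos by simp
    have "\<bar>op_B T emb a saw v\<bar> / (norm_X T emb a saw * norm_Y T a v) \<le> ?D / ?c * sqrt h"
    proof (cases "norm_Y T a v = 0")
      case True
      have "0 \<le> ?D / ?c * sqrt h" by (rule mult_nonneg_nonneg[OF divide_nonneg_pos[OF D c]]) (use h_pos in simp)
      then show ?thesis using True by simp
    next
      case False
      then have vp: "norm_Y T a v > 0" using v0 by simp
      have "\<bar>op_B T emb a saw v\<bar> / (norm_X T emb a saw * norm_Y T a v)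
          \<le> (?D * sqrt h * norm_Y T a v) / (norm_X T emb a saw * norm_Y T a v)"
        using saw_inf_sup[OF N S(1) v] vp norm_X_nonneg by (intro divide_right_mono) auto
      also have "\<dots> = ?D * sqrt h / norm_X T emb a saw" using vp by simp
      also have "\<dots> \<le> ?D * sqrt h / ?c"
      proof (rule divide_left_mono[OF cX])
        show "0 \<le> ?D * sqrt h" using D by (rule mult_nonneg_nonneg) (use h_pos in simp)
        show "0 < norm_X T emb a saw * ?c" using c cX by (intro mult_pos_pos) linarith+
      qed
      finally show ?thesis by (simp only: times_divide_eq_left)
    qed
    then show "ereal (\<bar>op_B T emb a saw v\<bar> / (norm_X T emb a saw * norm_Y T a v)) \<le> ereal (?D / ?c * sqrt h)"
      by simp
  qed
qed

end

section \<open>Stability of the scheme\<close>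

text \<open>Constants in the bounds for the energy of the solution, for its time derivative in the dual
  norm, and for its norm in \<open>X\<close>. They do not depend on the grid. The arguments \<open>\<kappa>\<close> and \<open>e\<close>
  stand for the squared norm of the embedding and for the norm of \<open>\<eta>\<close>.\<close>

definition energy_const :: "real \<Rightarrow> real \<Rightarrow> real \<Rightarrow> real \<Rightarrow> real \<Rightarrow> real" where
  "energy_const T M \<alpha> \<kappa> e = (2 * M\<^sup>2 * T\<^sup>2 + 2 * \<kappa>\<^sup>2) * e\<^sup>2 / \<alpha>"

definition deriv_const :: "real \<Rightarrow> real \<Rightarrow> real \<Rightarrow> real \<Rightarrow> real \<Rightarrow> real \<Rightarrow> real" where
  "deriv_const T M \<alpha> \<kappa> e R = (2 + 3 * R)\<^sup>2 *
     (4 * M\<^sup>2 * (T\<^sup>2 * e\<^sup>2 + 3264 * energy_const T M \<alpha> \<kappa> e / \<alpha>) + \<kappa>\<^sup>2 * e\<^sup>2 / 2)"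

definition approx_const :: "real \<Rightarrow> real \<Rightarrow> real \<Rightarrow> real \<Rightarrow> real \<Rightarrow> real \<Rightarrow> real" where
  "approx_const T M \<alpha> \<kappa> e R = sqrt M * sqrt (3264 * energy_const T M \<alpha> \<kappa> e / \<alpha>) +
     sqrt (deriv_const T M \<alpha> \<kappa> e R) / sqrt \<alpha> + sqrt (2 * energy_const T M \<alpha> \<kappa> e)"

text \<open>A solution of the scheme: on cell \<open>k\<close> it starts with \<open>x k\<close> and is incremented by \<open>y k\<close>, and
  \<open>E k\<close> is the value that enters the cell from the left.\<close>

locale dg_solution = dg_scheme +
  fixes x y E :: "nat \<Rightarrow> 'a"
  assumes E_0: "E 0 = 0" and E_Suc: "\<And>k. k < n \<Longrightarrow> E (Suc k) = x k + y k"
    and step: "\<And>k. k < n \<Longrightarrow> step_eq k (E k) (x k) (y k)"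
begin

text \<open>The smoothed solution \<open>sol\<close> with its derivative, its jumps before smoothing, and the squared
  \<open>L\<^sub>2\<close> norm of the discontinuous solution divided by \<open>h\<close>.\<close>

definition jump :: "nat \<Rightarrow> 'a" where "jump k = x k - E k"

definition total_mass :: real where "total_mass = (\<Sum>k<n. affine_mass (x k) (y k))"

definition sol :: "real \<Rightarrow> 'a" where
  "sol t = trial (x (cell t)) (y (cell t)) (jump (cell t)) t"

definition sol' :: "real \<Rightarrow> 'a" where
  "sol' t = (1 / h) *\<^sub>R (y (cell t) - r' (loc t) *\<^sub>R jump (cell t))"

abbreviation \<kappa> :: real where "\<kappa> \<equiv> (norm emb)\<^sup>2"
abbreviation C\<^sub>0 :: real where "C\<^sub>0 \<equiv> energy_const T M \<alpha> \<kappa> (norm \<eta>)"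

lemma total_mass_nonneg: "0 \<le> total_mass"
  unfolding total_mass_def by (intro sum_nonneg affine_mass_bounds)

lemma C0_nonneg: "0 \<le> C\<^sub>0"
  using alpha_pos by (simp add: energy_const_def)

lemma sum_jumps: "(\<Sum>k<n. (norm (jump k))\<^sup>2) \<le> 16 * total_mass"
proof -
  have "(\<Sum>k<n. (norm (E k))\<^sup>2) \<le> (\<Sum>k<Suc n. (norm (E k))\<^sup>2)" by simp
  also have "\<dots> = (\<Sum>k<n. (norm (E (Suc k)))\<^sup>2)"
    by (subst sum.lessThan_Suc_shift) (simp add: E_0)
  also have "\<dots> \<le> (\<Sum>k<n. 4 * affine_mass (x k) (y k))"
    by (intro sum_mono) (auto simp: E_Suc affine_mass_bounds)
  finally have E: "(\<Sum>k<n. (norm (E k))\<^sup>2) \<le> 4 * total_mass"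
    by (simp add: total_mass_def sum_distrib_left)
  have "(\<Sum>k<n. (norm (jump k))\<^sup>2) \<le> (\<Sum>k<n. 8 * affine_mass (x k) (y k) + 2 * (norm (E k))\<^sup>2)"
  proof (rule sum_mono)
    fix k
    have "(norm (jump k))\<^sup>2 \<le> (norm (x k) + norm (E k))\<^sup>2"
      unfolding jump_def by (intro power_mono norm_triangle_ineq4) simp
    also have "\<dots> \<le> 2 * (norm (x k))\<^sup>2 + 2 * (norm (E k))\<^sup>2"
      using sum_squares_bound[of "norm (x k)" "norm (E k)"] by (simp add: power2_sum)
    finally show "(norm (jump k))\<^sup>2 \<le> 8 * affine_mass (x k) (y k) + 2 * (norm (E k))\<^sup>2"
      using affine_mass_bounds(1)[of "x k" "y k"] by linarith
  qed
  also have "\<dots> = 8 * total_mass + 2 * (\<Sum>k<n. (norm (E k))\<^sup>2)"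
    by (simp add: sum.distrib sum_distrib_left total_mass_def)
  finally show ?thesis using E by linarith
qed

lemma source_le:
  assumes k: "k < n"
  shows "source k (x k) (y k) \<le> \<alpha> / 4 * (h * affine_mass (x k) (y k)) + 2 * M\<^sup>2 / \<alpha> * (h * norm \<eta>)\<^sup>2 * h
    + (if Suc k = n then h * (2 * \<kappa>\<^sup>2 * (norm \<eta>)\<^sup>2 / \<alpha>) else 0)"
proof -
  have "- (h / 2 * ip \<eta> (x k + y k)) \<le> \<alpha> / 8 * (h * affine_mass (x k) (y k)) + h * (2 * \<kappa>\<^sup>2 * (norm \<eta>)\<^sup>2 / \<alpha>)"
  proof -
    have "- (1 / 2 * ip \<eta> (x k + y k)) \<le> (\<kappa> * norm \<eta> / 2) * norm (x k + y k)"
      using ip_le[of \<eta> "x k + y k"] by simp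
    also have "\<dots> \<le> \<alpha> / 32 * (norm (x k + y k))\<^sup>2 + (\<kappa> * norm \<eta> / 2)\<^sup>2 / (4 * (\<alpha> / 32))"
      using alpha_pos by (intro young_ineq) simp
    also have "(\<kappa> * norm \<eta> / 2)\<^sup>2 / (4 * (\<alpha> / 32)) = 2 * \<kappa>\<^sup>2 * (norm \<eta>)\<^sup>2 / \<alpha>"
      by (simp add: power_mult_distrib power_divide)
    also have "\<alpha> / 32 * (norm (x k + y k))\<^sup>2 \<le> \<alpha> / 32 * (4 * affine_mass (x k) (y k))"
      using alpha_pos by (intro mult_left_mono affine_mass_bounds) auto
    finally have "- (1 / 2 * ip \<eta> (x k + y k)) \<le> \<alpha> / 8 * affine_mass (x k) (y k) + 2 * \<kappa>\<^sup>2 * (norm \<eta>)\<^sup>2 / \<alpha>"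
      by simp
    from mult_left_mono[OF this less_imp_le[OF h_pos]] show ?thesis by (simp add: algebra_simps)
  qed
  moreover have "0 \<le> \<alpha> / 8 * (h * affine_mass (x k) (y k))"
    using alpha_pos h_pos affine_mass_bounds(4)[of "x k" "y k"] by simp
  ultimately show ?thesis
    using saw_energy[OF k, of "x k" "y k"] unfolding source_def by (cases "Suc k = n") auto
qed

text \<open>The energy estimate: the equation is tested with the discontinuous solution itself, and the
  kinetic terms telescope up to the nonnegative jump terms.\<close>

lemma energy: "ip (E n) (E n) / 2 + \<alpha> / 4 * (h * total_mass) \<le> h * C\<^sub>0"
proof -
  define A where "A = 2 * M\<^sup>2 / \<alpha> * (h * norm \<eta>)\<^sup>2 * h"
  define B where "B = h * (2 * \<kappa>\<^sup>2 * (norm \<eta>)\<^sup>2 / \<alpha>)"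
  define m where "m k = h * affine_mass (x k) (y k)" for k
  have st: "(ip (E (Suc k)) (E (Suc k)) / 2 - ip (E k) (E k) / 2) + \<alpha> / 2 * m k
      \<le> \<alpha> / 64 * (h * (norm (jump k))\<^sup>2) + A + (if Suc k = n then B else 0)" if k: "k < n" for k
  proof -
    have "ip (y k) (x k) + ip (y k) (y k) / 2 + ip (jump k) (x k) + cform k (trial (x k) (y k) (jump k)) (aff (x k) (y k))
        = source k (x k) (y k)"
      using step[OF k] unfolding step_eq_def jump_def by blast
    moreover have "ip (y k) (x k) + ip (y k) (y k) / 2 + ip (jump k) (x k)
        = ip (E (Suc k)) (E (Suc k)) / 2 - ip (E k) (E k) / 2 + ip (jump k) (jump k) / 2"
      unfolding E_Suc[OF k] jump_def
      by (simp add: ip.add_left ip.add_right ip.diff_left ip.diff_right ip_sym[of "y k" "x k"]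
          ip_sym[of "E k" "x k"] add_divide_distrib diff_divide_distrib)
    moreover have "0 \<le> ip (jump k) (jump k)" by simp
    moreover have "3 * \<alpha> / 4 * m k - \<alpha> / 64 * (h * (norm (jump k))\<^sup>2) \<le> cform k (trial (x k) (y k) (jump k)) (aff (x k) (y k))"
      unfolding m_def by (rule local_energy[OF k])
    moreover have "source k (x k) (y k) \<le> \<alpha> / 4 * m k + A + (if Suc k = n then B else 0)"
      using source_le[OF k] unfolding m_def A_def B_def .
    ultimately show ?thesis by linarith
  qed
  have "(\<Sum>k<n. (ip (E (Suc k)) (E (Suc k)) / 2 - ip (E k) (E k) / 2) + \<alpha> / 2 * m k)
      \<le> (\<Sum>k<n. \<alpha> / 64 * (h * (norm (jump k))\<^sup>2) + A + (if Suc k = n then B else 0))"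
    by (intro sum_mono st) simp
  moreover have "(\<Sum>k<n. (ip (E (Suc k)) (E (Suc k)) / 2 - ip (E k) (E k) / 2) + \<alpha> / 2 * m k)
      = ip (E n) (E n) / 2 + \<alpha> / 2 * (h * total_mass)"
    using sum_lessThan_telescope[of "\<lambda>k. ip (E k) (E k) / 2" n]
    by (simp add: sum.distrib E_0 ip.zero_left m_def total_mass_def sum_distrib_left)
  moreover have "(\<Sum>k<n. \<alpha> / 64 * (h * (norm (jump k))\<^sup>2) + A + (if Suc k = n then B else 0))
      = \<alpha> / 64 * (h * (\<Sum>k<n. (norm (jump k))\<^sup>2)) + real n * A + B"
  proof -
    have "(\<Sum>k<n. if Suc k = n then B else 0) = (\<Sum>k<n. if k = n - 1 then B else 0)"
      using n_pos by (intro sum.cong) auto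
    also have "\<dots> = B" using n_pos by simp
    finally show ?thesis by (simp add: sum.distrib sum_distrib_left)
  qed
  moreover have "\<alpha> / 64 * (h * (\<Sum>k<n. (norm (jump k))\<^sup>2)) \<le> \<alpha> / 64 * (h * (16 * total_mass))"
    using sum_jumps alpha_pos h_pos by (intro mult_left_mono) auto
  moreover have "real n * A \<le> h * (2 * M\<^sup>2 * T\<^sup>2 * (norm \<eta>)\<^sup>2 / \<alpha>)"
  proof -
    have "real n * A = (2 * M\<^sup>2 * (norm \<eta>)\<^sup>2 / \<alpha>) * (h * ((real n * h) * h))"
      by (simp add: A_def power2_eq_square)
    also have "\<dots> \<le> (2 * M\<^sup>2 * (norm \<eta>)\<^sup>2 / \<alpha>) * (h * (T * T))"
      unfolding n_h using h_le h_pos alpha_pos T_pos by (intro mult_left_mono) auto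
    finally show ?thesis by (simp add: power2_eq_square mult_ac)
  qed
  moreover have "h * C\<^sub>0 = h * (2 * M\<^sup>2 * T\<^sup>2 * (norm \<eta>)\<^sup>2 / \<alpha>) + B"
    by (simp add: energy_const_def B_def algebra_simps add_divide_distrib)
  ultimately show ?thesis by linarith
qed

lemma h_total_mass_le: "h * total_mass \<le> 4 * C\<^sub>0 / \<alpha> * h"
proof -
  have "\<alpha> / 4 * (h * total_mass) \<le> h * C\<^sub>0" using energy ip_nonneg[of "E n"] by linarith
  then show ?thesis using alpha_pos by (simp add: field_simps)
qed

lemma sol_smooth: "pw_smooth T sol sol'"
proof -
  define p where "p k t = x k + (t / h - real k) *\<^sub>R y k - r (t / h - real k) *\<^sub>R jump k" for k t
  define d where "d k t = (1 / h) *\<^sub>R (y k - r' (t / h - real k) *\<^sub>R jump k)" for k t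
  have "pw_smooth T (\<lambda>t. p (cell t) t) (\<lambda>t. d (cell t) t)"
  proof (rule pw_smooth_glue)
    fix k assume k: "k < n"
    have 1: "real (Suc k) * h / h - real k = 1" "real (Suc k) * h / h - real (Suc k) = 0"
      using h_pos by (auto simp: field_simps)
    show "p k (real (Suc k) * h) = p (Suc k) (real (Suc k) * h)"
      unfolding p_def 1 by (simp add: r_0 r_1 jump_def E_Suc[OF k])
  next
    fix k t
    have 1: "((\<lambda>t. t / h - real k) has_real_derivative 1 / h) (at t)"
      using h_pos by (auto intro!: derivative_eq_intros)
    have 2: "((\<lambda>t. r (t / h - real k)) has_real_derivative r' (t / h - real k) * (1 / h)) (at t)"
      by (rule DERIV_chain2[OF r_deriv 1])
    have "(p k has_vector_derivative (0 + (1 / h) *\<^sub>R y k) - (r' (t / h - real k) * (1 / h)) *\<^sub>R jump k) (at t)"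
      unfolding p_def[abs_def]
      by (intro has_vector_derivative_diff has_vector_derivative_add has_vector_derivative_const
          bounded_linear.has_vector_derivative[OF bounded_linear_scaleR_left]
          1[unfolded has_real_derivative_iff_has_vector_derivative] 2[unfolded has_real_derivative_iff_has_vector_derivative])
    then show "(p k has_vector_derivative d k t) (at t)"
      by (simp add: d_def algebra_simps)
    show "continuous_on UNIV (d k)"
      unfolding d_def[abs_def] using h_pos
      by (intro continuous_intros continuous_on_compose2[OF r'_cont]) auto
  qed
  then show ?thesis
    by (simp add: p_def d_def sol_def[abs_def] sol'_def[abs_def] trial_def aff_def loc_def)
qed

lemma sol_0: "sol 0 = 0" and sol_T: "sol T = E n"
  by (auto simp: sol_def trial_def aff_def loc_0 loc_T cell_0 cell_T r_0 jump_def E_0)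

text \<open>The scheme tests the equation with all functions that are affine on each cell,
  continuous or not.\<close>

lemma op_B_sol:
  "op_B T emb a sol (\<lambda>t. aff (\<xi> (cell t)) (\<zeta> (cell t)) t) = (\<Sum>k<n. source k (\<xi> k) (\<zeta> k))"
proof -
  let ?v = "\<lambda>t. aff (\<xi> (cell t)) (\<zeta> (cell t)) t"
  have "(LINT t|\<mu>. ip (sol' t) (?v t)) = (\<Sum>k<n. LINT t|\<mu>. cind k t * ip (sol' t) (?v t))"
    by (intro integral_cells ip_integrable pw_smooth_deriv_L2[OF sol_smooth] disc_L2)
  also have "\<dots> = (\<Sum>k<n. ip (y k) (\<xi> k) + ip (y k) (\<zeta> k) / 2 + ip (jump k) (\<xi> k))"
  proof (rule sum.cong)
    fix k assume "k \<in> {..<n}"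
    then have k: "k < n" by simp
    let ?a = "ip (y k) (\<xi> k)" and ?b = "ip (y k) (\<zeta> k)" and ?c = "ip (jump k) (\<xi> k)" and ?d = "ip (jump k) (\<zeta> k)"
    define \<Gamma> where "\<Gamma> s = (1 / h) * (s * ?a + s\<^sup>2 / 2 * ?b - r s * ?c - (s * r s - P s) * ?d)" for s
    define G where "G s = (1 / h) * (?a + s * ?b - r' s * ?c - s * r' s * ?d)" for s
    have d: "(\<Gamma> has_real_derivative G s) (at s)" for s
      unfolding \<Gamma>_def[abs_def] G_def
      by (rule derivative_eq_intros r_deriv P_deriv refl | simp add: algebra_simps)+
    have c: "continuous_on UNIV G" unfolding G_def[abs_def] by (intro continuous_intros r'_cont)
    have "(LINT t|\<mu>. cind k t * ip (sol' t) (?v t)) = (LINT t|\<mu>. cind k t * G (loc t))"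
    proof (intro Bochner_Integration.integral_cong refl cind_cong)
      fix t assume "cell t = k"
      then show "ip (sol' t) (?v t) = G (loc t)"
        unfolding sol'_def aff_def G_def
        by (simp add: ip.add_right ip.diff_left ip.scaleR_left ip.scaleR_right algebra_simps)
    qed
    also have "\<dots> = h * (\<Gamma> 1 - \<Gamma> 0)" by (rule cell_integral(2)[OF k d c])
    also have "\<dots> = ?a + ?b / 2 + ?c"
      using h_pos by (simp add: \<Gamma>_def r_0 r_1 P_0 P_1 field_simps)
    finally show "(LINT t|\<mu>. cind k t * ip (sol' t) (?v t)) = ?a + ?b / 2 + ?c" .
  qed simp
  finally have 1: "(LINT t|\<mu>. ip (sol' t) (?v t)) = \<dots>" .
  have "(LINT t|\<mu>. a t (sol t) (?v t)) = (\<Sum>k<n. LINT t|\<mu>. cind k t * a t (sol t) (?v t))"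
    by (intro integral_cells form_integrable pw_smooth_L2[OF sol_smooth] disc_L2)
  also have "\<dots> = (\<Sum>k<n. cform k (trial (x k) (y k) (jump k)) (aff (\<xi> k) (\<zeta> k)))"
    unfolding cform_def
    by (intro sum.cong Bochner_Integration.integral_cong refl cind_cong) (simp add: sol_def)
  finally have 2: "(LINT t|\<mu>. a t (sol t) (?v t)) = \<dots>" .
  have "op_B T emb a sol ?v = (\<Sum>k<n. ip (y k) (\<xi> k) + ip (y k) (\<zeta> k) / 2 + ip (jump k) (\<xi> k)
      + cform k (trial (x k) (y k) (jump k)) (aff (\<xi> k) (\<zeta> k)))"
    unfolding op_B_eq[OF sol_smooth disc_L2] 1 2 by (simp add: sum.distrib)
  also have "\<dots> = (\<Sum>k<n. source k (\<xi> k) (\<zeta> k))"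
    using step unfolding step_eq_def jump_def by (intro sum.cong) auto
  finally show ?thesis .
qed

text \<open>A bound for the solution on cell \<open>k\<close>.\<close>

definition size_on :: "nat \<Rightarrow> real" where
  "size_on k = norm (x k) + norm (y k) + 4 * norm (jump k)"

lemma sol_norm: "t \<in> {0<..<T} \<Longrightarrow> norm (sol t) \<le> size_on (cell t)"
  unfolding sol_def size_on_def by (rule trial_norm)

lemma size_on_nonneg: "0 \<le> size_on k"
  by (simp add: size_on_def)

lemma sum_size_on: "(\<Sum>k<n. (size_on k)\<^sup>2) \<le> 3264 * C\<^sub>0 / \<alpha>"
proof -
  have "(size_on k)\<^sup>2 \<le> 48 * affine_mass (x k) (y k) + 48 * (norm (jump k))\<^sup>2" for k
  proof -
    have "(size_on k)\<^sup>2 \<le> 3 * ((norm (x k))\<^sup>2 + (norm (y k))\<^sup>2 + (4 * norm (jump k))\<^sup>2)"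
      using sum_squares_bound[of "norm (x k)" "norm (y k)"]
        sum_squares_bound[of "norm (x k)" "4 * norm (jump k)"] sum_squares_bound[of "norm (y k)" "4 * norm (jump k)"]
      unfolding size_on_def by (simp add: power2_eq_square algebra_simps)
    then show ?thesis using affine_mass_bounds(3)[of "x k" "y k"] by (simp add: power_mult_distrib)
  qed
  then have "(\<Sum>k<n. (size_on k)\<^sup>2) \<le> (\<Sum>k<n. 48 * affine_mass (x k) (y k) + 48 * (norm (jump k))\<^sup>2)"
    by (intro sum_mono)
  also have "\<dots> = 48 * total_mass + 48 * (\<Sum>k<n. (norm (jump k))\<^sup>2)"
    by (simp add: sum.distrib sum_distrib_left total_mass_def)
  finally have "(\<Sum>k<n. (size_on k)\<^sup>2) \<le> 816 * total_mass" using sum_jumps by linarith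
  moreover have "h * total_mass \<le> h * (4 * C\<^sub>0 / \<alpha>)" using h_total_mass_le by (simp only: mult.commute[of h])
  then have "total_mass \<le> 4 * C\<^sub>0 / \<alpha>" using mult_le_cancel_left_pos[OF h_pos] by blast
  ultimately show ?thesis by linarith
qed

lemma sol_L2n: "L2n T sol \<le> sqrt (3264 * C\<^sub>0 / \<alpha>) * sqrt h"
proof -
  have i: "integrable \<mu> (\<lambda>t. (norm (sol t))\<^sup>2)"
    using pw_smooth_L2[OF sol_smooth] by (simp add: L2_space_def)
  have "(LINT t|\<mu>. (norm (sol t))\<^sup>2) = (\<Sum>k<n. LINT t|\<mu>. cind k t * (norm (sol t))\<^sup>2)"
    by (rule integral_cells[OF i])
  also have "\<dots> \<le> (\<Sum>k<n. LINT t|\<mu>. cind k t * (size_on k)\<^sup>2)"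
  proof (intro sum_mono integral_mono_AE cind_integrable[OF i] AE_I2)
    show "integrable \<mu> (\<lambda>t. cind k t * (size_on k)\<^sup>2)" for k by (rule cind_integrable) simp
    show "cind k t * (norm (sol t))\<^sup>2 \<le> cind k t * (size_on k)\<^sup>2" if "t \<in> space \<mu>" for k t
      using that sol_norm[of t] by (auto simp: cind_def intro: power_mono)
  qed
  also have "\<dots> = h * (\<Sum>k<n. (size_on k)\<^sup>2)" by (simp add: cind_integral sum_distrib_left)
  also have "\<dots> \<le> h * (3264 * C\<^sub>0 / \<alpha>)" using h_pos by (intro mult_left_mono sum_size_on) auto
  finally have "sqrt (LINT t|\<mu>. (norm (sol t))\<^sup>2) \<le> sqrt (h * (3264 * C\<^sub>0 / \<alpha>))"
    by (rule real_sqrt_le_mono)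
  then show ?thesis by (simp only: L2n_def real_sqrt_mult mult.commute[of "sqrt h"])
qed

lemma sol_T_le: "norm (blinfun_apply emb (sol T)) \<le> sqrt (2 * C\<^sub>0) * sqrt h"
proof -
  have "0 \<le> \<alpha> / 4 * (h * total_mass)" using alpha_pos h_pos total_mass_nonneg by simp
  then have "(norm (blinfun_apply emb (E n)))\<^sup>2 \<le> 2 * C\<^sub>0 * h"
    using energy by (simp add: ip_self algebra_simps)
  then show ?thesis unfolding sol_T real_sqrt_mult[symmetric] by (rule real_le_rsqrt)
qed

text \<open>A bound, up to constant factors, for the dual norms of the increment and of the jump on cell
  \<open>k\<close>. It comes from the equation, tested separately with the two components.\<close>

definition dual_bound :: "nat \<Rightarrow> real" where
  "dual_bound k = M * (h * norm \<eta> + size_on k) * h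
     + (if Suc k = n then h / 2 * (\<kappa> * norm \<eta>) else 0)"

lemma dual_bound_nonneg: "0 \<le> dual_bound k"
  unfolding dual_bound_def using M_pos h_pos by (auto intro!: add_nonneg_nonneg mult_nonneg_nonneg size_on_nonneg)

lemma dual_bounds:
  assumes k: "k < n"
  shows "\<bar>ip (y k) v\<bar> \<le> 2 * dual_bound k * norm v" "\<bar>ip (jump k) v\<bar> \<le> 3 * dual_bound k * norm v"
proof -
  have main: "\<bar>ip (y k) \<xi> + ip (y k) \<zeta> / 2 + ip (jump k) \<xi>\<bar> \<le> dual_bound k * (norm \<xi> + norm \<zeta>)" for \<xi> \<zeta>
  proof -
    let ?B = "norm \<xi> + norm \<zeta>"
    have "ip (y k) \<xi> + ip (y k) \<zeta> / 2 + ip (jump k) \<xi> + cform k (trial (x k) (y k) (jump k)) (aff \<xi> \<zeta>) = source k \<xi> \<zeta>"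
      using step[OF k] unfolding step_eq_def jump_def by blast
    moreover have "\<bar>cform k (trial (x k) (y k) (jump k)) (aff \<xi> \<zeta>)\<bar> \<le> M * size_on k * ?B * h"
      unfolding size_on_def by (intro cform_bound[OF k] trial_L2 trial_norm aff_L2 aff_norm)
    moreover have "\<bar>cform k saw (aff \<xi> \<zeta>)\<bar> \<le> M * (h * norm \<eta>) * ?B * h"
      by (intro cform_bound[OF k] saw_L2 saw_norm aff_L2 aff_norm)
    moreover have "\<bar>if Suc k = n then h / 2 * ip \<eta> (\<xi> + \<zeta>) else 0\<bar> \<le> (if Suc k = n then h / 2 * (\<kappa> * norm \<eta>) else 0) * ?B"
    proof -
      have "\<bar>ip \<eta> (\<xi> + \<zeta>)\<bar> \<le> \<kappa> * norm \<eta> * ?B"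
        by (rule order_trans[OF ip_le]) (intro mult_left_mono norm_triangle_ineq, simp)
      then have "h / 2 * \<bar>ip \<eta> (\<xi> + \<zeta>)\<bar> \<le> h / 2 * (\<kappa> * norm \<eta> * ?B)" using h_pos by (intro mult_left_mono) auto
      then show ?thesis using h_pos by (simp add: abs_mult mult.assoc)
    qed
    moreover have "dual_bound k * ?B = M * size_on k * ?B * h
        + M * (h * norm \<eta>) * ?B * h + (if Suc k = n then h / 2 * (\<kappa> * norm \<eta>) else 0) * ?B"
      unfolding dual_bound_def by (simp add: algebra_simps)
    ultimately show ?thesis unfolding source_def by linarith
  qed
  show 1: "\<bar>ip (y k) v\<bar> \<le> 2 * dual_bound k * norm v" for v
    using main[of 0 v] by (simp add: ip.zero_right)
  show "\<bar>ip (jump k) v\<bar> \<le> 3 * dual_bound k * norm v"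
    using main[of v 0] 1[of v] by (simp add: ip.zero_right)
qed

lemma sum_dual_bound:
  "(\<Sum>k<n. (dual_bound k)\<^sup>2) \<le> h\<^sup>2 * (4 * M\<^sup>2 * (T\<^sup>2 * (norm \<eta>)\<^sup>2 + 3264 * C\<^sub>0 / \<alpha>) + \<kappa>\<^sup>2 * (norm \<eta>)\<^sup>2 / 2)"
proof -
  define B where "B = h / 2 * (\<kappa> * norm \<eta>)"
  have sq2: "(p + q)\<^sup>2 \<le> 2 * p\<^sup>2 + 2 * q\<^sup>2" for p q :: real
    using sum_squares_bound[of p q] by (simp add: power2_sum)
  have b: "(dual_bound k)\<^sup>2 \<le> 4 * M\<^sup>2 * h\<^sup>2 * (h\<^sup>2 * (norm \<eta>)\<^sup>2) + 4 * M\<^sup>2 * h\<^sup>2 * (size_on k)\<^sup>2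
      + (if k = n - 1 then 2 * B\<^sup>2 else 0)" for k
  proof -
    have "(dual_bound k)\<^sup>2 \<le> 2 * (M * (h * norm \<eta> + size_on k) * h)\<^sup>2 + 2 * (if Suc k = n then B else 0)\<^sup>2"
      unfolding dual_bound_def B_def[symmetric] by (rule sq2)
    also have "(M * (h * norm \<eta> + size_on k) * h)\<^sup>2 = M\<^sup>2 * h\<^sup>2 * (h * norm \<eta> + size_on k)\<^sup>2"
      by (simp add: power_mult_distrib)
    also have "\<dots> \<le> M\<^sup>2 * h\<^sup>2 * (2 * (h * norm \<eta>)\<^sup>2 + 2 * (size_on k)\<^sup>2)"
      by (intro mult_left_mono sq2) simp
    finally show ?thesis
      using n_pos by (cases "Suc k = n") (auto simp: power_mult_distrib algebra_simps)
  qed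
  have "(\<Sum>k<n. (dual_bound k)\<^sup>2) \<le> (\<Sum>k<n. 4 * M\<^sup>2 * h\<^sup>2 * (h\<^sup>2 * (norm \<eta>)\<^sup>2)
      + 4 * M\<^sup>2 * h\<^sup>2 * (size_on k)\<^sup>2 + (if k = n - 1 then 2 * B\<^sup>2 else 0))"
    by (intro sum_mono b)
  also have "\<dots> = 4 * M\<^sup>2 * h\<^sup>2 * (((real n * h) * h) * (norm \<eta>)\<^sup>2) + 4 * M\<^sup>2 * h\<^sup>2 * (\<Sum>k<n. (size_on k)\<^sup>2) + 2 * B\<^sup>2"
    using n_pos by (simp add: sum.distrib sum_distrib_left power2_eq_square mult_ac)
  also have "\<dots> \<le> 4 * M\<^sup>2 * h\<^sup>2 * ((T * T) * (norm \<eta>)\<^sup>2) + 4 * M\<^sup>2 * h\<^sup>2 * (3264 * C\<^sub>0 / \<alpha>) + 2 * B\<^sup>2"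
    unfolding n_h using h_le T_pos
    by (intro add_mono order_refl mult_left_mono mult_right_mono sum_size_on) auto
  also have "2 * B\<^sup>2 = h\<^sup>2 * (\<kappa>\<^sup>2 * (norm \<eta>)\<^sup>2 / 2)"
    by (simp add: B_def power_mult_distrib power_divide)
  finally show ?thesis by (simp add: power2_eq_square algebra_simps)
qed

lemma sol'_dual:
  assumes v: "v \<in> L2_space T"
  shows "\<bar>LINT t|\<mu>. ip (sol' t) (v t)\<bar> \<le> sqrt (deriv_const T M \<alpha> \<kappa> (norm \<eta>) R) * sqrt h * L2n T v"
proof -
  define g where "g t = (2 + 3 * R) / h * dual_bound (cell t)" for t
  have g0: "0 \<le> g t" for t unfolding g_def using R_nonneg h_pos dual_bound_nonneg by simp
  have g: "g \<in> L2_space T"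
    unfolding g_def[abs_def] by (rule cellwise_L2[of "\<lambda>k s. (2 + 3 * R) / h * dual_bound k"]) (intro continuous_intros)
  have "\<bar>LINT t|\<mu>. ip (sol' t) (v t)\<bar> \<le> 1 * L2n T g * L2n T v"
  proof (rule integral_product_le(2)[OF g v])
    show "(\<lambda>t. ip (sol' t) (v t)) \<in> borel_measurable \<mu>"
      by (rule borel_measurable_integrable[OF ip_integrable[OF pw_smooth_deriv_L2[OF sol_smooth] v]])
    show "AE t in \<mu>. \<bar>ip (sol' t) (v t)\<bar> \<le> 1 * norm (g t) * norm (v t)"
    proof (rule AE_I2)
      fix t assume "t \<in> space \<mu>"
      then have t: "t \<in> {0<..<T}" by simp
      then have k: "cell t < n" using cell_less[of t] by simp
      let ?d = "dual_bound (cell t)"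
      have "\<bar>ip (y (cell t)) (v t) - r' (loc t) * ip (jump (cell t)) (v t)\<bar>
          \<le> \<bar>ip (y (cell t)) (v t)\<bar> + \<bar>r' (loc t)\<bar> * \<bar>ip (jump (cell t)) (v t)\<bar>"
        unfolding abs_mult[symmetric] by (rule abs_triangle_ineq4)
      also have "\<dots> \<le> 2 * ?d * norm (v t) + R * (3 * ?d * norm (v t))"
        using dual_bounds[OF k, of "v t"] r'_le[OF loc_unit[OF t]] R_nonneg
        by (intro add_mono mult_mono) auto
      finally have "\<bar>ip (y (cell t)) (v t) - r' (loc t) * ip (jump (cell t)) (v t)\<bar> \<le> (2 + 3 * R) * ?d * norm (v t)"
        by (simp add: algebra_simps)
      from mult_left_mono[OF this, of "1 / h"]
      have "1 / h * \<bar>ip (y (cell t)) (v t) - r' (loc t) * ip (jump (cell t)) (v t)\<bar> \<le> g t * norm (v t)"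
        using h_pos by (simp add: g_def)
      moreover have "\<bar>ip (sol' t) (v t)\<bar> = 1 / h * \<bar>ip (y (cell t)) (v t) - r' (loc t) * ip (jump (cell t)) (v t)\<bar>"
        unfolding sol'_def using h_pos by (simp add: ip.scaleR_left ip.diff_left abs_mult)
      ultimately show "\<bar>ip (sol' t) (v t)\<bar> \<le> 1 * norm (g t) * norm (v t)" using g0 by simp
    qed
  qed simp
  moreover have "L2n T g \<le> sqrt (deriv_const T M \<alpha> \<kappa> (norm \<eta>) R * h)"
    unfolding L2n_def
  proof (rule real_sqrt_le_mono)
    have i: "integrable \<mu> (\<lambda>t. (norm (g t))\<^sup>2)" using g by (simp add: L2_space_def)
    have "(LINT t|\<mu>. (norm (g t))\<^sup>2) = (\<Sum>k<n. LINT t|\<mu>. cind k t * (norm (g t))\<^sup>2)"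
      by (rule integral_cells[OF i])
    also have "\<dots> = (\<Sum>k<n. LINT t|\<mu>. cind k t * (((2 + 3 * R) / h)\<^sup>2 * (dual_bound k)\<^sup>2))"
      by (intro sum.cong Bochner_Integration.integral_cong refl cind_cong) (simp add: g_def power_mult_distrib power_divide)
    also have "\<dots> = (\<Sum>k<n. h * (((2 + 3 * R) / h)\<^sup>2 * (dual_bound k)\<^sup>2))"
      by (intro sum.cong refl) (simp add: cind_integral)
    also have "\<dots> = (2 + 3 * R)\<^sup>2 / h * (\<Sum>k<n. (dual_bound k)\<^sup>2)"
      using h_pos by (simp add: sum_distrib_left power_divide power2_eq_square)
    also have "\<dots> \<le> (2 + 3 * R)\<^sup>2 / h * (h\<^sup>2 * (4 * M\<^sup>2 * (T\<^sup>2 * (norm \<eta>)\<^sup>2 + 3264 * C\<^sub>0 / \<alpha>) + \<kappa>\<^sup>2 * (norm \<eta>)\<^sup>2 / 2))"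
      using h_pos by (intro mult_left_mono sum_dual_bound) auto
    also have "\<dots> = deriv_const T M \<alpha> \<kappa> (norm \<eta>) R * h"
      using h_pos by (simp add: deriv_const_def power2_eq_square)
    finally show "(LINT t|\<mu>. (norm (g t))\<^sup>2) \<le> deriv_const T M \<alpha> \<kappa> (norm \<eta>) R * h" .
  qed
  then have "L2n T g * L2n T v \<le> sqrt (deriv_const T M \<alpha> \<kappa> (norm \<eta>) R) * sqrt h * L2n T v"
    by (intro mult_right_mono) (simp_all add: real_sqrt_mult)
  ultimately show ?thesis by linarith
qed

section \<open>The error function\<close>

text \<open>The sawtooth minus the small solution with the same functional on the discrete space. It is
  orthogonal to the discrete space, so that its Galerkin approximation vanishes, and it is close to the
  sawtooth, which belongs to the discrete space.\<close>

definition err :: "real \<Rightarrow> 'a" where "err t = saw t - sol t"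

lemma err_smooth: "pw_smooth T err (\<lambda>t. alt (cell t) *\<^sub>R \<eta> - sol' t)"
  unfolding err_def[abs_def] by (rule op_B_diff(1)[OF saw_smooth sol_smooth saw_L2])

lemma op_B_err: "v \<in> L2_space T \<Longrightarrow> op_B T emb a err v = op_B T emb a saw v - op_B T emb a sol v"
  unfolding err_def[abs_def] by (rule op_B_diff(2)[OF saw_smooth sol_smooth])

lemma err_orthogonal:
  assumes N: "n = 2 * N" and S: "subspace S" and w: "w \<in> X_delta T N S"
  shows "op_B T emb a err w = 0"
proof -
  have "op_B T emb a sol w = op_B T emb a sol
      (\<lambda>t. aff (w (real (cell t) * h)) (w (real (Suc (cell t)) * h) - w (real (cell t) * h)) t)"
    by (rule op_B_test_cong[OF X_delta_disc[OF N S w]])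
  also have "\<dots> = op_B T emb a saw w"
    unfolding op_B_saw_X_delta(1)[OF N S w]
    by (rule op_B_sol[of "\<lambda>k. w (real k * h)" "\<lambda>k. w (real (Suc k) * h) - w (real k * h)"])
  finally show ?thesis
    using op_B_err[OF pw_smooth_L2[OF X_delta_smooth[OF N S w]]] by simp
qed

text \<open>Discontinuous test functions detect the derivative of the sawtooth. This bounds the norm of the
  error function from below.\<close>

lemma op_B_err_saw_slope:
  assumes N: "n = 2 * N"
  shows "op_B T emb a err saw_slope = (T - h / 2) * ip \<eta> \<eta>"
proof -
  have k: "saw_slope = (\<lambda>t. aff (alt (cell t) *\<^sub>R \<eta>) ((\<lambda>_. 0) (cell t)) t)"
    by (auto simp: saw_slope_def aff_def)
  have "(\<Sum>k<n. alt k * h * (ip \<eta> (alt k *\<^sub>R \<eta>) + ip \<eta> 0 / 2)) = (\<Sum>k<n. h * ip \<eta> \<eta>)"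
    by (intro sum.cong) (auto simp: alt_def ip.minus_right ip.zero_right)
  also have "\<dots> = T * ip \<eta> \<eta>" using n_h by simp
  finally have s: "(\<Sum>k<n. alt k * h * (ip \<eta> (alt k *\<^sub>R \<eta>) + ip \<eta> 0 / 2)) = T * ip \<eta> \<eta>" .
  have "odd (n - 1)" using N n_pos by simp
  then have l: "alt (n - 1) = -1" by (simp add: alt_def)
  have "op_B T emb a saw saw_slope = T * ip \<eta> \<eta> + (\<Sum>k<n. cform k saw (aff (alt k *\<^sub>R \<eta>) 0))"
    using op_B_saw[of "\<lambda>k. alt k *\<^sub>R \<eta>" "\<lambda>_. 0"] unfolding k by (simp only: sum.distrib s)
  moreover have "op_B T emb a sol saw_slope = (\<Sum>k<n. cform k saw (aff (alt k *\<^sub>R \<eta>) 0)) + h / 2 * ip \<eta> \<eta>"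
    using op_B_sol[of "\<lambda>k. alt k *\<^sub>R \<eta>" "\<lambda>_. 0"] unfolding k sum_source l by (simp add: ip.minus_right)
  ultimately show ?thesis
    using op_B_err[OF saw_slope_L2] by (simp add: algebra_simps)
qed

lemma err_norm_X:
  assumes N: "n = 2 * N"
  shows "T / 2 * ip \<eta> \<eta> \<le> (sqrt M + M / sqrt \<alpha>) * (sqrt T * norm \<eta>) * norm_X T emb a err"
proof -
  have "T / 2 * ip \<eta> \<eta> \<le> (T - h / 2) * ip \<eta> \<eta>"
    using h_le T_pos by (intro mult_right_mono) auto
  also have "\<dots> \<le> (sqrt M + M / sqrt \<alpha>) * norm_X T emb a err * L2n T saw_slope"
    using op_B_le[OF err_smooth saw_slope_L2] unfolding op_B_err_saw_slope[OF N] by linarith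
  finally show ?thesis unfolding saw_slope_L2n by (simp add: mult_ac)
qed

lemma err_nonzero:
  assumes N: "n = 2 * N" and \<eta>: "blinfun_apply emb \<eta> \<noteq> 0"
  shows "\<not> eq_on_I T err (\<lambda>t. 0)"
proof
  assume "eq_on_I T err (\<lambda>t. 0)"
  then have "(T - h / 2) * ip \<eta> \<eta> = 0"
    using op_B_cong_AE[of err "\<lambda>t. 0" saw_slope] op_B_zero[OF saw_slope_L2] by (simp add: op_B_err_saw_slope[OF N])
  moreover have "ip \<eta> \<eta> > 0" "T - h / 2 > 0" using \<eta> h_le h_pos T_pos by (auto simp: ip_self)
  ultimately show False by simp
qed

lemma galerkin_unique:
  assumes N: "n = 2 * N" and S: "subspace S" and w: "is_galerkin T emb a (X_delta T N S) err w"
  shows "eq_on_I T w (\<lambda>t. 0)"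
proof -
  have wX: "w \<in> X_delta T N S" and "op_B T emb a w w = op_B T emb a err w"
    using w by (auto simp: is_galerkin_def)
  then have 0: "op_B T emb a w w = 0" using err_orthogonal[OF N S wX] by simp
  note s = X_delta_smooth[OF N S wX]
  have "\<alpha> * (L2n T w)\<^sup>2 \<le> 0"
    using op_B_self[OF s X_delta_interp(1)[OF N S wX]] 0 by simp
  then have "L2n T w = 0" using alpha_pos by (simp add: mult_le_0_iff)
  then show ?thesis by (rule L2n_zero_imp_eq_on_I[OF pw_smooth_L2[OF s]])
qed

lemma err_not_in_X_delta:
  assumes N: "n = 2 * N" and S: "subspace S" and \<eta>: "blinfun_apply emb \<eta> \<noteq> 0"
  shows "\<not> (\<exists>w\<in>X_delta T N S. eq_on_I T err w)"
proof
  assume "\<exists>w\<in>X_delta T N S. eq_on_I T err w"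
  then obtain w where w: "w \<in> X_delta T N S" "eq_on_I T err w" by blast
  then have "is_galerkin T emb a (X_delta T N S) err w"
    using op_B_cong_AE[OF w(2)] by (simp add: is_galerkin_def)
  from galerkin_unique[OF N S this] w(2) have "eq_on_I T err (\<lambda>t. 0)"
    unfolding eq_on_I_def by eventually_elim simp
  then show False using err_nonzero[OF N \<eta>] by simp
qed

lemma err_galerkin_zero:
  assumes N: "n = 2 * N" and S: "subspace S"
  shows "is_galerkin T emb a (X_delta T N S) err (\<lambda>t. 0)"
  unfolding is_galerkin_def
  using X_delta_zero err_orthogonal[OF N S] op_B_zero pw_smooth_L2[OF X_delta_smooth[OF N S]] by auto

lemma err_best_approx: "norm_X T emb a (\<lambda>t. err t - saw t) \<le> approx_const T M \<alpha> \<kappa> (norm \<eta>) R * sqrt h"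
proof -
  have e: "err t - saw t = (-1) *\<^sub>R sol t" for t by (simp add: err_def)
  have s: "pw_smooth T (\<lambda>t. err t - saw t) (\<lambda>t. (-1) *\<^sub>R sol' t)"
    unfolding e using pw_smooth_linear[OF sol_smooth bounded_linear_scaleR_right[of "-1"]] .
  have "norm_X T emb a (\<lambda>t. err t - saw t) \<le> sqrt M * L2n T (\<lambda>t. err t - saw t)
      + (sqrt (deriv_const T M \<alpha> \<kappa> (norm \<eta>) R) * sqrt h) / sqrt \<alpha> + norm (blinfun_apply emb (err T - saw T))"
  proof (rule norm_X_le[OF s])
    have "0 \<le> deriv_const T M \<alpha> \<kappa> (norm \<eta>) R"
      using C0_nonneg alpha_pos by (simp add: deriv_const_def)
    then show "0 \<le> sqrt (deriv_const T M \<alpha> \<kappa> (norm \<eta>) R) * sqrt h" using h_pos by simp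
    fix v :: "real \<Rightarrow> 'a" assume v: "v \<in> L2_space T"
    show "\<bar>LINT t|\<mu>. ip ((-1) *\<^sub>R sol' t) (v t)\<bar> \<le> sqrt (deriv_const T M \<alpha> \<kappa> (norm \<eta>) R) * sqrt h * L2n T v"
      using sol'_dual[OF v] by (simp add: ip.minus_left)
  qed
  also have "L2n T (\<lambda>t. err t - saw t) = L2n T sol" unfolding e L2n_cmult by simp
  also have "blinfun_apply emb (err T - saw T) = - blinfun_apply emb (sol T)" by (simp add: e blinfun.minus_right)
  also have "sqrt M * L2n T sol + (sqrt (deriv_const T M \<alpha> \<kappa> (norm \<eta>) R) * sqrt h) / sqrt \<alpha> + norm (- blinfun_apply emb (sol T))
     \<le> sqrt M * (sqrt (3264 * C\<^sub>0 / \<alpha>) * sqrt h) + (sqrt (deriv_const T M \<alpha> \<kappa> (norm \<eta>) R) * sqrt h) / sqrt \<alpha> + sqrt (2 * C\<^sub>0) * sqrt h"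
    using sol_L2n sol_T_le M_pos by (intro add_mono mult_left_mono) auto
  finally show ?thesis by (simp add: approx_const_def algebra_simps)
qed

lemma err_trace_0: "trace_at T emb err 0 = 0"
  using trace_at_eq[OF err_smooth, of 0] T_pos by (simp add: err_def saw_0 sol_0 blinfun.zero_right)

lemma err_not_quasi_optimal:
  assumes N: "n = 2 * N" and S: "subspace S" "\<eta> \<in> S" and \<eta>: "blinfun_apply emb \<eta> \<noteq> 0"
    and A: "approx_const T M \<alpha> \<kappa> (norm \<eta>) R \<le> A" "A > 0"
  shows "(T / 2 * ip \<eta> \<eta>) / ((sqrt M + M / sqrt \<alpha>) * (sqrt T * norm \<eta>)) / A * h powr (-1/2) *
      (INF w\<in>X_delta T N S. norm_X T emb a (\<lambda>t. err t - w t)) \<le> norm_X T emb a err"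
proof -
  let ?c = "(T / 2 * ip \<eta> \<eta>) / ((sqrt M + M / sqrt \<alpha>) * (sqrt T * norm \<eta>))"
  let ?I = "INF w\<in>X_delta T N S. norm_X T emb a (\<lambda>t. err t - w t)"
  have "\<eta> \<noteq> 0" using \<eta> by (auto simp: blinfun.zero_right)
  moreover have "sqrt M + M / sqrt \<alpha> > 0" using M_pos alpha_pos by (intro add_pos_pos) auto
  ultimately have p: "(sqrt M + M / sqrt \<alpha>) * (sqrt T * norm \<eta>) > 0" using T_pos by simp
  have "?I \<le> norm_X T emb a (\<lambda>t. err t - saw t)"
    using saw_in_X_delta[OF N S(2)] norm_X_nonneg by (intro cINF_lower bdd_belowI2[of _ 0]) auto
  also have "\<dots> \<le> A * sqrt h"
    using err_best_approx A(1) h_pos by (meson mult_right_mono order_trans real_sqrt_ge_zero less_imp_le)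
  finally have I: "?I \<le> A * sqrt h" .
  have c0: "0 \<le> ?c" using p T_pos by simp
  have "?c / A * h powr (-1/2) * ?I \<le> ?c / A * h powr (-1/2) * (A * sqrt h)"
  proof (rule mult_left_mono[OF I])
    have "0 \<le> ?c / A" using c0 A(2) by (rule divide_nonneg_pos)
    then show "0 \<le> ?c / A * h powr (-1/2)" by (rule mult_nonneg_nonneg) simp
  qed
  also have "\<dots> = ?c * (h powr (-1/2) * h powr (1/2))"
    using A(2) h_pos by (simp add: powr_half_sqrt)
  also have "h powr (-1/2) * h powr (1/2) = 1" using h_pos by (simp flip: powr_add)
  also have "?c * 1 \<le> norm_X T emb a err"
  proof -
    have "L / K * 1 \<le> X" if "L \<le> K * X" "K > 0" for L K X :: real
      using that by (simp add: pos_divide_le_eq mult.commute)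
    from this[OF err_norm_X[OF N] p] show ?thesis .
  qed
  finally show ?thesis .
qed

end

section \<open>Lack of quasi-optimality\<close>

theorem mainTheorem6:
  fixes T :: real
    and emb :: "'v::{real_inner,complete_space,second_countable_topology} \<Rightarrow>\<^sub>L
                'h::{real_inner,complete_space,second_countable_topology}"
    and a :: "real \<Rightarrow> 'v \<Rightarrow> 'v \<Rightarrow> real"
    and \<Delta> :: "'d set"
    and N :: "'d \<Rightarrow> nat"
    and Xx :: "'d \<Rightarrow> 'v set"
  assumes "T > 0"
    and "gelfand_embedding emb"
    and "parabolic_form T a"
    and "\<forall>u\<in>Y_space T. \<forall>v\<in>Y_space T. op_A T a u v = op_As T a u v"
    and "\<forall>\<delta>\<in>\<Delta>. N \<delta> \<ge> 1"
    and "\<forall>\<delta>\<in>\<Delta>. subspace (Xx \<delta>) \<and> closed (Xx \<delta>)"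
    and "(\<Inter>\<delta>\<in>\<Delta>. Xx \<delta>) \<noteq> {0}"
  shows
    "(\<exists>C>0. \<forall>\<delta>\<in>\<Delta>.
        (INF z\<in>nonzero_in T (X_delta T (N \<delta>) (Xx \<delta>)).
           SUP v\<in>nonzero_in T (X_delta T (N \<delta>) (Xx \<delta>)).
             ereal (\<bar>op_B T emb a z v\<bar> / (norm_X T emb a z * norm_Y T a v)))
        \<le> ereal (C * sqrt (mesh T (N \<delta>)))) \<and>
     (\<exists>c>0. \<forall>\<delta>\<in>\<Delta>. \<exists>u\<in>X_space T emb.
        trace_at T emb u 0 = 0 \<and>
        \<not> (\<exists>w\<in>X_delta T (N \<delta>) (Xx \<delta>). eq_on_I T u w) \<and>
        (\<exists>u\<delta>. is_galerkin T emb a (X_delta T (N \<delta>) (Xx \<delta>)) u u\<delta> \<and>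
           (\<forall>w. is_galerkin T emb a (X_delta T (N \<delta>) (Xx \<delta>)) u w \<longrightarrow> eq_on_I T w u\<delta>) \<and>
           norm_X T emb a (\<lambda>t. u t - u\<delta> t) \<ge>
             c * mesh T (N \<delta>) powr (-1/2) *
             (INF w\<in>X_delta T (N \<delta>) (Xx \<delta>). norm_X T emb a (\<lambda>t. u t - w t))))"
proof (cases "\<Delta> = {}")
  case True
  then show ?thesis by (auto intro: exI[of _ 1])
next
  case False
  then obtain \<delta>\<^sub>0 where \<delta>0: "\<delta>\<^sub>0 \<in> \<Delta>" by blast
  have sub: "subspace (Xx \<delta>)" if "\<delta> \<in> \<Delta>" for \<delta> using assms(6) that by blast
  have "0 \<in> (\<Inter>\<delta>\<in>\<Delta>. Xx \<delta>)" using sub subspace_0 by blast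
  then obtain \<eta> where \<eta>_in: "\<And>\<delta>. \<delta> \<in> \<Delta> \<Longrightarrow> \<eta> \<in> Xx \<delta>" and \<eta>0: "\<eta> \<noteq> 0"
    using assms(7) by blast
  have emb_\<eta>: "blinfun_apply emb \<eta> \<noteq> 0"
  proof
    assume "blinfun_apply emb \<eta> = 0"
    then have "blinfun_apply emb \<eta> = blinfun_apply emb 0" by (simp add: blinfun.zero_right)
    moreover have "inj (blinfun_apply emb)" using assms(2) by (simp add: gelfand_embedding_def)
    ultimately show False using \<eta>0 by (metis injD)
  qed
  obtain M\<^sub>0 where M0: "AE t in lebesgue_on {0<..<T}. \<forall>\<eta> \<zeta>. \<bar>a t \<eta> \<zeta>\<bar> \<le> M\<^sub>0 * norm \<eta> * norm \<zeta>"
    using assms(3) by (auto simp: parabolic_form_def)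
  obtain \<alpha> where \<alpha>: "\<alpha> > 0" "AE t in lebesgue_on {0<..<T}. \<forall>\<eta>. a t \<eta> \<eta> \<ge> \<alpha> * (norm \<eta>)\<^sup>2"
    using assms(3) by (auto simp: parabolic_form_def)
  define M where "M = max M\<^sub>0 1"
  interpret parabolic_problem T a M \<alpha> emb
  proof unfold_locales
    show "AE t in lebesgue_on {0<..<T}. \<forall>\<eta> \<zeta>. \<bar>a t \<eta> \<zeta>\<bar> \<le> M * norm \<eta> * norm \<zeta>"
      using M0
    proof eventually_elim
      case (elim t)
      show ?case
      proof (intro allI)
        fix \<eta> \<zeta> :: 'v
        have "M\<^sub>0 * norm \<eta> * norm \<zeta> \<le> M * norm \<eta> * norm \<zeta>"
          by (intro mult_right_mono) (auto simp: M_def)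
        then show "\<bar>a t \<eta> \<zeta>\<bar> \<le> M * norm \<eta> * norm \<zeta>" using elim order_trans by blast
      qed
    qed
  qed (use assms(1,3) \<alpha> in \<open>auto simp: M_def parabolic_form_def\<close>)
  have "\<alpha>\<^sup>2 / (64 * M\<^sup>2) > 0" using alpha_pos M_pos by simp
  then obtain r r' P I\<^sub>2 m\<^sub>2 :: "real \<Rightarrow> real" and R :: real where prof:
    "\<And>s. (r has_real_derivative r' s) (at s)" "continuous_on UNIV r'" "r 0 = 1" "r 1 = 0"
    "\<And>s. (P has_real_derivative r s) (at s)" "P 0 = 0" "P 1 = 0"
    "\<And>s. s \<in> {0..1} \<Longrightarrow> \<bar>r s\<bar> \<le> 4" "\<And>s. s \<in> {0..1} \<Longrightarrow> \<bar>r' s\<bar> \<le> R"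
    "\<And>s. (I\<^sub>2 has_real_derivative m\<^sub>2 s) (at s)" "continuous_on UNIV m\<^sub>2"
    "\<And>s. s \<in> {0..1} \<Longrightarrow> (r s)\<^sup>2 \<le> m\<^sub>2 s" "I\<^sub>2 1 - I\<^sub>2 0 \<le> \<alpha>\<^sup>2 / (64 * M\<^sup>2)"
    by (rule radau_profile) blast
  have scheme: "dg_scheme T a M \<alpha> (mesh T (N \<delta>)) (2 * N \<delta>) r r' P m\<^sub>2 I\<^sub>2 R" if "\<delta> \<in> \<Delta>" for \<delta>
  proof unfold_locales
    show "1 \<le> 2 * N \<delta>" using assms(5) that by fastforce
    show "mesh T (N \<delta>) = T / real (2 * N \<delta>)" by (simp add: mesh_def)
  qed (use T_pos prof in auto)
  \<comment> \<open>the profile, and with it \<open>R\<close>, depends on the form only, so that the constants are uniform\<close>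
  let ?C = "((norm emb)\<^sup>2 + M * T) * norm \<eta> / sqrt \<alpha> / (T * ip \<eta> \<eta> / (sqrt M * sqrt T * norm \<eta>))"
  let ?A = "max 1 (approx_const T M \<alpha> ((norm emb)\<^sup>2) (norm \<eta>) R)"
  let ?c = "(T / 2 * ip \<eta> \<eta>) / ((sqrt M + M / sqrt \<alpha>) * (sqrt T * norm \<eta>)) / ?A"
  have ip_pos: "ip \<eta> \<eta> > 0" using emb_\<eta> by (simp add: ip_self)
  have c_pos: "?c > 0"
    using ip_pos T_pos M_pos alpha_pos \<eta>0
    by (intro divide_pos_pos mult_pos_pos add_pos_pos) auto
  have C_pos: "?C > 0"
    using ip_pos T_pos M_pos alpha_pos \<eta>0
    by (intro divide_pos_pos mult_pos_pos add_nonneg_pos) auto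
  have part1: "(INF z\<in>nonzero_in T (X_delta T (N \<delta>) (Xx \<delta>)). SUP v\<in>nonzero_in T (X_delta T (N \<delta>) (Xx \<delta>)).
             ereal (\<bar>op_B T emb a z v\<bar> / (norm_X T emb a z * norm_Y T a v)))
        \<le> ereal (?C * sqrt (mesh T (N \<delta>)))" if \<delta>: "\<delta> \<in> \<Delta>" for \<delta>
  proof -
    interpret s: dg_scheme T a M \<alpha> emb "mesh T (N \<delta>)" "2 * N \<delta>" r r' P m\<^sub>2 I\<^sub>2 R \<eta> by (rule scheme[OF \<delta>])
    have "1 \<le> N \<delta>" using assms(5) \<delta> by blast
    then show ?thesis by (rule s.inf_sup_le[OF refl _ sub[OF \<delta>] \<eta>_in[OF \<delta>] \<eta>0 emb_\<eta>])
  qed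
  have part2: "\<exists>u\<in>X_space T emb.
        trace_at T emb u 0 = 0 \<and>
        \<not> (\<exists>w\<in>X_delta T (N \<delta>) (Xx \<delta>). eq_on_I T u w) \<and>
        (\<exists>u\<delta>. is_galerkin T emb a (X_delta T (N \<delta>) (Xx \<delta>)) u u\<delta> \<and>
           (\<forall>w. is_galerkin T emb a (X_delta T (N \<delta>) (Xx \<delta>)) u w \<longrightarrow> eq_on_I T w u\<delta>) \<and>
           norm_X T emb a (\<lambda>t. u t - u\<delta> t) \<ge>
             ?c * mesh T (N \<delta>) powr (-1/2) *
             (INF w\<in>X_delta T (N \<delta>) (Xx \<delta>). norm_X T emb a (\<lambda>t. u t - w t)))" if \<delta>: "\<delta> \<in> \<Delta>" for \<delta>
  proof -
    interpret s: dg_scheme T a M \<alpha> emb "mesh T (N \<delta>)" "2 * N \<delta>" r r' P m\<^sub>2 I\<^sub>2 R \<eta> by (rule scheme[OF \<delta>])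
    obtain x y E where "E 0 = 0" "\<And>k. k < 2 * N \<delta> \<Longrightarrow> E (Suc k) = x k + y k"
      "\<And>k. k < 2 * N \<delta> \<Longrightarrow> s.step_eq k (E k) (x k) (y k)"
      using s.scheme_exists by blast
    then interpret d: dg_solution T a M \<alpha> emb "mesh T (N \<delta>)" "2 * N \<delta>" r r' P m\<^sub>2 I\<^sub>2 R \<eta> x y E
      by unfold_locales auto
    show ?thesis
    proof (intro bexI[of _ d.err] conjI exI[of _ "\<lambda>t. 0"] allI impI)
      show "d.err \<in> X_space T emb" by (rule pw_smooth_X_space[OF d.err_smooth])
      show "trace_at T emb d.err 0 = 0" by (rule d.err_trace_0)
      show "\<not> (\<exists>w\<in>X_delta T (N \<delta>) (Xx \<delta>). eq_on_I T d.err w)"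
        by (rule d.err_not_in_X_delta[OF refl sub[OF \<delta>] emb_\<eta>])
      show "is_galerkin T emb a (X_delta T (N \<delta>) (Xx \<delta>)) d.err (\<lambda>t. 0)"
        by (rule d.err_galerkin_zero[OF refl sub[OF \<delta>]])
      show "eq_on_I T w (\<lambda>t. 0)" if "is_galerkin T emb a (X_delta T (N \<delta>) (Xx \<delta>)) d.err w" for w
        by (rule d.galerkin_unique[OF refl sub[OF \<delta>] that])
      show "?c * mesh T (N \<delta>) powr (-1/2) *
             (INF w\<in>X_delta T (N \<delta>) (Xx \<delta>). norm_X T emb a (\<lambda>t. d.err t - w t)) \<le> norm_X T emb a (\<lambda>t. d.err t - 0)"
        using d.err_not_quasi_optimal[OF refl sub[OF \<delta>] \<eta>_in[OF \<delta>] emb_\<eta>, of ?A] by simp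
    qed
  qed
  show ?thesis
    using C_pos c_pos part1 part2 by (intro conjI exI[of _ ?C] exI[of _ ?c]) blast+
qed

end
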